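(* Let $\mathcal{E}$ be the class of Mackey-complete locally convex spaces $E$ such that for every $n\geq 1$, the $c^{\infty}$-topology on $E^n$ is the same as the product topology for the given topology on $E$, and let $\mathcal{M}$ be the class of Mackey-complete locally convex spaces. Then: (i) If $M=(M_0,\mathcal{A})$ is a smooth $\mathcal{E}$-manifold, $N=(N_0,\mathcal{B})$ a smooth $\mathcal{M}$-manifold, and $\Phi:M_0\longrightarrow N_0$ a continuous map, then $\Phi$ is smooth if and only if $\Phi:(M_0,\mathcal{C}^{\infty}_M)\longrightarrow(N_0,\mathcal{C}^{\infty}_N)$ is a morphism of locally ringed spaces. (ii) For every structure sheaf-smooth $\mathcal{E}$-manifold $(M_0,\mathcal{O}_M)$, there is a canonical maximal atlas $\mathcal{A}$ on $M_0$ such that $M=(M_0,\mathcal{A})$ is a smooth $\mathcal{E}$-manifold fulfilling $\mathcal{C}^{\infty}_M=\mathcal{O}_M$. Furthermore, the maximal atlas $\mathcal{A}$ is uniquely determined by the condition $\mathcal{C}^{\infty}_M=\mathcal{O}_M$.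
   Context: Locally convex spaces are real and Hausdorff. Smoothness: for $E,F$ locally convex, $U\subset E$ open and $\Phi:U\to F$ continuous, put $d\Phi_{|x}(v)=\lim_{t\to 0}\frac{\Phi(x+tv)-\Phi(x)}{t}$. $\Phi$ is $\mathcal{C}^1$ if $d\Phi:U\times E\to F$, $(x,v)\mapsto d\Phi_{|x}(v)$ exists everywhere and is continuous; inductively $\Phi$ is $\mathcal{C}^{k+1}$ if it is $\mathcal{C}^1$ and $d\Phi$ is $\mathcal{C}^k$; $\Phi$ is smooth if it is $\mathcal{C}^k$ for all $k$. The $c^\infty$-topology on a locally convex space $E$ is the finest topology on $E$ making all smooth curves $c:\mathbb{R}\to E$ continuous. A net $(x_i)$ in $E$ is Mackey-Cauchy if there exist an absolutely convex bounded set $B\subset E$ and a double net $(\mu_{i,j})$ of reals converging to $0$ with $x_i-x_j\in\mu_{i,j}B$ for all $i,j$; $E$ is Mackey-complete if every Mackey-Cauchy net in $E$ converges. Manifolds: let $\mathcal{E}$ be a class of locally convex spaces containing all $\mathbb{R}^n$. A smooth $\mathcal{E}$-atlas on a Hausdorff space $M_0$ is a family of pairs $(U_\alpha,\varphi_\alpha)$ such that the $U_\alpha$ form an open cover of $M_0$, each $\varphi_\alpha$ is a homeomorphism from $U_\alpha$ onto an open subset of some $E_\alpha\in\mathcal{E}$, and all transition maps $\varphi_\alpha\circ\varphi_\beta^{-1}:\varphi_\beta(U_\alpha\cap U_\beta)\to\varphi_\alpha(U_\alpha\cap U_\beta)$ are smooth. The atlas is maximal if it contains every chart (with values in spaces of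 $\mathcal{E}$) smoothly compatible with it. A smooth $\mathcal{E}$-manifold is a pair $M=(M_0,\mathcal{A})$ with $M_0$ Hausdorff (no countability assumption) and $\mathcal{A}$ a maximal smooth $\mathcal{E}$-atlas. A continuous map $\Phi:M_0\to N_0$ between manifolds $(M_0,\mathcal{A})$, $(N_0,\mathcal{B})$ is smooth if for all $(U,\varphi)\in\mathcal{A}$, $(V,\psi)\in\mathcal{B}$ with $\Phi(U)\subset V$, the map $\psi\circ\Phi_{|U}\circ\varphi^{-1}:\varphi(U)\to\psi(V)$ is smooth. $\mathcal{C}^\infty_M$ is the sheaf on $M_0$ assigning to each open $U\subset M_0$ the $\mathbb{R}$-algebra of smooth functions $U\to\mathbb{R}$. Ringed spaces: locally ringed spaces here have structure sheaves of unital commutative $\mathbb{R}$-algebras with local stalks, and a morphism $(X_0,\mathcal{O}_X)\to(Y_0,\mathcal{O}_Y)$ is a pair $(\Phi_0,\Phi^\sharp)$ with $\Phi_0:X_0\to Y_0$ continuous and $\Phi^\sharp:\mathcal{O}_Y\to(\Phi_0)_*\mathcal{O}_X$ a morphism of sheaves of unital $\mathbb{R}$-algebras inducing local homomorphisms on stalks. A locally ringed space is reduced if $\mathcal{O}_X$ is a subsheaf of the sheaf $\mathcal{C}^0_{X_0}$ of continuous real-valued functions. Between reduced locally ringed spaces, $\Phi^\sharp$ is the pullback $g\mapsto g\circ\Phi_0$, so a morphism is identified with its underlying continuous map; thus a continuous map $\Phi$ is "a morphism of locally ringed spaces" when the pullback by $\Phi$ gives such a $\Phi^\sharp$, i.e.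 maps $\mathcal{O}_Y(W)$ into $\mathcal{O}_X(\Phi^{-1}(W))$ for all open $W$. A structure sheaf-smooth $\mathcal{E}$-manifold is a reduced locally ringed space whose underlying space is Hausdorff and which is locally isomorphic, as a locally ringed space, to models $(D_0,\mathcal{C}^\infty_D)$, where $D_0$ is an open subset of a space from $\mathcal{E}$ and $\mathcal{C}^\infty_D$ is its sheaf of smooth real-valued functions. *)

theory Defs
  imports "HOL-Analysis.Analysis" "HOL-Algebra.Module" "HOL-Algebra.Ideal"
begin

section \<open>Locally convex spaces\<close>

text \<open>
  Charts of one manifold take values in different spaces, so a space is a record with an explicit
  carrier inside an arbitrary type, and a class of spaces is a set of such records over that type.
  The fields \<open>mult\<close> and \<open>one\<close> inherited from \<open>module\<close> play no role.
\<close>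

definition real_ring :: "real ring" where
  "real_ring = \<lparr>carrier = UNIV, mult = (*), one = 1, zero = 0, add = (+)\<rparr>"

record 'a tvs = "(real, 'a) module" +
  topo :: "'a topology"

definition convex_in :: "'a tvs \<Rightarrow> 'a set \<Rightarrow> bool" where
  "convex_in E C \<longleftrightarrow> (\<forall>x\<in>C. \<forall>y\<in>C. \<forall>a b. 0 \<le> a \<and> 0 \<le> b \<and> a + b = 1
      \<longrightarrow> a \<odot>\<^bsub>E\<^esub> x \<oplus>\<^bsub>E\<^esub> b \<odot>\<^bsub>E\<^esub> y \<in> C)"

definition absolutely_convex_in :: "'a tvs \<Rightarrow> 'a set \<Rightarrow> bool" where
  "absolutely_convex_in E C \<longleftrightarrow> (\<forall>x\<in>C. \<forall>y\<in>C. \<forall>a b. \<bar>a\<bar> + \<bar>b\<bar> \<le> 1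
      \<longrightarrow> a \<odot>\<^bsub>E\<^esub> x \<oplus>\<^bsub>E\<^esub> b \<odot>\<^bsub>E\<^esub> y \<in> C)"

definition bounded_in :: "'a tvs \<Rightarrow> 'a set \<Rightarrow> bool" where
  "bounded_in E B \<longleftrightarrow> B \<subseteq> carrier E \<and>
     (\<forall>U. openin (topo E) U \<and> \<zero>\<^bsub>E\<^esub> \<in> U \<longrightarrow> (\<exists>r>0. B \<subseteq> (\<lambda>u. r \<odot>\<^bsub>E\<^esub> u) ` U))"

definition lcs :: "'a tvs \<Rightarrow> bool" where
  "lcs E \<longleftrightarrow> Module.module real_ring E \<and> topspace (topo E) = carrier E \<and> Hausdorff_space (topo E) \<and>
     continuous_map (prod_topology (topo E) (topo E)) (topo E) (\<lambda>(x, y). x \<oplus>\<^bsub>E\<^esub> y) \<and>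
     continuous_map (prod_topology euclideanreal (topo E)) (topo E) (\<lambda>(a, x). a \<odot>\<^bsub>E\<^esub> x) \<and>
     (\<forall>U. openin (topo E) U \<and> \<zero>\<^bsub>E\<^esub> \<in> U \<longrightarrow>
        (\<exists>C W. convex_in E C \<and> openin (topo E) W \<and> \<zero>\<^bsub>E\<^esub> \<in> W \<and> W \<subseteq> C \<and> C \<subseteq> U))"

definition real_tvs :: "real tvs" where
  "real_tvs = \<lparr>carrier = UNIV, mult = (*), one = 1, zero = 0, add = (+), smult = (*),
     topo = euclideanreal\<rparr>"

definition prod_tvs :: "'a tvs \<Rightarrow> 'b tvs \<Rightarrow> ('a \<times> 'b) tvs" where
  "prod_tvs E F = \<lparr>carrier = carrier E \<times> carrier F, mult = undefined, one = undefined,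
     zero = (\<zero>\<^bsub>E\<^esub>, \<zero>\<^bsub>F\<^esub>),
     add = (\<lambda>(x, y) (x', y'). (x \<oplus>\<^bsub>E\<^esub> x', y \<oplus>\<^bsub>F\<^esub> y')),
     smult = (\<lambda>a (x, y). (a \<odot>\<^bsub>E\<^esub> x, a \<odot>\<^bsub>F\<^esub> y)),
     topo = prod_topology (topo E) (topo F)\<rparr>"

definition power_tvs :: "'a tvs \<Rightarrow> nat \<Rightarrow> (nat \<Rightarrow> 'a) tvs" where
  "power_tvs E n = \<lparr>carrier = (\<Pi>\<^sub>E i\<in>{..<n}. carrier E), mult = undefined, one = undefined,
     zero = (\<lambda>i\<in>{..<n}. \<zero>\<^bsub>E\<^esub>),
     add = (\<lambda>x y. \<lambda>i\<in>{..<n}. x i \<oplus>\<^bsub>E\<^esub> y i),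
     smult = (\<lambda>a x. \<lambda>i\<in>{..<n}. a \<odot>\<^bsub>E\<^esub> x i),
     topo = product_topology (\<lambda>_. topo E) {..<n}\<rparr>"

text \<open>Transport of structure along an injection \<open>h\<close> with left inverse \<open>g\<close>.\<close>

definition transport_tvs :: "('a \<Rightarrow> 'b) \<Rightarrow> ('b \<Rightarrow> 'a) \<Rightarrow> 'a tvs \<Rightarrow> 'b tvs" where
  "transport_tvs h g E = \<lparr>carrier = h ` carrier E, mult = undefined, one = undefined,
     zero = h \<zero>\<^bsub>E\<^esub>,
     add = (\<lambda>x y. h (g x \<oplus>\<^bsub>E\<^esub> g y)),
     smult = (\<lambda>a x. h (a \<odot>\<^bsub>E\<^esub> g x)),
     topo = pullback_topology (h ` carrier E) g (topo E)\<rparr>"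


section \<open>Smooth maps\<close>

text \<open>
  The recursion ``\<open>\<Phi>\<close> is \<open>C\<^sup>k\<^sup>+\<^sup>1\<close> iff it is \<open>C\<^sup>1\<close> and \<open>d\<Phi> : U \<times> E \<rightarrow> F\<close> is \<open>C\<^sup>k\<close>'' replaces \<open>E\<close> by
  \<open>E \<times> E\<close> and would therefore change the type at every step. The following datatype contains \<open>'a\<close>
  and is closed under pairing, so that all iterated squares of \<open>E\<close> live in the single type
  \<open>'a iter\<close>.
\<close>

datatype 'a iter = Base (unBase: 'a) | Pair (pfst: "'a iter") (psnd: "'a iter")

definition base_tvs :: "'a tvs \<Rightarrow> 'a iter tvs" where
  "base_tvs = transport_tvs Base unBase"

definition square_tvs :: "'a iter tvs \<Rightarrow> 'a iter tvs" where
  "square_tvs E = transport_tvs (\<lambda>(x, v). Pair x v) (\<lambda>p. (pfst p, psnd p)) (prod_tvs E E)"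

text \<open>
  In the successor step \<open>d\<close> is the differential; being \<open>C\<^sup>k\<close>, it is in particular continuous.
  Only values on \<open>U\<close> matter, since \<open>x + t v \<in> U\<close> for \<open>t\<close> near \<open>0\<close>.
\<close>

primrec Ck :: "nat \<Rightarrow> 'a iter tvs \<Rightarrow> 'b tvs \<Rightarrow> 'a iter set \<Rightarrow> ('a iter \<Rightarrow> 'b) \<Rightarrow> bool" where
  "Ck 0 E F U \<Phi> \<longleftrightarrow> continuous_map (subtopology (topo E) U) (topo F) \<Phi>"
| "Ck (Suc k) E F U \<Phi> \<longleftrightarrow> continuous_map (subtopology (topo E) U) (topo F) \<Phi> \<and>
     (\<exists>d. (\<forall>x\<in>U. \<forall>v\<in>carrier E.
             limitin (topo F) (\<lambda>t. (1 / t) \<odot>\<^bsub>F\<^esub> (\<Phi> (x \<oplus>\<^bsub>E\<^esub> t \<odot>\<^bsub>E\<^esub> v) \<ominus>\<^bsub>F\<^esub> \<Phi> x)) (d (Pair x v)) (at 0)) \<and>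
          Ck k (square_tvs E) F {Pair x v |x v. x \<in> U \<and> v \<in> carrier E} d)"

definition smooth_map :: "'a tvs \<Rightarrow> 'b tvs \<Rightarrow> 'a set \<Rightarrow> ('a \<Rightarrow> 'b) \<Rightarrow> bool" where
  "smooth_map E F U \<Phi> \<longleftrightarrow> openin (topo E) U \<and>
     (\<forall>k. Ck k (base_tvs E) F (Base ` U) (\<Phi> \<circ> unBase))"


section \<open>The \<open>c\<^sup>\<infinity>\<close>-topology\<close>

definition cinf_topology :: "'a tvs \<Rightarrow> 'a topology" where
  "cinf_topology E = topology (\<lambda>V. V \<subseteq> carrier E \<and>
     (\<forall>c. smooth_map real_tvs E UNIV c \<longrightarrow> open (c -` V)))"

lemma openin_cinf_topology:
  "openin (cinf_topology E) V \<longleftrightarrow> V \<subseteq> carrier E \<and>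
     (\<forall>c. smooth_map real_tvs E UNIV c \<longrightarrow> open (c -` V))"
proof -
  have "istopology (\<lambda>V. V \<subseteq> carrier E \<and> (\<forall>c. smooth_map real_tvs E UNIV c \<longrightarrow> open (c -` V)))"
    unfolding istopology_def by (auto simp: vimage_Union)
  then show ?thesis
    unfolding cinf_topology_def by (simp add: topology_inverse')
qed

lemma smooth_curve_continuous:
  assumes "smooth_map real_tvs E UNIV c"
  shows "continuous_map euclideanreal (topo E) c"
proof -
  have "Ck 0 (base_tvs real_tvs) E (Base ` UNIV) (c \<circ> unBase)"
    using assms unfolding smooth_map_def by blast
  then have c: "continuous_map (pullback_topology (range Base) unBase euclideanreal) (topo E) (c \<circ> unBase)"
    by (simp add: base_tvs_def transport_tvs_def real_tvs_def subtopology_superset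
        topspace_pullback_topology)
  have "continuous_map euclideanreal (pullback_topology (range Base) unBase euclideanreal) Base"
    by (rule continuous_map_pullback') (auto simp: o_def)
  from continuous_map_compose[OF this c] show ?thesis
    by (simp add: o_def)
qed

lemma lcs_topspace: "lcs E \<Longrightarrow> topspace (topo E) = carrier E"
  unfolding lcs_def by (elim conjE)

lemma topspace_cinf_topology:
  assumes "lcs E"
  shows "topspace (cinf_topology E) = carrier E"
proof
  show "topspace (cinf_topology E) \<subseteq> carrier E"
    using openin_cinf_topology[of E "topspace (cinf_topology E)"] by simp
  have "c -` carrier E = UNIV" if "smooth_map real_tvs E UNIV c" for c
  proof -
    have "c x \<in> topspace (topo E)" for x
      using continuous_map_image_subset_topspace[OF smooth_curve_continuous[OF that]] by auto
    then show ?thesis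
      using lcs_topspace[OF assms] by auto
  qed
  then have "openin (cinf_topology E) (carrier E)"
    by (simp add: openin_cinf_topology)
  then show "carrier E \<subseteq> topspace (cinf_topology E)"
    by (rule openin_subset)
qed

lemma cinf_topology_smooth_curve:
  assumes "lcs E" "smooth_map real_tvs E UNIV c"
  shows "continuous_map euclideanreal (cinf_topology E) c"
proof -
  have c: "c \<in> UNIV \<rightarrow> carrier E"
    using continuous_map_image_subset_topspace[OF smooth_curve_continuous[OF assms(2)]]
      lcs_topspace[OF assms(1)] by auto
  have "openin euclideanreal {x \<in> topspace euclideanreal. c x \<in> V}"
    if "openin (cinf_topology E) V" for V
  proof -
    have "open (c -` V)"
      using that assms(2) by (simp add: openin_cinf_topology)
    then show ?thesis
      by (simp add: vimage_def)
  qed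
  with c show ?thesis
    unfolding continuous_map_def topspace_cinf_topology[OF assms(1)] by simp
qed

lemma cinf_topology_finest:
  assumes "topspace T = carrier E"
    and "\<And>c. smooth_map real_tvs E UNIV c \<Longrightarrow> continuous_map euclideanreal T c"
    and "openin T V"
  shows "openin (cinf_topology E) V"
  unfolding openin_cinf_topology
proof (intro conjI allI impI)
  show "V \<subseteq> carrier E"
    using openin_subset[OF assms(3)] assms(1) by simp
  fix c assume "smooth_map real_tvs E UNIV c"
  then have "openin euclideanreal {x \<in> topspace euclideanreal. c x \<in> V}"
    by (intro openin_continuous_map_preimage[OF assms(2) assms(3)])
  then show "open (c -` V)"
    by (simp add: vimage_def)
qed


section \<open>Mackey-completeness\<close>

definition directed_on :: "'i set \<Rightarrow> ('i \<Rightarrow> 'i \<Rightarrow> bool) \<Rightarrow> bool" where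
  "directed_on D leq \<longleftrightarrow> D \<noteq> {} \<and> (\<forall>i\<in>D. leq i i) \<and>
     (\<forall>i\<in>D. \<forall>j\<in>D. \<forall>k\<in>D. leq i j \<and> leq j k \<longrightarrow> leq i k) \<and>
     (\<forall>i\<in>D. \<forall>j\<in>D. \<exists>k\<in>D. leq i k \<and> leq j k)"

definition net_filter :: "'i set \<Rightarrow> ('i \<Rightarrow> 'i \<Rightarrow> bool) \<Rightarrow> 'i filter" where
  "net_filter D leq = (INF i\<in>D. principal {j \<in> D. leq i j})"

definition mackey_cauchy :: "'a tvs \<Rightarrow> 'i set \<Rightarrow> ('i \<Rightarrow> 'i \<Rightarrow> bool) \<Rightarrow> ('i \<Rightarrow> 'a) \<Rightarrow> bool" where
  "mackey_cauchy E D leq x \<longleftrightarrow> x ` D \<subseteq> carrier E \<and>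
     (\<exists>B \<mu>. absolutely_convex_in E B \<and> bounded_in E B \<and>
        ((\<lambda>(i, j). \<mu> i j) \<longlongrightarrow> (0::real)) (net_filter D leq \<times>\<^sub>F net_filter D leq) \<and>
        (\<forall>i\<in>D. \<forall>j\<in>D. x i \<ominus>\<^bsub>E\<^esub> x j \<in> (\<lambda>b. \<mu> i j \<odot>\<^bsub>E\<^esub> b) ` B))"

text \<open>
  A definition cannot quantify over the types of index sets. Index sets inside \<open>'a set \<times> 'a\<close> (the
  type indexing the net of a filter on \<open>'a\<close>) suffice: the lemma \<open>mackey_complete_net\<close>
  below recovers convergence of Mackey-Cauchy nets over index sets of any type.
\<close>

definition mackey_complete :: "'a tvs \<Rightarrow> bool" where
  "mackey_complete E \<longleftrightarrow> (\<forall>(D :: ('a set \<times> 'a) set) leq x.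
     directed_on D leq \<and> mackey_cauchy E D leq x \<longrightarrow> (\<exists>l. limitin (topo E) x l (net_filter D leq)))"

lemma directed_on_trans:
  "directed_on D leq \<Longrightarrow> i \<in> D \<Longrightarrow> j \<in> D \<Longrightarrow> k \<in> D \<Longrightarrow> leq i j \<Longrightarrow> leq j k \<Longrightarrow> leq i k"
  unfolding directed_on_def by meson

lemma directed_on_upper:
  assumes "directed_on D leq" "i \<in> D" "j \<in> D"
  obtains k where "k \<in> D" "leq i k" "leq j k"
  using assms unfolding directed_on_def by meson

lemma eventually_net_filter:
  assumes D: "directed_on D leq"
  shows "eventually P (net_filter D leq) \<longleftrightarrow> (\<exists>i\<in>D. \<forall>j\<in>D. leq i j \<longrightarrow> P j)"
proof -
  have ne: "D \<noteq> {}"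
    using D by (simp add: directed_on_def)
  have base: "\<exists>k\<in>D. principal {l \<in> D. leq k l} \<le> inf (principal {l \<in> D. leq i l}) (principal {l \<in> D. leq j l})"
    if ij: "i \<in> D" "j \<in> D" for i j
  proof -
    obtain k where k: "k \<in> D" "leq i k" "leq j k"
      using directed_on_upper[OF D ij] by metis
    have "{l \<in> D. leq k l} \<subseteq> {l \<in> D. leq i l} \<inter> {l \<in> D. leq j l}"
      using directed_on_trans[OF D ij(1) k(1) _ k(2)] directed_on_trans[OF D ij(2) k(1) _ k(3)] by auto
    then have "principal {l \<in> D. leq k l} \<le> inf (principal {l \<in> D. leq i l}) (principal {l \<in> D. leq j l})"
      by (simp only: inf_principal principal_le_iff)
    then show ?thesis
      using k(1) by (rule bexI)
  qed
  show ?thesis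
    unfolding net_filter_def
    by (subst eventually_INF_base[OF ne base]) (simp_all add: eventually_principal Ball_def imp_conjL)
qed

lemma mackey_complete_net:
  fixes D :: "'i set"
  assumes E: "lcs E" and "mackey_complete E" and D: "directed_on D leq" and "mackey_cauchy E D leq x"
  shows "\<exists>l. limitin (topo E) x l (net_filter D leq)"
proof -
  interpret M: Module.module real_ring E
    using E by (simp add: lcs_def)
  have R [simp]: "carrier real_ring = UNIV" "mult real_ring = (*)" "one real_ring = 1"
    "add real_ring = (+)" "zero real_ring = 0"
    by (simp_all add: real_ring_def)
  have smultC: "a \<odot>\<^bsub>E\<^esub> v \<in> carrier E" if "v \<in> carrier E" for a v
    using M.smult_closed[of a v] that by simp
  have top: "topspace (topo E) = carrier E"
    using E by (simp add: lcs_def)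
  obtain B \<mu> where xC: "x ` D \<subseteq> carrier E" and B: "absolutely_convex_in E B" "bounded_in E B"
    and lim: "((\<lambda>(i, j). \<mu> i j) \<longlongrightarrow> (0::real)) (net_filter D leq \<times>\<^sub>F net_filter D leq)"
    and diff: "\<And>i j. i \<in> D \<Longrightarrow> j \<in> D \<Longrightarrow> x i \<ominus>\<^bsub>E\<^esub> x j \<in> (\<lambda>b. \<mu> i j \<odot>\<^bsub>E\<^esub> b) ` B"
    using assms(4) unfolding mackey_cauchy_def by (elim conjE exE) (rule that, assumption+, simp)
  have BC: "B \<subseteq> carrier E"
    using B by (simp add: bounded_in_def)
  have tail: "\<exists>k\<in>D. \<forall>i\<in>D. \<forall>j\<in>D. leq k i \<longrightarrow> leq k j \<longrightarrow> \<bar>\<mu> i j\<bar> < e" if "e > 0" for e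
  proof -
    have "eventually (\<lambda>p. \<bar>case p of (i, j) \<Rightarrow> \<mu> i j\<bar> < e) (net_filter D leq \<times>\<^sub>F net_filter D leq)"
      using tendstoD[OF lim that] by (simp add: dist_real_def)
    then obtain P Q where PQ: "eventually P (net_filter D leq)" "eventually Q (net_filter D leq)"
      "\<And>i j. P i \<Longrightarrow> Q j \<Longrightarrow> \<bar>\<mu> i j\<bar> < e"
      unfolding eventually_prod_filter by auto
    have "eventually (\<lambda>i. P i \<and> Q i) (net_filter D leq)"
      using PQ(1,2) by (rule eventually_conj)
    then show ?thesis
      unfolding eventually_net_filter[OF D] using PQ(3) by meson
  qed
  show ?thesis
  proof (cases "finite (UNIV :: 'a set)")
    case True
    have zero: "v = \<zero>\<^bsub>E\<^esub>" if v: "v \<in> carrier E" for v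
    proof (rule ccontr)
      assume nz: "v \<noteq> \<zero>\<^bsub>E\<^esub>"
      have "finite (range (\<lambda>a. a \<odot>\<^bsub>E\<^esub> v))"
        by (rule finite_subset[OF subset_UNIV True])
      then have "\<not> inj (\<lambda>a. a \<odot>\<^bsub>E\<^esub> v)"
        using finite_imageD[of "\<lambda>a. a \<odot>\<^bsub>E\<^esub> v" UNIV] infinite_UNIV_char_0[where 'a=real] by metis
      then obtain a b where ab: "a \<odot>\<^bsub>E\<^esub> v = b \<odot>\<^bsub>E\<^esub> v" "a \<noteq> b"
        by (auto simp: inj_def)
      have "(a - b) \<odot>\<^bsub>E\<^esub> v = a \<odot>\<^bsub>E\<^esub> v \<oplus>\<^bsub>E\<^esub> (- b) \<odot>\<^bsub>E\<^esub> v"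
        using M.smult_l_distr[of a "- b" v] v by simp
      also have "\<dots> = b \<odot>\<^bsub>E\<^esub> v \<oplus>\<^bsub>E\<^esub> (- b) \<odot>\<^bsub>E\<^esub> v"
        using ab by simp
      also have "\<dots> = 0 \<odot>\<^bsub>E\<^esub> v"
        using M.smult_l_distr[of b "- b" v] v by simp
      also have "\<dots> = \<zero>\<^bsub>E\<^esub>"
        using M.smult_l_null[OF v] by simp
      finally have "(1 / (a - b)) \<odot>\<^bsub>E\<^esub> ((a - b) \<odot>\<^bsub>E\<^esub> v) = (1 / (a - b)) \<odot>\<^bsub>E\<^esub> \<zero>\<^bsub>E\<^esub>"
        by simp
      also have "\<dots> = \<zero>\<^bsub>E\<^esub>"
        using M.smult_r_null by simp
      finally have "1 \<odot>\<^bsub>E\<^esub> v = \<zero>\<^bsub>E\<^esub>"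
        using M.smult_assoc1[of "1 / (a - b)" "a - b" v] v ab(2) by simp
      then show False
        using nz M.smult_one[OF v] by simp
    qed
    have x0: "x i = \<zero>\<^bsub>E\<^esub>" if "i \<in> D" for i
      using zero xC that by (simp add: image_subset_iff)
    obtain i where i: "i \<in> D"
      using D unfolding directed_on_def by (meson ex_in_conv)
    have "\<exists>i\<in>D. \<forall>j\<in>D. leq i j \<longrightarrow> x j \<in> U" if "\<zero>\<^bsub>E\<^esub> \<in> U" for U
      using i x0 that by (intro bexI[of _ i]) simp_all
    then have "limitin (topo E) x \<zero>\<^bsub>E\<^esub> (net_filter D leq)"
      unfolding limitin_def eventually_net_filter[OF D] top by simp
    then show ?thesis ..
  next
    case False
    then have "infinite (UNIV :: ('a set \<times> 'a) set)"
      by (simp add: finite_prod)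
    then obtain h :: "nat \<Rightarrow> 'a set \<times> 'a" where h: "inj h"
      using infinite_countable_subset by blast
    define g where "g = inv_into UNIV h"
    have gh [simp]: "g (h n) = n" for n
      using h by (simp add: g_def)
    define K where "K n k \<longleftrightarrow> k \<in> D \<and>
      (\<forall>i\<in>D. \<forall>j\<in>D. leq k i \<longrightarrow> leq k j \<longrightarrow> \<bar>\<mu> i j\<bar> < 1 / Suc n)" for n k
    have "\<exists>k. \<forall>n. K n (k n) \<and> leq (k n) (k (Suc n))"
    proof (rule dependent_nat_choice)
      show "\<exists>k. K 0 k"
        using tail[of 1] by (auto simp: K_def)
      fix k n assume k: "K n k"
      obtain k' where k': "K (Suc n) k'"
        using tail[of "1 / Suc (Suc n)"] by (auto simp: K_def)
      have kk: "k \<in> D" "k' \<in> D"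
        using k k' by (simp_all add: K_def)
      obtain k'' where k'': "k'' \<in> D" "leq k k''" "leq k' k''"
        using directed_on_upper[OF D kk] by metis
      have "leq k' i" if "i \<in> D" "leq k'' i" for i
        using directed_on_trans[OF D kk(2) k''(1) that(1) k''(3) that(2)] .
      then have "K (Suc n) k''"
        using k' k''(1) unfolding K_def by simp
      then show "\<exists>k''. K (Suc n) k'' \<and> leq k k''"
        using k''(2) by (intro exI conjI)
    qed
    then obtain k where kall: "\<forall>n. K n (k n) \<and> leq (k n) (k (Suc n))" ..
    have k: "K n (k n)" and le_Suc: "leq (k n) (k (Suc n))" for n
      using kall by simp_all
    have kD: "k n \<in> D" for n
      using k by (simp add: K_def)
    have mono: "leq (k m) (k n)" if "m \<le> n" for m n
      using that
    proof (induction n rule: dec_induct)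
      case base
      then show ?case using D kD by (auto simp: directed_on_def)
    next
      case (step n)
      show ?case
        by (rule directed_on_trans[OF D kD kD kD step(3)]) (rule le_Suc)
    qed
    define D' where "D' = range h"
    define le' where "le' a b \<longleftrightarrow> g a \<le> g b" for a b
    have D': "directed_on D' le'"
      unfolding directed_on_def D'_def le'_def
      by (simp add: image_iff) (meson linear)
    have "((\<lambda>(i, j). \<mu> (k (g i)) (k (g j))) \<longlongrightarrow> (0::real)) (net_filter D' le' \<times>\<^sub>F net_filter D' le')"
    proof (rule tendstoI)
      fix e :: real assume "e > 0"
      then obtain n where n: "1 / Suc n < e"
        by (rule nat_approx_posE)
      have ev: "eventually (\<lambda>i. n \<le> g i) (net_filter D' le')"
        unfolding eventually_net_filter[OF D'] by (auto simp: D'_def le'_def intro!: exI[of _ n])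
      have "\<bar>\<mu> (k p) (k q)\<bar> < e" if "n \<le> p" "n \<le> q" for p q
      proof -
        have "\<bar>\<mu> (k p) (k q)\<bar> < 1 / Suc n"
          using k[of n] kD[of p] kD[of q] mono[OF that(1)] mono[OF that(2)] unfolding K_def by simp
        then show ?thesis
          using n by linarith
      qed
      then show "eventually (\<lambda>p. dist (case p of (i, j) \<Rightarrow> \<mu> (k (g i)) (k (g j))) 0 < e)
          (net_filter D' le' \<times>\<^sub>F net_filter D' le')"
        unfolding eventually_prod_filter using ev
        by (intro exI[of _ "\<lambda>i. n \<le> g i"]) (simp add: dist_real_def)
    qed
    then have "mackey_cauchy E D' le' (\<lambda>i. x (k (g i)))"
      unfolding mackey_cauchy_def using xC kD B diff
      by (intro conjI exI[of _ B] exI[of _ "\<lambda>i j. \<mu> (k (g i)) (k (g j))"] ballI)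
        (simp_all add: image_subset_iff)
    then obtain l where l: "limitin (topo E) (\<lambda>i. x (k (g i))) l (net_filter D' le')"
      using assms(2) D' unfolding mackey_complete_def by metis
    have lC: "l \<in> carrier E"
      using l top by (simp add: limitin_def)
    have "\<exists>i\<in>D. \<forall>j\<in>D. leq i j \<longrightarrow> x j \<in> U" if U: "openin (topo E) U" "l \<in> U" for U
    proof -
      have cont: "continuous_map (prod_topology (topo E) (topo E)) (topo E) (\<lambda>(x, y). x \<oplus>\<^bsub>E\<^esub> y)"
        using E by (simp add: lcs_def)
      define P where "P = {p \<in> topspace (prod_topology (topo E) (topo E)). (case p of (x, y) \<Rightarrow> x \<oplus>\<^bsub>E\<^esub> y) \<in> U}"
      have "openin (prod_topology (topo E) (topo E)) P"
        unfolding P_def using cont U(1) by (rule openin_continuous_map_preimage)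
      moreover have "(\<zero>\<^bsub>E\<^esub>, l) \<in> P"
        unfolding P_def using U(2) lC by (simp add: top)
      ultimately have "\<exists>V W. openin (topo E) V \<and> openin (topo E) W \<and> \<zero>\<^bsub>E\<^esub> \<in> V \<and> l \<in> W \<and> V \<times> W \<subseteq> P"
        by (simp only: openin_prod_topology_alt)
      then obtain V W where VW: "openin (topo E) V" "openin (topo E) W" "\<zero>\<^bsub>E\<^esub> \<in> V" "l \<in> W"
        "V \<times> W \<subseteq> P"
        by (elim exE conjE)
      have sumU: "v \<oplus>\<^bsub>E\<^esub> w \<in> U" if "v \<in> V" "w \<in> W" for v w
      proof -
        have "(v, w) \<in> P"
          using VW(5) that by blast
        then show ?thesis
          by (simp add: P_def)
      qed
      have VC: "V \<subseteq> carrier E"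
        using openin_subset[OF VW(1)] top by simp
      obtain r where r: "r > 0" "B \<subseteq> (\<lambda>u. r \<odot>\<^bsub>E\<^esub> u) ` V"
        using B(2) VW(1,3) unfolding bounded_in_def by metis
      have small: "c \<odot>\<^bsub>E\<^esub> b \<in> V" if "b \<in> B" "\<bar>c\<bar> < 1 / r" for b c
      proof -
        have bC: "b \<in> carrier E"
          using that BC by blast
        have "\<bar>r * c\<bar> \<le> 1"
          using that(2) r(1) by (simp add: abs_mult field_simps)
        then have "(r * c) \<odot>\<^bsub>E\<^esub> b \<oplus>\<^bsub>E\<^esub> 0 \<odot>\<^bsub>E\<^esub> b \<in> B"
          using B(1)[unfolded absolutely_convex_in_def, rule_format, OF that(1) that(1), of "r * c" 0]
          by simp
        then have "(r * c) \<odot>\<^bsub>E\<^esub> b \<in> B"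
          using M.smult_l_null[OF bC] smultC[OF bC] by simp
        then obtain u where u: "u \<in> V" "(r * c) \<odot>\<^bsub>E\<^esub> b = r \<odot>\<^bsub>E\<^esub> u"
          using r(2) by blast
        have "c \<odot>\<^bsub>E\<^esub> b = (1 / r) \<odot>\<^bsub>E\<^esub> ((r * c) \<odot>\<^bsub>E\<^esub> b)"
          using M.smult_assoc1[of "1 / r" "r * c" b] bC r(1) by simp
        also have "\<dots> = (1 / r) \<odot>\<^bsub>E\<^esub> (r \<odot>\<^bsub>E\<^esub> u)"
          using u by simp
        also have "\<dots> = 1 \<odot>\<^bsub>E\<^esub> u"
          using M.smult_assoc1[of "1 / r" r u] u(1) VC r(1) by auto
        also have "\<dots> = u"
          using M.smult_one[of u] u(1) VC by auto
        finally show ?thesis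
          using u(1) by simp
      qed
      obtain m where m: "1 / Suc m < 1 / r"
        using nat_approx_posE[of "1 / r"] r(1) by auto
      have "eventually (\<lambda>i. x (k (g i)) \<in> W) (net_filter D' le')"
        using l VW(2,4) by (simp add: limitin_def)
      then obtain n where n: "\<And>p. n \<le> p \<Longrightarrow> x (k p) \<in> W"
        unfolding eventually_net_filter[OF D'] by (auto simp: D'_def le'_def)
      define p where "p = max m n"
      have "x j \<in> U" if j: "j \<in> D" "leq (k p) j" for j
      proof -
        have mp: "leq (k m) (k p)"
          by (rule mono) (simp add: p_def)
        have "leq (k m) j"
          by (rule directed_on_trans[OF D kD kD j(1) mp j(2)])
        then have "\<bar>\<mu> j (k p)\<bar> < 1 / Suc m"
          using k[of m] mp j(1) kD[of p] unfolding K_def by simp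
        then have "\<bar>\<mu> j (k p)\<bar> < 1 / r"
          using m by linarith
        then have "x j \<ominus>\<^bsub>E\<^esub> x (k p) \<in> V"
          using diff[OF j(1) kD[of p]] small by (elim imageE) simp
        then have "(x j \<ominus>\<^bsub>E\<^esub> x (k p)) \<oplus>\<^bsub>E\<^esub> x (k p) \<in> U"
          using sumU n[of p] by (simp add: p_def)
        moreover have "x j \<in> carrier E" "x (k p) \<in> carrier E"
          using xC j kD by auto
        ultimately show ?thesis
          by (simp add: a_minus_def M.a_assoc M.l_neg)
      qed
      then show ?thesis
        using kD by blast
    qed
    then have "limitin (topo E) x l (net_filter D leq)"
      using lC unfolding limitin_def eventually_net_filter[OF D] top by simp
    then show ?thesis ..
  qed
qed

definition mackey_lcs :: "'a tvs set" where
  "mackey_lcs = {E. lcs E \<and> mackey_complete E}"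

definition cinf_lcs :: "'a tvs set" where
  "cinf_lcs = {E. lcs E \<and> mackey_complete E \<and>
     (\<forall>n\<ge>1. cinf_topology (power_tvs E n) = topo (power_tvs E n))}"


section \<open>Manifolds\<close>

text \<open>
  In a chart \<open>(U, \<phi>, E)\<close> the values of \<open>\<phi>\<close> outside \<open>U\<close> are irrelevant; a maximal atlas is
  closed under changing them.
\<close>

type_synonym ('m, 'e) chart = "'m set \<times> ('m \<Rightarrow> 'e) \<times> 'e tvs"

definition is_chart :: "'e tvs set \<Rightarrow> 'm topology \<Rightarrow> ('m, 'e) chart \<Rightarrow> bool" where
  "is_chart \<E> M = (\<lambda>(U, \<phi>, E). E \<in> \<E> \<and> openin M U \<and> openin (topo E) (\<phi> ` U) \<and>
     homeomorphic_map (subtopology M U) (subtopology (topo E) (\<phi> ` U)) \<phi>)"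

definition smooth_transition :: "('m, 'e) chart \<Rightarrow> ('m, 'e) chart \<Rightarrow> bool" where
  "smooth_transition = (\<lambda>(U, \<phi>, E) (V, \<psi>, F). smooth_map F E (\<psi> ` (U \<inter> V)) (\<phi> \<circ> inv_into V \<psi>))"

definition smooth_atlas :: "'e tvs set \<Rightarrow> 'm topology \<Rightarrow> ('m, 'e) chart set \<Rightarrow> bool" where
  "smooth_atlas \<E> M A \<longleftrightarrow> (\<forall>c\<in>A. is_chart \<E> M c) \<and> (\<Union>c\<in>A. fst c) = topspace M \<and>
     (\<forall>c\<in>A. \<forall>c'\<in>A. smooth_transition c c')"

definition maximal_atlas :: "'e tvs set \<Rightarrow> 'm topology \<Rightarrow> ('m, 'e) chart set \<Rightarrow> bool" where
  "maximal_atlas \<E> M A \<longleftrightarrow> smooth_atlas \<E> M A \<and>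
     (\<forall>c. is_chart \<E> M c \<and> (\<forall>c'\<in>A. smooth_transition c c' \<and> smooth_transition c' c) \<longrightarrow> c \<in> A)"

definition smooth_manifold :: "'e tvs set \<Rightarrow> 'm topology \<Rightarrow> ('m, 'e) chart set \<Rightarrow> bool" where
  "smooth_manifold \<E> M A \<longleftrightarrow> Hausdorff_space M \<and> maximal_atlas \<E> M A"

definition smooth_manifold_map ::
    "'m topology \<Rightarrow> ('m, 'e) chart set \<Rightarrow> 'n topology \<Rightarrow> ('n, 'f) chart set \<Rightarrow> ('m \<Rightarrow> 'n) \<Rightarrow> bool" where
  "smooth_manifold_map M A N B \<Phi> \<longleftrightarrow> continuous_map M N \<Phi> \<and>
     (\<forall>(U, \<phi>, E)\<in>A. \<forall>(V, \<psi>, F)\<in>B. \<Phi> ` U \<subseteq> V \<longrightarrow>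
        smooth_map E F (\<phi> ` U) (\<psi> \<circ> \<Phi> \<circ> inv_into U \<phi>))"


section \<open>Sheaves of real-valued functions\<close>

text \<open>
  A subsheaf of the sheaf of all real-valued functions on \<open>X\<close> is a function assigning to an open
  set \<open>U\<close> a set of functions, each made extensional outside \<open>U\<close>. Its values on sets that are
  not open are irrelevant, and its restriction to an open subspace is given by the same function.
\<close>

type_synonym 'a fun_sheaf = "'a set \<Rightarrow> ('a \<Rightarrow> real) set"

definition cinf_model :: "'e tvs \<Rightarrow> 'e fun_sheaf" where
  "cinf_model E U = {f \<in> extensional U. smooth_map E real_tvs U f}"

text \<open>
  Smooth functions on the open submanifold \<open>U\<close>, with \<open>\<real>\<close> described by its global chart.
\<close>

definition cinf_sheaf :: "'m topology \<Rightarrow> ('m, 'e) chart set \<Rightarrow> 'm fun_sheaf" where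
  "cinf_sheaf M A U = {f \<in> extensional U.
     smooth_manifold_map (subtopology M U) {c \<in> A. fst c \<subseteq> U} euclideanreal {(UNIV, id, real_tvs)} f}"

text \<open>
  Continuous real functions satisfy uniqueness of gluing automatically, so only existence is required.
\<close>

definition algebra_sheaf :: "'a topology \<Rightarrow> 'a fun_sheaf \<Rightarrow> bool" where
  "algebra_sheaf X \<O> \<longleftrightarrow>
     (\<forall>U. openin X U \<longrightarrow>
        \<O> U \<subseteq> {f \<in> extensional U. continuous_map (subtopology X U) euclideanreal f} \<and>
        (\<forall>c. (\<lambda>x\<in>U. c) \<in> \<O> U) \<and>
        (\<forall>f\<in>\<O> U. \<forall>g\<in>\<O> U. (\<lambda>x\<in>U. f x + g x) \<in> \<O> U \<and> (\<lambda>x\<in>U. f x * g x) \<in> \<O> U)) \<and>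
     (\<forall>U V. openin X U \<and> openin X V \<and> V \<subseteq> U \<longrightarrow> (\<forall>f\<in>\<O> U. restrict f V \<in> \<O> V)) \<and>
     (\<forall>\<W> f. (\<forall>W\<in>\<W>. openin X W \<and> restrict f W \<in> \<O> W) \<and> f \<in> extensional (\<Union>\<W>) \<longrightarrow> f \<in> \<O> (\<Union>\<W>))"

definition sections_at :: "'a topology \<Rightarrow> 'a fun_sheaf \<Rightarrow> 'a \<Rightarrow> ('a set \<times> ('a \<Rightarrow> real)) set" where
  "sections_at X \<O> x = {(U, f). openin X U \<and> x \<in> U \<and> f \<in> \<O> U}"

definition germ_rel ::
    "'a topology \<Rightarrow> 'a fun_sheaf \<Rightarrow> 'a \<Rightarrow> (('a set \<times> ('a \<Rightarrow> real)) \<times> ('a set \<times> ('a \<Rightarrow> real))) set" where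
  "germ_rel X \<O> x = {((U, f), (V, g)). (U, f) \<in> sections_at X \<O> x \<and> (V, g) \<in> sections_at X \<O> x \<and>
     (\<exists>W. openin X W \<and> x \<in> W \<and> W \<subseteq> U \<inter> V \<and> restrict f W = restrict g W)}"

definition stalk :: "'a topology \<Rightarrow> 'a fun_sheaf \<Rightarrow> 'a \<Rightarrow> ('a set \<times> ('a \<Rightarrow> real)) set ring" where
  "stalk X \<O> x = \<lparr>carrier = sections_at X \<O> x // germ_rel X \<O> x,
     mult = (\<lambda>a b. \<Union>(U, f)\<in>a. \<Union>(V, g)\<in>b. germ_rel X \<O> x `` {(U \<inter> V, \<lambda>y\<in>U \<inter> V. f y * g y)}),
     one = germ_rel X \<O> x `` {(topspace X, \<lambda>y\<in>topspace X. 1)},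
     zero = germ_rel X \<O> x `` {(topspace X, \<lambda>y\<in>topspace X. 0)},
     add = (\<lambda>a b. \<Union>(U, f)\<in>a. \<Union>(V, g)\<in>b. germ_rel X \<O> x `` {(U \<inter> V, \<lambda>y\<in>U \<inter> V. f y + g y)})\<rparr>"

definition local_ring :: "('a, 'b) ring_scheme \<Rightarrow> bool" where
  "local_ring R \<longleftrightarrow> cring R \<and> (\<exists>!I. maximalideal I R)"

definition reduced_lrs :: "'a topology \<Rightarrow> 'a fun_sheaf \<Rightarrow> bool" where
  "reduced_lrs X \<O> \<longleftrightarrow> algebra_sheaf X \<O> \<and> (\<forall>x\<in>topspace X. local_ring (stalk X \<O> x))"

text \<open>
  Between reduced locally ringed spaces a morphism is pullback along its underlying map. Locality on
  stalks is automatic: the unique maximal ideal of a stalk at \<open>x\<close> is the kernel of evaluation at \<open>x\<close>.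
\<close>

definition lrs_morphism ::
    "'a topology \<Rightarrow> 'a fun_sheaf \<Rightarrow> 'b topology \<Rightarrow> 'b fun_sheaf \<Rightarrow> ('a \<Rightarrow> 'b) \<Rightarrow> bool" where
  "lrs_morphism X \<O> Y \<P> \<Phi> \<longleftrightarrow> continuous_map X Y \<Phi> \<and>
     (\<forall>W. openin Y W \<longrightarrow> (\<forall>g\<in>\<P> W.
        restrict (g \<circ> \<Phi>) {x \<in> topspace X. \<Phi> x \<in> W} \<in> \<O> {x \<in> topspace X. \<Phi> x \<in> W}))"

definition lrs_isomorphic ::
    "'a topology \<Rightarrow> 'a fun_sheaf \<Rightarrow> 'b topology \<Rightarrow> 'b fun_sheaf \<Rightarrow> bool" where
  "lrs_isomorphic X \<O> Y \<P> \<longleftrightarrow> (\<exists>\<Phi> \<Psi>. lrs_morphism X \<O> Y \<P> \<Phi> \<and> lrs_morphism Y \<P> X \<O> \<Psi> \<and>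
     (\<forall>x\<in>topspace X. \<Psi> (\<Phi> x) = x) \<and> (\<forall>y\<in>topspace Y. \<Phi> (\<Psi> y) = y))"

definition sheaf_smooth_manifold :: "'e tvs set \<Rightarrow> 'm topology \<Rightarrow> 'm fun_sheaf \<Rightarrow> bool" where
  "sheaf_smooth_manifold \<E> M \<O> \<longleftrightarrow> reduced_lrs M \<O> \<and> Hausdorff_space M \<and>
     (\<forall>x\<in>topspace M. \<exists>U E D. openin M U \<and> x \<in> U \<and> E \<in> \<E> \<and> openin (topo E) D \<and>
        lrs_isomorphic (subtopology M U) \<O> (subtopology (topo E) D) (cinf_model E))"

end

theory Submission
  imports Defs
begin

text \<open>
  Both parts rest on one criterion, \<open>scalarwise_smooth_imp_smooth\<close>: if \<open>E\<close> belongs to \<open>cinf_lcs\<close> and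
  \<open>F\<close> is Mackey-complete, then a map \<open>f\<close> from an open subset of \<open>E\<close> to \<open>F\<close> is smooth as soon as
  \<open>l \<circ> f\<close> is smooth for every continuous linear functional \<open>l\<close> on \<open>F\<close>.

  The criterion is applied as follows. A chart \<open>\<psi>\<close> of \<open>N\<close> followed by a functional is a smooth function on an open
  subset of \<open>N\<close>. A morphism of ringed spaces pulls it back to a smooth function, so the local
  representatives of the morphism are smooth after composition with every functional, hence
  smooth. Conversely smooth maps pull smooth functions back to smooth functions by the chain rule
  (\<open>Ck_compose\<close>). For a structure sheaf \<open>\<O>\<close>, the atlas consists of all charts through which the
  sections of \<open>\<O>\<close> are the smooth functions. Its transition maps pull functionals back to smooth
  functions, so the criterion makes them smooth. A maximal atlas with sheaf \<open>\<O>\<close> consists of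
  such charts only, and a maximal atlas contained in another atlas is equal to it.

  The criterion has three ingredients. First, a set on which every functional is bounded is bounded
  for every continuous seminorm (\<open>weakly_bounded_imp_bounded\<close>, from the Hahn-Banach theorem and a
  gliding hump). Hence an estimate that holds for each \<open>l \<circ> f\<close>, with a constant depending on \<open>l\<close>, holds
  for \<open>f\<close> and each seminorm. Secondly, \<open>l \<circ> f \<circ> c\<close> is locally Lipschitz for every curve \<open>c\<close> of class \<open>C\<^sup>1\<close>,
  and therefore so is \<open>f \<circ> c\<close>; as the topology of \<open>E\<close> is determined by curves, \<open>f\<close> is continuous
  (\<open>scalarwise_C1_imp_continuous\<close>). Thirdly, since \<open>l \<circ> f\<close> is of class \<open>C\<^sup>2\<close>, its difference quotients
  along a line at \<open>s\<close> and \<open>t\<close> differ by at most a multiple of \<open>\<bar>s\<bar> + \<bar>t\<bar>\<close>; so those of \<open>f\<close> are Mackey-Cauchy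
  and converge
  (\<open>scalarwise_C2_imp_has_ddir\<close>). The resulting derivative \<open>df\<close> on \<open>U \<times> E\<close> satisfies
  \<open>l \<circ> df = d(l \<circ> f)\<close>, so it fulfils the same hypothesis as \<open>f\<close>, and induction on the order of
  differentiability finishes the proof (\<open>scalarwise_smooth_imp_Ck\<close>). The \<open>k\<close>-th derivative lives on the
  \<open>k\<close>-fold iterated square of \<open>E\<close>, a copy of \<open>E\<close> to the power \<open>2 ^ k\<close>; this is why the topologies of all
  powers of \<open>E\<close> have to be determined by smooth curves.

  The class \<open>C\<^sup>1\<close> is defined by directional derivatives. That these obey the chain rule is the content
  of \<open>C1_map_moving_direction\<close>, which again uses the Hahn-Banach theorem to reduce to the mean value
  theorem on the real line.
\<close>

section \<open>Linear algebra and continuity in a locally convex space\<close>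

lemma real_ring_simps [simp]:
  "carrier real_ring = UNIV" "mult real_ring = (*)" "one real_ring = 1"
  "add real_ring = (+)" "zero real_ring = 0"
  by (simp_all add: real_ring_def)

lemma lcs_module: "lcs E \<Longrightarrow> Module.module real_ring E"
  by (simp add: lcs_def)

context
  fixes E :: "'a tvs" (structure)
  assumes E: "lcs E"
begin

interpretation M: Module.module real_ring E
  using E by (rule lcs_module)

lemma lcs_zero_closed [simp, intro]: "\<zero> \<in> carrier E"
  by simp

lemma lcs_add_closed [simp, intro]:
  "x \<in> carrier E \<Longrightarrow> y \<in> carrier E \<Longrightarrow> x \<oplus> y \<in> carrier E"
  by simp

lemma lcs_smult_closed [simp, intro]: "x \<in> carrier E \<Longrightarrow> a \<odot> x \<in> carrier E"
  using M.smult_closed by simp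

lemma lcs_diff_closed [simp, intro]:
  "x \<in> carrier E \<Longrightarrow> y \<in> carrier E \<Longrightarrow> x \<ominus> y \<in> carrier E"
  by simp

lemma lcs_add_assoc:
  "x \<in> carrier E \<Longrightarrow> y \<in> carrier E \<Longrightarrow> z \<in> carrier E \<Longrightarrow>
     (x \<oplus> y) \<oplus> z = x \<oplus> (y \<oplus> z)"
  by (rule M.a_assoc)

lemma lcs_add_commute:
  "x \<in> carrier E \<Longrightarrow> y \<in> carrier E \<Longrightarrow> x \<oplus> y = y \<oplus> x"
  by (rule M.a_comm)

lemma lcs_add_left_commute:
  "x \<in> carrier E \<Longrightarrow> y \<in> carrier E \<Longrightarrow> z \<in> carrier E \<Longrightarrow>
     x \<oplus> (y \<oplus> z) = y \<oplus> (x \<oplus> z)"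
  by (rule M.a_lcomm)

lemma lcs_add_zero [simp]:
  "x \<in> carrier E \<Longrightarrow> x \<oplus> \<zero> = x" "x \<in> carrier E \<Longrightarrow> \<zero> \<oplus> x = x"
  by simp_all

lemma lcs_smult_add_right:
  "x \<in> carrier E \<Longrightarrow> y \<in> carrier E \<Longrightarrow> a \<odot> (x \<oplus> y) = a \<odot> x \<oplus> a \<odot> y"
  using M.smult_r_distr by simp

lemma lcs_smult_add_left:
  "x \<in> carrier E \<Longrightarrow> (a + b) \<odot> x = a \<odot> x \<oplus> b \<odot> x"
  using M.smult_l_distr by simp

lemma lcs_smult_smult [simp]: "x \<in> carrier E \<Longrightarrow> a \<odot> (b \<odot> x) = (a * b) \<odot> x"
  using M.smult_assoc1 by simp

lemma lcs_smult_one [simp]: "x \<in> carrier E \<Longrightarrow> 1 \<odot> x = x"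
  using M.smult_one by simp

lemma lcs_smult_zero_left [simp]: "x \<in> carrier E \<Longrightarrow> 0 \<odot> x = \<zero>"
  using M.smult_l_null by simp

lemma lcs_smult_zero_right [simp]: "a \<odot> \<zero> = \<zero>"
  using M.smult_r_null by simp

lemma lcs_diff_eq:
  assumes "x \<in> carrier E" "y \<in> carrier E"
  shows "x \<ominus> y = x \<oplus> (-1) \<odot> y"
proof -
  have "y \<oplus> (-1) \<odot> y = \<zero>"
    using lcs_smult_add_left[of y 1 "-1"] assms by simp
  then have "\<ominus> y = (-1) \<odot> y"
    using assms by (intro M.minus_equality) (simp_all add: lcs_add_commute)
  then show ?thesis
    by (simp add: a_minus_def)
qed

lemma lcs_diff_self [simp]: "x \<in> carrier E \<Longrightarrow> x \<ominus> x = \<zero>"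
  by (simp add: M.r_neg a_minus_def)

lemma lcs_add_diff_cancel [simp]:
  "x \<in> carrier E \<Longrightarrow> y \<in> carrier E \<Longrightarrow> x \<oplus> (y \<ominus> x) = y"
  by (simp add: a_minus_def lcs_add_left_commute[of x y] M.r_neg)

lemma lcs_diff_commute:
  "x \<in> carrier E \<Longrightarrow> y \<in> carrier E \<Longrightarrow> (-1) \<odot> (x \<ominus> y) = y \<ominus> x"
  by (simp add: lcs_diff_eq lcs_smult_add_right lcs_add_commute)

lemma lcs_Hausdorff: "Hausdorff_space (topo E)"
  using E by (simp add: lcs_def)

lemma continuous_map_lcs_add:
  assumes "continuous_map X (topo E) f" "continuous_map X (topo E) g"
  shows "continuous_map X (topo E) (\<lambda>x. f x \<oplus> g x)"
proof -
  have "continuous_map (prod_topology (topo E) (topo E)) (topo E) (\<lambda>(x, y). x \<oplus> y)"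
    using E by (simp add: lcs_def)
  from continuous_map_compose[OF continuous_map_pairedI[OF assms] this] show ?thesis
    by (simp add: o_def)
qed

lemma continuous_map_lcs_smult:
  assumes "continuous_map X euclideanreal a" "continuous_map X (topo E) f"
  shows "continuous_map X (topo E) (\<lambda>x. a x \<odot> f x)"
proof -
  have "continuous_map (prod_topology euclideanreal (topo E)) (topo E) (\<lambda>(a, x). a \<odot> x)"
    using E by (simp add: lcs_def)
  from continuous_map_compose[OF continuous_map_pairedI[OF assms] this] show ?thesis
    by (simp add: o_def)
qed

lemma continuous_map_into_carrier:
  "continuous_map X (topo E) f \<Longrightarrow> x \<in> topspace X \<Longrightarrow> f x \<in> carrier E"
  using lcs_topspace[OF E] continuous_map_image_subset_topspace by fastforce

lemma continuous_map_lcs_diff: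
  assumes "continuous_map X (topo E) f" "continuous_map X (topo E) g"
  shows "continuous_map X (topo E) (\<lambda>x. f x \<ominus> g x)"
proof (rule continuous_map_eq)
  show "continuous_map X (topo E) (\<lambda>x. f x \<oplus> (-1) \<odot> g x)"
    using assms by (intro continuous_map_lcs_add continuous_map_lcs_smult) auto
qed (simp add: lcs_diff_eq continuous_map_into_carrier[OF assms(1)]
       continuous_map_into_carrier[OF assms(2)])

end

section \<open>Continuous seminorms describe the topology\<close>

definition cseminorm :: "'a tvs \<Rightarrow> ('a \<Rightarrow> real) \<Rightarrow> bool" where
  "cseminorm E p \<longleftrightarrow> (\<forall>x\<in>carrier E. \<forall>y\<in>carrier E. p (x \<oplus>\<^bsub>E\<^esub> y) \<le> p x + p y) \<and>
     (\<forall>x\<in>carrier E. \<forall>a. p (a \<odot>\<^bsub>E\<^esub> x) = \<bar>a\<bar> * p x) \<and> continuous_map (topo E) euclideanreal p"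

lemma cseminorm_add: "cseminorm E p \<Longrightarrow> x \<in> carrier E \<Longrightarrow> y \<in> carrier E \<Longrightarrow> p (x \<oplus>\<^bsub>E\<^esub> y) \<le> p x + p y"
  by (simp add: cseminorm_def)

lemma cseminorm_smult: "cseminorm E p \<Longrightarrow> x \<in> carrier E \<Longrightarrow> p (a \<odot>\<^bsub>E\<^esub> x) = \<bar>a\<bar> * p x"
  by (simp add: cseminorm_def)

lemma cseminorm_continuous: "cseminorm E p \<Longrightarrow> continuous_map (topo E) euclideanreal p"
  by (simp add: cseminorm_def)

lemma cseminorm_zero [simp]: "lcs E \<Longrightarrow> cseminorm E p \<Longrightarrow> p \<zero>\<^bsub>E\<^esub> = 0"
  using cseminorm_smult[of E p "\<zero>\<^bsub>E\<^esub>" 0] by simp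

lemma cseminorm_nonneg:
  fixes E (structure)
  assumes "lcs E" "cseminorm E p" "x \<in> carrier E"
  shows "0 \<le> p x"
proof -
  have "p (0 \<odot> x) \<le> p (1 \<odot> x) + p ((-1) \<odot> x)"
    using cseminorm_add[OF assms(2), of "1 \<odot> x" "(-1) \<odot> x"] assms
      lcs_smult_add_left[OF assms(1,3), of 1 "-1"] by simp
  then show ?thesis
    using assms by (simp add: cseminorm_smult)
qed

lemma continuous_map_real_iff:
  "continuous_map X euclideanreal f \<longleftrightarrow>
    (\<forall>x\<in>topspace X. \<forall>e>0. \<exists>U. openin X U \<and> x \<in> U \<and> (\<forall>y\<in>U. \<bar>f y - f x\<bar> < e))"
  using Met_TC.continuous_map_to_metric[where 'a=real and 'b='a, of X f]
  by (simp add: dist_real_def abs_minus_commute)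

text \<open>
  It suffices to bound the seminorm near \<open>0\<close>: scaling turns such a bound into an estimate of
  \<open>p (y - x)\<close> for \<open>y\<close> near \<open>x\<close>. An inequality for scalar multiples suffices because it can be applied
  to the inverse scalar as well.
\<close>

lemma cseminormI:
  fixes E (structure)
  assumes E: "lcs E"
    and add: "\<And>x y. x \<in> carrier E \<Longrightarrow> y \<in> carrier E \<Longrightarrow> p (x \<oplus> y) \<le> p x + p y"
    and smult: "\<And>x a. x \<in> carrier E \<Longrightarrow> p (a \<odot> x) \<le> \<bar>a\<bar> * p x"
    and W: "openin (topo E) W" "\<zero> \<in> W" "\<And>x. x \<in> W \<Longrightarrow> p x \<le> K"
  shows "cseminorm E p"
proof -
  have eq: "p (a \<odot> x) = \<bar>a\<bar> * p x" if x: "x \<in> carrier E" for x a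
  proof (cases "a = 0")
    case True
    have "p \<zero> \<le> 0"
      using smult[OF x, of 0] E x by simp
    moreover have "p \<zero> \<le> p \<zero> + p \<zero>"
      using add[of "\<zero>" "\<zero>"] E by simp
    ultimately show ?thesis
      using True E x by simp
  next
    case False
    have "p ((1 / a) \<odot> (a \<odot> x)) \<le> \<bar>1 / a\<bar> * p (a \<odot> x)"
      using smult[of "a \<odot> x" "1 / a"] E x by simp
    then have "p x \<le> \<bar>1 / a\<bar> * p (a \<odot> x)"
      using E x False by simp
    then have "\<bar>a\<bar> * p x \<le> p (a \<odot> x)"
      using False by (simp add: field_simps)
    with smult[OF x, of a] show ?thesis
      by simp
  qed
  have WC: "W \<subseteq> carrier E"
    using openin_subset[OF W(1)] lcs_topspace[OF E] by simp
  have p0: "p \<zero> = 0"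
    using eq[of "\<zero>" 0] E by simp
  then have K0: "K \<ge> 0"
    using W by fastforce
  have "continuous_map (topo E) euclideanreal p"
    unfolding continuous_map_real_iff
  proof (intro ballI allI impI)
    fix x and e :: real assume "x \<in> topspace (topo E)" and e: "e > 0"
    then have x: "x \<in> carrier E"
      using lcs_topspace[OF E] by simp
    \<comment> \<open>If \<open>c (y - x)\<close> lies in \<open>W\<close>, then \<open>p (y - x) \<le> K / c < e\<close>.\<close>
    define c where "c = (K + 1) / e"
    have c: "c > 0"
      using K0 e by (simp add: c_def)
    define U where "U = {y \<in> topspace (topo E). c \<odot> (y \<ominus> x) \<in> W}"
    have "openin (topo E) U"
      unfolding U_def
      using E x W lcs_topspace[OF E]
      by (intro openin_continuous_map_preimage[OF _ W(1)] continuous_map_lcs_smult continuous_map_lcs_diff)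
        auto
    moreover have "x \<in> U"
      using E x W lcs_topspace[OF E] by (simp add: U_def)
    moreover have "\<bar>p y - p x\<bar> < e" if "y \<in> U" for y
    proof -
      have y: "y \<in> carrier E" "p (c \<odot> (y \<ominus> x)) \<le> K"
        using that W lcs_topspace[OF E] by (simp_all add: U_def)
      then have "c * p (y \<ominus> x) \<le> K"
        using E x c by (simp add: eq)
      then have "p (y \<ominus> x) < e"
        using c e mult_less_cancel_left_pos[OF c, of "p (y \<ominus> x)" e] by (simp add: c_def)
      moreover have "p y \<le> p x + p (y \<ominus> x)"
        using add[of x "y \<ominus> x"] E x y by simp
      moreover have "p x \<le> p y + p (x \<ominus> y)"
        using add[of y "x \<ominus> y"] E x y by simp
      moreover have "p (x \<ominus> y) = p (y \<ominus> x)"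
        using eq[of "y \<ominus> x" "-1"] E x y by (simp add: lcs_diff_commute)
      ultimately show ?thesis
        by linarith
    qed
    ultimately show "\<exists>U. openin (topo E) U \<and> x \<in> U \<and> (\<forall>y\<in>U. \<bar>p y - p x\<bar> < e)"
      by blast
  qed
  then show ?thesis
    using add eq by (simp add: cseminorm_def)
qed

text \<open>
  The seminorm is the Minkowski gauge of \<open>S = C \<inter> - C\<close> for a convex neighbourhood \<open>C\<close> of \<open>0\<close> in \<open>U\<close>:
  convexity of \<open>S\<close> gives the triangle inequality, its symmetry the homogeneity.
\<close>

lemma cseminorm_below_neighbourhood:
  fixes E (structure)
  assumes E: "lcs E" and U: "openin (topo E) U" "\<zero> \<in> U"
  obtains p where "cseminorm E p" "{x \<in> carrier E. p x < 1} \<subseteq> U"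
proof -
  obtain C W where C: "convex_in E C" "C \<subseteq> U" and W: "openin (topo E) W" "\<zero> \<in> W" "W \<subseteq> C"
    using E U unfolding lcs_def by meson
  note top = lcs_topspace[OF E]
  define S where "S = {x \<in> carrier E. x \<in> C \<and> (-1) \<odot> x \<in> C}"
  define N where "N = {x \<in> topspace (topo E). (-1) \<odot> x \<in> W} \<inter> W"
  have "continuous_map (topo E) (topo E) (\<lambda>x. (-1) \<odot> x)"
    using E by (intro continuous_map_lcs_smult) auto
  then have N: "openin (topo E) N"
    unfolding N_def using W(1) by (intro openin_Int openin_continuous_map_preimage)
  have N0: "\<zero> \<in> N" and NS: "N \<subseteq> S"
    using E W top by (auto simp: N_def S_def)
  have SC: "x \<in> carrier E" if "x \<in> S" for x
    using that by (simp add: S_def)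
  have S_conv: "a \<odot> x \<oplus> b \<odot> y \<in> S"
    if "x \<in> S" "y \<in> S" "0 \<le> a" "0 \<le> b" "a + b = 1" for a b x y
  proof -
    have "(-1) \<odot> (a \<odot> x \<oplus> b \<odot> y) = a \<odot> ((-1) \<odot> x) \<oplus> b \<odot> ((-1) \<odot> y)"
      using E SC[OF that(1)] SC[OF that(2)] by (simp add: lcs_smult_add_right)
    moreover have "a \<odot> x \<oplus> b \<odot> y \<in> C"
      "a \<odot> ((-1) \<odot> x) \<oplus> b \<odot> ((-1) \<odot> y) \<in> C"
      using that C(1) by (simp_all add: S_def convex_in_def)
    moreover have "a \<odot> x \<oplus> b \<odot> y \<in> carrier E"
      using E SC[OF that(1)] SC[OF that(2)] by simp
    ultimately show ?thesis
      unfolding S_def by (metis (mono_tags, lifting) mem_Collect_eq)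
  qed
  have S0: "\<zero> \<in> S"
    using N0 NS by blast
  have S_scale: "a \<odot> x \<in> S" if "x \<in> S" "0 \<le> a" "a \<le> 1" for a x
    using S_conv[OF that(1) S0, of a "1 - a"] that E SC[OF that(1)] by simp
  have S_sgn: "sgn a \<odot> x \<in> S" if "x \<in> S" for a :: real and x
    using that E SC[OF that] S0 by (auto simp: sgn_if S_def)
  define A where "A x = {t. 0 < t \<and> (1 / t) \<odot> x \<in> S}" for x
  define p where "p x = Inf (A x)" for x
  have A_ne: "A x \<noteq> {}" if x: "x \<in> carrier E" for x
  proof -
    have "continuous_map euclideanreal (topo E) (\<lambda>a. a \<odot> x)"
      using E x top by (intro continuous_map_lcs_smult) auto
    then have "openin euclideanreal {a \<in> topspace euclideanreal. a \<odot> x \<in> N}"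
      using N by (rule openin_continuous_map_preimage)
    moreover have "0 \<in> {a \<in> topspace euclideanreal. a \<odot> x \<in> N}"
      using E x N0 by simp
    ultimately obtain e where e: "e > 0" "ball 0 e \<subseteq> {a \<in> topspace euclideanreal. a \<odot> x \<in> N}"
      unfolding open_openin[symmetric] by (meson open_contains_ball)
    then have "e / 2 \<in> ball 0 e"
      by simp
    then have "(e / 2) \<odot> x \<in> N"
      using e(2) by blast
    then have "2 / e \<in> A x"
      using e NS by (auto simp: A_def)
    then show ?thesis
      by blast
  qed
  have A_bdd: "bdd_below (A x)" for x
    by (rule bdd_belowI[of _ 0]) (simp add: A_def)
  have p_le: "p x \<le> t" if "t \<in> A x" for x t
    unfolding p_def using that A_bdd by (rule cInf_lower)
  have p_less: "t \<in> A x" if x: "x \<in> carrier E" and "p x < t" for x t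
  proof -
    obtain s where s: "s \<in> A x" "s < t"
      using cInf_lessD[OF A_ne[OF x]] \<open>p x < t\<close> unfolding p_def by blast
    then have "(s / t) \<odot> ((1 / s) \<odot> x) \<in> S"
      by (intro S_scale[of "(1 / s) \<odot> x"]) (auto simp: A_def)
    then show ?thesis
      using s E x by (simp add: A_def)
  qed
  have p_nonneg: "0 \<le> p x" if "x \<in> carrier E" for x
    unfolding p_def using A_ne[OF that] by (intro cInf_greatest) (auto simp: A_def)
  have "cseminorm E p"
  proof (rule cseminormI[OF E])
    fix x y assume xy: "x \<in> carrier E" "y \<in> carrier E"
    show "p (x \<oplus> y) \<le> p x + p y"
    proof (rule field_le_epsilon)
      fix e :: real assume e: "e > 0"
      define s t where "s = p x + e / 2" and "t = p y + e / 2"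
      have s: "s \<in> A x" and t: "t \<in> A y"
        unfolding s_def t_def using xy e by (auto intro!: p_less)
      have pos: "s > 0" "t > 0"
        using s t by (simp_all add: A_def)
      have "(s / (s + t)) \<odot> ((1 / s) \<odot> x) \<oplus> (t / (s + t)) \<odot> ((1 / t) \<odot> y) \<in> S"
        using s t pos by (intro S_conv) (auto simp: A_def add_divide_distrib[symmetric])
      then have "s + t \<in> A (x \<oplus> y)"
        using xy pos E by (simp add: A_def lcs_smult_add_right)
      then show "p (x \<oplus> y) \<le> p x + p y + e"
        using p_le[of "s + t" "x \<oplus> y"] by (simp add: s_def t_def)
    qed
  next
    fix x and a :: real assume x: "x \<in> carrier E"
    show "p (a \<odot> x) \<le> \<bar>a\<bar> * p x"
    proof (cases "a = 0")
      case True
      have "p \<zero> \<le> 0 + e" if "e > 0" for e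
        using p_le[of e "\<zero>"] that S0 E by (simp add: A_def)
      then have "p \<zero> \<le> 0"
        by (rule field_le_epsilon)
      with True E x show ?thesis
        by simp
    next
      case False
      show ?thesis
      proof (rule field_le_epsilon)
        fix e :: real assume e: "e > 0"
        define t where "t = p x + e / \<bar>a\<bar>"
        have "t \<in> A x"
          unfolding t_def using x e False by (intro p_less) auto
        then have t: "t > 0" "(1 / t) \<odot> x \<in> S"
          by (simp_all add: A_def)
        have "sgn a * (1 / t) = 1 / (\<bar>a\<bar> * t) * a"
          using False t by (simp add: sgn_if)
        then have "(1 / (\<bar>a\<bar> * t)) \<odot> (a \<odot> x) \<in> S"
          using S_sgn[OF t(2), of a] E x by simp
        then have "\<bar>a\<bar> * t \<in> A (a \<odot> x)"
          using t False by (simp add: A_def)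
        then show "p (a \<odot> x) \<le> \<bar>a\<bar> * p x + e"
          using p_le[of "\<bar>a\<bar> * t" "a \<odot> x"] False by (simp add: t_def distrib_left)
      qed
    qed
  next
    show "p x \<le> 1" if "x \<in> N" for x
      using that NS SC E by (intro p_le) (auto simp: A_def)
  qed (use N N0 in auto)
  moreover have "{x \<in> carrier E. p x < 1} \<subseteq> U"
  proof clarify
    fix x assume "x \<in> carrier E" "p x < 1"
    then have "1 \<in> A x"
      by (intro p_less)
    then show "x \<in> U"
      using C E \<open>x \<in> carrier E\<close> by (auto simp: A_def S_def)
  qed
  ultimately show thesis
    using that by blast
qed

lemma openin_cseminorm_ball:
  fixes E (structure)
  assumes "lcs E" "cseminorm E p" "x \<in> carrier E"
  shows "openin (topo E) {y \<in> carrier E. p (y \<ominus> x) < r}"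
proof -
  have "continuous_map (topo E) (topo E) (\<lambda>y. y \<ominus> x)"
    using assms lcs_topspace[OF assms(1)] by (intro continuous_map_lcs_diff) auto
  then have "continuous_map (topo E) euclideanreal (p \<circ> (\<lambda>y. y \<ominus> x))"
    using cseminorm_continuous[OF assms(2)] by (rule continuous_map_compose)
  from openin_continuous_map_preimage[OF this, of "{..<r}"] show ?thesis
    by (simp add: lcs_topspace[OF assms(1)])
qed

lemma cseminorm_ball_in_open:
  fixes E (structure)
  assumes E: "lcs E" and U: "openin (topo E) U" "x \<in> U"
  obtains p where "cseminorm E p" "{y \<in> carrier E. p (y \<ominus> x) < 1} \<subseteq> U"
proof -
  note top = lcs_topspace[OF E]
  have x: "x \<in> carrier E"
    using openin_subset[OF U(1)] U(2) top by auto
  define V where "V = {v \<in> topspace (topo E). x \<oplus> v \<in> U}"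
  have "openin (topo E) V"
    unfolding V_def using E x top
    by (intro openin_continuous_map_preimage[OF _ U(1)] continuous_map_lcs_add) auto
  moreover have "\<zero> \<in> V"
    using E x U top by (simp add: V_def)
  ultimately obtain p where p: "cseminorm E p" "{v \<in> carrier E. p v < 1} \<subseteq> V"
    using cseminorm_below_neighbourhood[OF E] by blast
  have "y \<in> U" if "y \<in> carrier E" "p (y \<ominus> x) < 1" for y
  proof -
    have "y \<ominus> x \<in> V"
      using p(2) that E x by auto
    then show ?thesis
      using E x that by (simp add: V_def)
  qed
  then show thesis
    using p(1) that by blast
qed

lemma limitin_lcs_iff:
  fixes E (structure)
  assumes E: "lcs E"
  shows "limitin (topo E) f l F \<longleftrightarrow> l \<in> carrier E \<and> (\<forall>\<^sub>F t in F. f t \<in> carrier E) \<and>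
    (\<forall>p. cseminorm E p \<longrightarrow> ((\<lambda>t. p (f t \<ominus> l)) \<longlongrightarrow> 0) F)" (is "?L \<longleftrightarrow> ?R")
proof
  assume L: ?L
  then have l: "l \<in> carrier E"
    using lcs_topspace[OF E] by (simp add: limitin_def)
  have ev: "\<forall>\<^sub>F t in F. f t \<in> carrier E"
    using L lcs_topspace[OF E] openin_topspace[of "topo E"] l unfolding limitin_def by metis
  have "((\<lambda>t. p (f t \<ominus> l)) \<longlongrightarrow> 0) F" if p: "cseminorm E p" for p
  proof (rule tendstoI)
    fix e :: real assume e: "e > 0"
    have "\<forall>\<^sub>F t in F. f t \<in> {y \<in> carrier E. p (y \<ominus> l) < e}"
    proof -
      have "l \<in> {y \<in> carrier E. p (y \<ominus> l) < e}"
        using l E p e by simp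
      with L openin_cseminorm_ball[OF E p l, of e] show ?thesis
        unfolding limitin_def by blast
    qed
    then show "\<forall>\<^sub>F t in F. dist (p (f t \<ominus> l)) 0 < e"
      by eventually_elim (use cseminorm_nonneg[OF E p] E l in simp)
  qed
  with l ev show ?R by blast
next
  assume R: ?R
  show ?L
    unfolding limitin_def
  proof (intro conjI allI impI)
    show "l \<in> topspace (topo E)"
      using R lcs_topspace[OF E] by simp
    fix U assume U: "openin (topo E) U \<and> l \<in> U"
    obtain p where p: "cseminorm E p" "{y \<in> carrier E. p (y \<ominus> l) < 1} \<subseteq> U"
      by (rule cseminorm_ball_in_open[OF E U[THEN conjunct1] U[THEN conjunct2]])
    have "\<forall>\<^sub>F t in F. p (f t \<ominus> l) < 1"
      using R p(1) by (intro order_tendstoD(2)[where y=0]) auto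
    moreover have "\<forall>\<^sub>F t in F. f t \<in> carrier E"
      using R by blast
    ultimately show "\<forall>\<^sub>F t in F. f t \<in> U"
      by eventually_elim (use p(2) in auto)
  qed
qed

lemma continuous_map_into_lcs_iff:
  fixes E (structure)
  assumes E: "lcs E"
  shows "continuous_map X (topo E) f \<longleftrightarrow> f \<in> topspace X \<rightarrow> carrier E \<and>
    (\<forall>x\<in>topspace X. \<forall>p. cseminorm E p \<longrightarrow> (\<forall>e>0. \<exists>U. openin X U \<and> x \<in> U \<and>
       (\<forall>y\<in>U. p (f y \<ominus> f x) < e)))" (is "?L \<longleftrightarrow> ?R")
proof
  assume L: ?L
  then have fC: "f \<in> topspace X \<rightarrow> carrier E"
    by (intro funcsetI continuous_map_into_carrier[OF E])
  moreover have "\<exists>U. openin X U \<and> x \<in> U \<and> (\<forall>y\<in>U. p (f y \<ominus> f x) < e)"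
    if x: "x \<in> topspace X" and p: "cseminorm E p" and e: "e > 0" for x p and e :: real
  proof -
    let ?U = "{y \<in> topspace X. f y \<in> {z \<in> carrier E. p (z \<ominus> f x) < e}}"
    have "openin X ?U"
      using fC x by (intro openin_continuous_map_preimage[OF L] openin_cseminorm_ball[OF E p]) auto
    moreover have "f x \<in> carrier E"
      using fC x by auto
    ultimately show ?thesis
      using x e E p by (intro exI[of _ ?U]) simp
  qed
  ultimately show ?R by blast
next
  assume R: ?R
  show ?L
    unfolding continuous_map_def lcs_topspace[OF E]
  proof (intro conjI allI impI)
    show "f \<in> topspace X \<rightarrow> carrier E"
      using R by blast
    fix V assume V: "openin (topo E) V"
    show "openin X {x \<in> topspace X. f x \<in> V}"
    proof (subst openin_subopen, clarify)
      fix x assume x: "x \<in> topspace X" "f x \<in> V"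
      obtain p where p: "cseminorm E p" "{y \<in> carrier E. p (y \<ominus> f x) < 1} \<subseteq> V"
        by (rule cseminorm_ball_in_open[OF E V x(2)])
      obtain U where U: "openin X U" "x \<in> U" "\<forall>y\<in>U. p (f y \<ominus> f x) < 1"
        using R p(1) x(1) zero_less_one by metis
      have "U \<subseteq> {x \<in> topspace X. f x \<in> V}"
        using openin_subset[OF U(1)] U(3) p(2) R by (auto simp: Pi_iff subset_iff)
      then show "\<exists>T. openin X T \<and> x \<in> T \<and> T \<subseteq> {x \<in> topspace X. f x \<in> V}"
        using U by blast
    qed
  qed
qed

section \<open>The Hahn-Banach theorem\<close>

definition dual :: "'a tvs \<Rightarrow> ('a \<Rightarrow> real) set" where
  "dual E = {l. (\<forall>x\<in>carrier E. \<forall>y\<in>carrier E. l (x \<oplus>\<^bsub>E\<^esub> y) = l x + l y) \<and>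
     (\<forall>x\<in>carrier E. \<forall>a. l (a \<odot>\<^bsub>E\<^esub> x) = a * l x) \<and> continuous_map (topo E) euclideanreal l}"

lemma dual_add: "l \<in> dual E \<Longrightarrow> x \<in> carrier E \<Longrightarrow> y \<in> carrier E \<Longrightarrow> l (x \<oplus>\<^bsub>E\<^esub> y) = l x + l y"
  by (simp add: dual_def)

lemma dual_smult: "l \<in> dual E \<Longrightarrow> x \<in> carrier E \<Longrightarrow> l (a \<odot>\<^bsub>E\<^esub> x) = a * l x"
  by (simp add: dual_def)

lemma dual_continuous: "l \<in> dual E \<Longrightarrow> continuous_map (topo E) euclideanreal l"
  by (simp add: dual_def)

lemma dual_zero: "lcs E \<Longrightarrow> l \<in> dual E \<Longrightarrow> l \<zero>\<^bsub>E\<^esub> = 0"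
  using dual_smult[of l E "\<zero>\<^bsub>E\<^esub>" 0] by simp

lemma dual_diff:
  "lcs E \<Longrightarrow> l \<in> dual E \<Longrightarrow> x \<in> carrier E \<Longrightarrow> y \<in> carrier E \<Longrightarrow> l (x \<ominus>\<^bsub>E\<^esub> y) = l x - l y"
  by (simp add: lcs_diff_eq dual_add dual_smult)

lemmas dual_simps = dual_add dual_smult dual_zero dual_diff

lemma dualI:
  fixes E (structure)
  assumes E: "lcs E" and p: "cseminorm E p"
    and add: "\<And>x y. x \<in> carrier E \<Longrightarrow> y \<in> carrier E \<Longrightarrow> l (x \<oplus> y) = l x + l y"
    and smult: "\<And>x a. x \<in> carrier E \<Longrightarrow> l (a \<odot> x) = a * l x"
    and bound: "\<And>x. x \<in> carrier E \<Longrightarrow> \<bar>l x\<bar> \<le> K * p x"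
  shows "l \<in> dual E"
proof -
  have "continuous_map (topo E) euclideanreal l"
    unfolding continuous_map_real_iff lcs_topspace[OF E]
  proof (intro ballI allI impI)
    fix x and e :: real assume x: "x \<in> carrier E" and e: "e > 0"
    define r where "r = e / (\<bar>K\<bar> + 1)"
    have r: "r > 0"
      using e by (simp add: r_def)
    have "\<bar>l y - l x\<bar> < e" if y: "y \<in> carrier E" "p (y \<ominus> x) < r" for y
    proof -
      have "l y - l x = l (y \<ominus> x)"
        using E x y by (simp add: lcs_diff_eq add smult)
      then have "\<bar>l y - l x\<bar> \<le> K * p (y \<ominus> x)"
        using bound[of "y \<ominus> x"] E x y by simp
      also have "\<dots> \<le> (\<bar>K\<bar> + 1) * p (y \<ominus> x)"
        using cseminorm_nonneg[OF E p, of "y \<ominus> x"] E x y by (intro mult_right_mono) auto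
      also have "\<dots> < (\<bar>K\<bar> + 1) * r"
        using y by (intro mult_strict_left_mono) auto
      also have "\<dots> = e"
        by (simp add: r_def)
      finally show ?thesis .
    qed
    then show "\<exists>U. openin (topo E) U \<and> x \<in> U \<and> (\<forall>y\<in>U. \<bar>l y - l x\<bar> < e)"
      using openin_cseminorm_ball[OF E p x, of r] x r E p
      by (intro exI[of _ "{y \<in> carrier E. p (y \<ominus> x) < r}"]) simp
  qed
  then show ?thesis
    using add smult by (simp add: dual_def)
qed

definition sublinear :: "'a tvs \<Rightarrow> ('a \<Rightarrow> real) \<Rightarrow> bool" where
  "sublinear E q \<longleftrightarrow> (\<forall>x\<in>carrier E. \<forall>y\<in>carrier E. q (x \<oplus>\<^bsub>E\<^esub> y) \<le> q x + q y) \<and>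
     (\<forall>x\<in>carrier E. \<forall>a\<ge>0. q (a \<odot>\<^bsub>E\<^esub> x) = a * q x)"

lemma sublinear_add:
  "sublinear E q \<Longrightarrow> x \<in> carrier E \<Longrightarrow> y \<in> carrier E \<Longrightarrow> q (x \<oplus>\<^bsub>E\<^esub> y) \<le> q x + q y"
  by (simp add: sublinear_def)

lemma sublinear_smult: "sublinear E q \<Longrightarrow> x \<in> carrier E \<Longrightarrow> a \<ge> 0 \<Longrightarrow> q (a \<odot>\<^bsub>E\<^esub> x) = a * q x"
  by (simp add: sublinear_def)

lemma sublinear_lower:
  fixes E (structure)
  assumes "lcs E" "sublinear E q" "x \<in> carrier E" "y \<in> carrier E"
  shows "q y - q ((-1) \<odot> x) \<le> q (x \<oplus> y)"
proof -
  have "x \<oplus> (-1) \<odot> x = \<zero>"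
    using assms by (simp add: lcs_diff_eq[symmetric])
  then have "y = (x \<oplus> y) \<oplus> (-1) \<odot> x"
    using assms(1,3,4) lcs_add_assoc[of E x "(-1) \<odot> x" y]
    by (simp add: lcs_add_assoc lcs_add_commute[of E y])
  then have "q y \<le> q (x \<oplus> y) + q ((-1) \<odot> x)"
    using sublinear_add[OF assms(2), of "x \<oplus> y" "(-1) \<odot> x"] assms by simp
  then show ?thesis
    by simp
qed

lemma sublinearI:
  fixes E (structure)
  assumes E: "lcs E" and zero: "q \<zero> = 0"
    and add: "\<And>x y. x \<in> carrier E \<Longrightarrow> y \<in> carrier E \<Longrightarrow> q (x \<oplus> y) \<le> q x + q y"
    and smult: "\<And>x a. x \<in> carrier E \<Longrightarrow> a > 0 \<Longrightarrow> q (a \<odot> x) \<le> a * q x"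
  shows "sublinear E q"
  unfolding sublinear_def
proof (intro conjI ballI allI impI add)
  fix x and a :: real assume x: "x \<in> carrier E" and a: "a \<ge> 0"
  show "q (a \<odot> x) = a * q x"
  proof (cases "a = 0")
    case True
    then show ?thesis
      using E x zero by simp
  next
    case False
    have "q ((1 / a) \<odot> (a \<odot> x)) \<le> (1 / a) * q (a \<odot> x)"
      using False a x E by (intro smult) auto
    then have "a * q x \<le> q (a \<odot> x)"
      using False a x E by (simp add: field_simps)
    with smult[OF x, of a] False a show ?thesis
      by simp
  qed
qed

text \<open>
  The function \<open>q' x = inf {q (x + t y) - t q y | t \<ge> 0}\<close> is again sublinear. It shows that a minimal
  sublinear functional is additive, and it also lets the functional in the Hahn-Banach theorem attain
  a prescribed value: at \<open>x = - y\<close> the second bound reads \<open>q' (- y) \<le> - q y\<close>.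
\<close>

lemma sublinear_shift:
  fixes E (structure)
  assumes E: "lcs E" and q: "sublinear E q" and y: "y \<in> carrier E"
  obtains q' where "sublinear E q'" "\<And>x. x \<in> carrier E \<Longrightarrow> q' x \<le> q x"
    "\<And>x. x \<in> carrier E \<Longrightarrow> q' x \<le> q (x \<oplus> y) - q y"
proof -
  define h where "h x t = q (x \<oplus> t \<odot> y) - t * q y" for x t
  define q' where "q' x = (INF t\<in>{0..}. h x t)" for x
  have lower: "- q ((-1) \<odot> x) \<le> h x t" if "x \<in> carrier E" "t \<ge> 0" for x t
    using sublinear_lower[OF E q that(1), of "t \<odot> y"] sublinear_smult[OF q y that(2)] E y
    by (simp add: h_def)
  have bdd: "bdd_below (h x ` {0..})" if "x \<in> carrier E" for x
    using lower[OF that] by (auto intro!: bdd_belowI2)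
  have q'_le: "q' x \<le> h x t" if "x \<in> carrier E" "t \<ge> 0" for x t
    unfolding q'_def using bdd that by (intro cINF_lower) auto
  have le_q': "c \<le> q' x" if "\<And>t. t \<ge> 0 \<Longrightarrow> c \<le> h x t" for c x
    unfolding q'_def using that by (intro cINF_greatest) auto
  have zero: "q \<zero> = 0"
    using sublinear_smult[OF q y, of 0] E y by simp
  have "sublinear E q'"
  proof (rule sublinearI[OF E])
    have "h \<zero> t = 0" if "t \<ge> 0" for t
      using that E y sublinear_smult[OF q y that] by (simp add: h_def)
    then show "q' \<zero> = 0"
      using q'_le[of "\<zero>" 0] le_q'[of 0 "\<zero>"] E by fastforce
  next
    fix x z assume xz: "x \<in> carrier E" "z \<in> carrier E"
    have sub: "q' (x \<oplus> z) \<le> h x s + h z t" if st: "s \<ge> 0" "t \<ge> 0" for s t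
    proof -
      have "(x \<oplus> z) \<oplus> (s + t) \<odot> y = (x \<oplus> s \<odot> y) \<oplus> (z \<oplus> t \<odot> y)"
        using E xz y by (simp add: lcs_smult_add_left lcs_add_assoc lcs_add_left_commute)
      then have "h (x \<oplus> z) (s + t) \<le> h x s + h z t"
        using sublinear_add[OF q, of "x \<oplus> s \<odot> y" "z \<oplus> t \<odot> y"] E xz y
        by (simp add: h_def algebra_simps)
      then show ?thesis
        using q'_le[of "x \<oplus> z" "s + t"] E xz st by simp
    qed
    have "q' (x \<oplus> z) - h x s \<le> q' z" if "s \<ge> 0" for s
      using sub[OF that] by (intro le_q') (simp add: algebra_simps)
    then have "q' (x \<oplus> z) - q' z \<le> q' x"
      by (intro le_q') (simp add: algebra_simps)
    then show "q' (x \<oplus> z) \<le> q' x + q' z"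
      by simp
  next
    fix x and a :: real assume x: "x \<in> carrier E" and a: "a > 0"
    have "q' (a \<odot> x) / a \<le> h x t" if t: "t \<ge> 0" for t
    proof -
      have "h (a \<odot> x) (a * t) = q (a \<odot> (x \<oplus> t \<odot> y)) - a * t * q y"
        using E x y by (simp add: h_def lcs_smult_add_right)
      also have "\<dots> = a * h x t"
        using E x y a sublinear_smult[OF q, of "x \<oplus> t \<odot> y" a]
        by (simp add: h_def algebra_simps)
      finally show ?thesis
        using q'_le[of "a \<odot> x" "a * t"] E x a t by (simp add: field_simps)
    qed
    then have "q' (a \<odot> x) / a \<le> q' x"
      by (rule le_q')
    then show "q' (a \<odot> x) \<le> a * q' x"
      using a by (simp add: field_simps)
  qed
  moreover have "q' x \<le> q x" if "x \<in> carrier E" for x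
    using q'_le[OF that, of 0] E y that by (simp add: h_def)
  moreover have "q' x \<le> q (x \<oplus> y) - q y" if "x \<in> carrier E" for x
    using q'_le[OF that, of 1] E y that by (simp add: h_def)
  ultimately show thesis
    by (rule that)
qed

text \<open>
  By Zorn's lemma: the infimum of a chain is sublinear, as any two members of a chain can be replaced
  by the smaller one, and it is finite because \<open>- p (- x)\<close> is a lower bound.
\<close>

lemma minimal_sublinear:
  fixes E (structure)
  assumes E: "lcs E" and p: "sublinear E p"
  obtains q where "sublinear E q" "\<And>x. x \<in> carrier E \<Longrightarrow> q x \<le> p x"
    "\<forall>r. sublinear E r \<longrightarrow> (\<forall>x\<in>carrier E. r x \<le> q x) \<longrightarrow> (\<forall>x\<in>carrier E. r x = q x)"
proof -
  define A where "A = {q \<in> extensional (carrier E). sublinear E q \<and> (\<forall>x\<in>carrier E. q x \<le> p x)}"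
  define below where "below a b \<longleftrightarrow> (\<forall>x\<in>carrier E. b x \<le> a x)" for a b :: "'a \<Rightarrow> real"
  have restrict_sub: "sublinear E (restrict q (carrier E))" if "sublinear E q" for q
    using that E by (simp add: sublinear_def)
  have "partial_order_on A (relation_of below A)"
  proof (rule partial_order_on_relation_ofI)
    fix a b assume "a \<in> A" "b \<in> A" "below a b" "below b a"
    then show "a = b"
      by (intro extensionalityI[of _ "carrier E"]) (auto simp: A_def below_def intro: antisym)
  qed (auto simp: below_def intro: order_trans)
  moreover have "\<exists>u\<in>A. \<forall>a\<in>K. below a u" if K: "K \<in> Chains (relation_of below A)" for K
  proof (cases "K = {}")
    case True
    then show ?thesis
      using restrict_sub[OF p] by (intro bexI[of _ "restrict p (carrier E)"]) (auto simp: A_def)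
  next
    case False
    have KA: "K \<subseteq> A" and total: "\<And>a b. a \<in> K \<Longrightarrow> b \<in> K \<Longrightarrow> below a b \<or> below b a"
      using K by (auto simp: Chains_def relation_of_def)
    define u where "u = (\<lambda>x\<in>carrier E. INF q\<in>K. q x)"
    have "- p ((-1) \<odot> x) \<le> q x" if q: "q \<in> K" and x: "x \<in> carrier E" for q x
    proof -
      have q': "sublinear E q" "q ((-1) \<odot> x) \<le> p ((-1) \<odot> x)"
        using q KA E x by (auto simp: A_def)
      have "q \<zero> = 0"
        using sublinear_smult[OF q'(1) x, of 0] E x by simp
      then show ?thesis
        using sublinear_lower[OF E q'(1) x lcs_zero_closed[OF E]] E x q' by simp
    qed
    then have bdd: "bdd_below ((\<lambda>q. q x) ` K)" if "x \<in> carrier E" for x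
      using that by (auto intro!: bdd_belowI2)
    have u_le: "u x \<le> q x" if "q \<in> K" "x \<in> carrier E" for q x
      using that bdd by (auto simp: u_def intro!: cINF_lower)
    have le_u: "c \<le> u x" if "\<And>q. q \<in> K \<Longrightarrow> c \<le> q x" "x \<in> carrier E" for c x
      using that False by (auto simp: u_def intro!: cINF_greatest)
    have sub: "sublinear E q" if "q \<in> K" for q
      using that KA by (auto simp: A_def)
    have "sublinear E u"
    proof (rule sublinearI[OF E])
      have "q \<zero> = 0" if "q \<in> K" for q
        using sublinear_smult[OF sub[OF that], of "\<zero>" 0] E by simp
      then show "u \<zero> = 0"
        using le_u[of 0 "\<zero>"] u_le[of _ "\<zero>"] False E by (metis all_not_in_conv antisym lcs_zero_closed order_refl)
    next
      fix x y assume xy: "x \<in> carrier E" "y \<in> carrier E"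
      have le: "u (x \<oplus> y) \<le> q x + r y" if qr: "q \<in> K" "r \<in> K" for q r
      proof -
        obtain s where s: "s \<in> K" "s x \<le> q x" "s y \<le> r y"
          using total[OF qr] qr xy unfolding below_def by blast
        have "u (x \<oplus> y) \<le> s x + s y"
          using u_le[OF s(1), of "x \<oplus> y"] sublinear_add[OF sub[OF s(1)] xy] E xy by simp
        with s show ?thesis
          by simp
      qed
      have "u (x \<oplus> y) - q x \<le> u y" if "q \<in> K" for q
        using le[OF that] xy by (intro le_u) (auto simp: algebra_simps)
      then have "u (x \<oplus> y) - u y \<le> u x"
        using xy by (intro le_u) (auto simp: algebra_simps)
      then show "u (x \<oplus> y) \<le> u x + u y"
        by simp
    next
      fix x and a :: real assume x: "x \<in> carrier E" and a: "a > 0"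
      have "u (a \<odot> x) / a \<le> q x" if "q \<in> K" for q
        using u_le[OF that, of "a \<odot> x"] sublinear_smult[OF sub[OF that] x, of a] E x a
        by (simp add: field_simps)
      then have "u (a \<odot> x) / a \<le> u x"
        using x by (intro le_u)
      then show "u (a \<odot> x) \<le> a * u x"
        using a by (simp add: field_simps)
    qed
    moreover have "u x \<le> p x" if x: "x \<in> carrier E" for x
    proof -
      obtain q where "q \<in> K"
        using False by blast
      with u_le[of q x] x KA show ?thesis
        by (force simp: A_def)
    qed
    moreover have "u \<in> extensional (carrier E)"
      by (simp add: u_def)
    ultimately have "u \<in> A"
      by (simp add: A_def)
    moreover have "below q u" if "q \<in> K" for q
      using u_le that by (simp add: below_def)
    ultimately show ?thesis
      by blast
  qed
  ultimately have "\<exists>q\<in>A. \<forall>r\<in>A. below q r \<longrightarrow> r = q"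
    by (rule predicate_Zorn)
  then obtain q where q: "q \<in> A" and min: "\<And>r. r \<in> A \<Longrightarrow> below q r \<Longrightarrow> r = q"
    by blast
  have "r x = q x" if r: "sublinear E r" "\<forall>x\<in>carrier E. r x \<le> q x" and x: "x \<in> carrier E" for r x
  proof -
    have "restrict r (carrier E) \<in> A"
      using r q restrict_sub[OF r(1)] by (force simp: A_def)
    moreover have "below q (restrict r (carrier E))"
      using r by (simp add: below_def)
    ultimately have "restrict r (carrier E) = q"
      by (rule min)
    then show ?thesis
      using x by (metis restrict_apply')
  qed
  with q show thesis
    by (intro that[of q]) (auto simp: A_def)
qed

lemma minimal_sublinear_additive:
  assumes E: "lcs E" and q: "sublinear E q"
    and min: "\<forall>r. sublinear E r \<longrightarrow> (\<forall>x\<in>carrier E. r x \<le> q x) \<longrightarrow> (\<forall>x\<in>carrier E. r x = q x)"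
    and xy: "x \<in> carrier E" "y \<in> carrier E"
  shows "q (x \<oplus>\<^bsub>E\<^esub> y) = q x + q y"
proof -
  obtain q' where q': "sublinear E q'" "\<And>x. x \<in> carrier E \<Longrightarrow> q' x \<le> q x"
    "\<And>x. x \<in> carrier E \<Longrightarrow> q' x \<le> q (x \<oplus>\<^bsub>E\<^esub> y) - q y"
    by (rule sublinear_shift[OF E q xy(2)]) blast
  have "q' x = q x"
    using min q'(1,2) xy by simp
  then show ?thesis
    using q'(3)[OF xy(1)] sublinear_add[OF q xy] by simp
qed

text \<open>
  Minimal sublinear functionals are linear; this replaces the extension from subspaces. A minimal
  functional below the shift of \<open>p\<close> by \<open>x0\<close> is linear, lies below \<open>p\<close>, and is at most \<open>- p x0\<close> at \<open>- x0\<close>.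
\<close>

theorem Hahn_Banach:
  fixes E (structure)
  assumes E: "lcs E" and p: "cseminorm E p" and x0: "x0 \<in> carrier E"
  obtains l where "l \<in> dual E" "l x0 = p x0" "\<forall>x\<in>carrier E. \<bar>l x\<bar> \<le> p x"
proof -
  have subp: "sublinear E p"
    using p by (simp add: sublinear_def cseminorm_def)
  obtain p1 where p1: "sublinear E p1" "\<And>x. x \<in> carrier E \<Longrightarrow> p1 x \<le> p x"
    "\<And>x. x \<in> carrier E \<Longrightarrow> p1 x \<le> p (x \<oplus> x0) - p x0"
    by (rule sublinear_shift[OF E subp x0]) blast
  obtain l where l: "sublinear E l" "\<And>x. x \<in> carrier E \<Longrightarrow> l x \<le> p1 x"
    and min: "\<forall>r. sublinear E r \<longrightarrow> (\<forall>x\<in>carrier E. r x \<le> l x) \<longrightarrow> (\<forall>x\<in>carrier E. r x = l x)"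
    by (rule minimal_sublinear[OF E p1(1)]) (rule that)
  have add: "l (x \<oplus> y) = l x + l y" if "x \<in> carrier E" "y \<in> carrier E" for x y
    by (rule minimal_sublinear_additive[OF E l(1) min that])
  have neg0: "(-1) \<odot> x \<oplus> x = \<zero>" if "x \<in> carrier E" for x
    using that E by (simp add: lcs_add_commute[of E _ x] lcs_diff_eq[symmetric])
  have "l \<zero> = 0"
    using sublinear_smult[OF l(1) x0, of 0] E x0 by simp
  then have neg: "l ((-1) \<odot> x) = - l x" if "x \<in> carrier E" for x
    using add[of "(-1) \<odot> x" x] neg0[OF that] E that by simp
  have smult: "l (a \<odot> x) = a * l x" if x: "x \<in> carrier E" for a x
  proof (cases "a \<ge> 0")
    case True
    then show ?thesis
      using sublinear_smult[OF l(1) x] by simp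
  next
    case False
    then have "l ((- a) \<odot> ((-1) \<odot> x)) = (- a) * l ((-1) \<odot> x)"
      using x E by (intro sublinear_smult[OF l(1)]) auto
    then show ?thesis
      using neg[OF x] x E by simp
  qed
  have le: "l x \<le> p x" if "x \<in> carrier E" for x
    using l(2)[OF that] p1(2)[OF that] by simp
  have bound: "\<bar>l x\<bar> \<le> p x" if x: "x \<in> carrier E" for x
  proof -
    have "p ((-1) \<odot> x) = p x"
      using cseminorm_smult[OF p x, of "-1"] by simp
    then show ?thesis
      using le[OF x] le[of "(-1) \<odot> x"] neg[OF x] E x by simp
  qed
  have "l ((-1) \<odot> x0) \<le> - p x0"
    using l(2)[of "(-1) \<odot> x0"] p1(3)[of "(-1) \<odot> x0"] neg0[OF x0] E x0 p by simp
  then have "l x0 = p x0"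
    using neg[OF x0] le[OF x0] by simp
  moreover have "l \<in> dual E"
    using bound by (intro dualI[OF E p add smult, of 1]) auto
  ultimately show thesis
    using bound by (intro that[of l]) simp_all
qed

text \<open>
  Equations between vectors can thus be checked on real numbers.
\<close>

lemma dual_eqI:
  fixes E (structure)
  assumes E: "lcs E" and xy: "x \<in> carrier E" "y \<in> carrier E" and eq: "\<And>l. l \<in> dual E \<Longrightarrow> l x = l y"
  shows "x = y"
proof (rule ccontr)
  assume "x \<noteq> y"
  then obtain U where U: "openin (topo E) U" "x \<in> U" "y \<notin> U"
    using lcs_Hausdorff[OF E] lcs_topspace[OF E] xy unfolding Hausdorff_space_def by (metis disjnt_iff)
  obtain p where p: "cseminorm E p" "{z \<in> carrier E. p (z \<ominus> x) < 1} \<subseteq> U"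
    by (rule cseminorm_ball_in_open[OF E U(1,2)])
  have d: "y \<ominus> x \<in> carrier E"
    using E xy by simp
  obtain l where l: "l \<in> dual E" "l (y \<ominus> x) = p (y \<ominus> x)"
    by (rule Hahn_Banach[OF E p(1) d])
  then have "p (y \<ominus> x) = 0"
    using eq[OF l(1)] E xy by (simp add: dual_simps)
  then show False
    using p(2) U(3) xy by auto
qed

section \<open>Weakly bounded sets are bounded\<close>

text \<open>
  A gliding hump. If \<open>p\<close> is unbounded on \<open>S\<close>, choose \<open>b n \<in> S\<close> with \<open>p (b n) > 4 ^ n\<close> and functionals
  \<open>e n \<le> p\<close> that norm \<open>b n\<close>. In \<open>l = (\<Sum>n. \<plusminus> e n / 3 ^ n)\<close> choose the \<open>n\<close>-th sign so that the new term does
  not cancel the previous ones at \<open>b n\<close>. The remaining terms amount to at most half of the \<open>n\<close>-th one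
  there, so \<open>l (b n)\<close> grows at least like \<open>(4 / 3) ^ n / 2\<close>.
\<close>

theorem weakly_bounded_imp_bounded:
  assumes E: "lcs E" and S: "S \<subseteq> carrier E" and p: "cseminorm E p"
    and weak: "\<And>l. l \<in> dual E \<Longrightarrow> \<exists>K. \<forall>x\<in>S. \<bar>l x\<bar> \<le> K"
  shows "\<exists>K. \<forall>x\<in>S. p x \<le> K"
proof (rule ccontr)
  assume "\<not> ?thesis"
  then have "\<exists>b. b \<in> S \<and> p b > 4 ^ n" for n :: nat
    by (meson not_le)
  then obtain b where b: "\<And>n. b n \<in> S" "\<And>n::nat. p (b n) > 4 ^ n"
    by metis
  have bC: "b n \<in> carrier E" for n
    using b(1) S by blast
  have "\<exists>e. e \<in> dual E \<and> e (b n) = p (b n) \<and> (\<forall>x\<in>carrier E. \<bar>e x\<bar> \<le> p x)" for n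
    by (rule Hahn_Banach[OF E p bC[of n]]) blast
  then obtain e where e: "\<And>n. e n \<in> dual E" "\<And>n. e n (b n) = p (b n)"
    "\<And>n x. x \<in> carrier E \<Longrightarrow> \<bar>e n x\<bar> \<le> p x"
    by metis
  define L where "L = rec_nat (\<lambda>x. 0) (\<lambda>n f x. f x + (if f (b n) \<ge> 0 then 1 else -1) / 3 ^ n * e n x)"
  define a where "a n x = (if L n (b n) \<ge> 0 then 1 else -1) / 3 ^ n * e n x" for n x
  have L_Suc: "L (Suc n) x = L n x + a n x" for n x
    by (simp add: L_def a_def)
  have L_sum: "L n x = (\<Sum>i<n. a i x)" for n x
    by (induction n) (simp_all add: L_Suc, simp add: L_def)
  have a_le: "\<bar>a n x\<bar> \<le> p x * (1 / 3) ^ n" if "x \<in> carrier E" for n x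
  proof -
    have "\<bar>a n x\<bar> = \<bar>e n x\<bar> / 3 ^ n"
      by (simp add: a_def abs_mult)
    also have "\<dots> \<le> p x / 3 ^ n"
      using e(3)[OF that, of n] by (intro divide_right_mono) auto
    finally show ?thesis
      by (simp add: power_divide)
  qed
  have geo: "summable (\<lambda>n. c * (1 / 3 :: real) ^ n)" for c
    by (intro summable_mult summable_geometric) simp
  have summ: "summable (\<lambda>n. a n x)" if "x \<in> carrier E" for x
    using a_le[OF that] by (intro summable_comparison_test'[OF geo[of "p x"]]) auto
  define l where "l x = (\<Sum>n. a n x)" for x
  have tail: "\<bar>l x - L m x\<bar> \<le> p x * (1 / 3) ^ m * (3 / 2)" if x: "x \<in> carrier E" for x m
  proof -
    have "l x - L m x = (\<Sum>n. a (n + m) x)"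
      using suminf_minus_initial_segment[OF summ[OF x], of m] by (simp add: l_def L_sum)
    also have "\<bar>\<dots>\<bar> \<le> (\<Sum>n. p x * (1 / 3) ^ m * (1 / 3) ^ n)"
      using a_le[OF x, of "_ + m"]
      by (intro summable_rabs_comparison_test suminf_le order_trans[OF summable_rabs] geo
          summable_comparison_test'[OF geo[of "p x * (1 / 3) ^ m"]]) (auto simp: power_add mult_ac)
    also have "\<dots> = p x * (1 / 3) ^ m * (3 / 2)"
      by (subst suminf_mult) (auto simp: suminf_geometric)
    finally show ?thesis .
  qed
  have "l \<in> dual E"
  proof (rule dualI[OF E p])
    show "l (x \<oplus>\<^bsub>E\<^esub> y) = l x + l y" if "x \<in> carrier E" "y \<in> carrier E" for x y
      using suminf_add[OF summ[OF that(1)] summ[OF that(2)]] that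
      by (simp add: l_def a_def dual_add[OF e(1)] distrib_left)
    show "l (c \<odot>\<^bsub>E\<^esub> x) = c * l x" if "x \<in> carrier E" for c x
      using suminf_mult[OF summ[OF that], of c] that
      by (simp add: l_def a_def dual_smult[OF e(1)] algebra_simps)
    show "\<bar>l x\<bar> \<le> (3 / 2) * p x" if "x \<in> carrier E" for x
      using tail[OF that, of 0] by (simp add: L_sum)
  qed
  then obtain K where K: "\<And>x. x \<in> S \<Longrightarrow> \<bar>l x\<bar> \<le> K"
    using weak by blast
  have "(4 / 3) ^ n \<le> 2 * K" for n :: nat
  proof -
    have "\<bar>L (Suc n) (b n)\<bar> \<ge> p (b n) * (1 / 3) ^ n"
      using cseminorm_nonneg[OF E p bC]
      by (auto simp: L_Suc a_def e(2) power_divide abs_if)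
    moreover have "\<bar>l (b n) - L (Suc n) (b n)\<bar> \<le> p (b n) * (1 / 3) ^ n / 2"
      using tail[OF bC, of n "Suc n"] by simp
    ultimately have "p (b n) * (1 / 3) ^ n / 2 \<le> K"
      using K[OF b(1), of n] by linarith
    moreover have "4 ^ n * (1 / 3) ^ n \<le> p (b n) * (1 / 3) ^ n"
      using b(2)[of n] by (intro mult_right_mono) auto
    ultimately show ?thesis
      by (simp add: power_divide)
  qed
  moreover obtain n where "2 * K < (4 / 3 :: real) ^ n"
    using real_arch_pow[of "4 / 3" "2 * K"] by auto
  ultimately show False
    by (meson not_le)
qed

section \<open>Constructions of locally convex spaces\<close>

text \<open>
  A finite jointly injective family of linear maps \<open>\<pi> i\<close> into a locally convex space that induces
  the topology of its domain makes that domain locally convex. Powers, squares and transported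
  copies are all of this kind.
\<close>

locale initial_family =
  fixes I :: "'i set" and \<pi> :: "'i \<Rightarrow> 'b \<Rightarrow> 'a" and G :: "'b tvs" and E :: "'a tvs"
  assumes lcs_codomain: "lcs E" and finite: "finite I" and topspace: "topspace (topo G) = carrier G"
    and inj: "\<And>x y. x \<in> carrier G \<Longrightarrow> y \<in> carrier G \<Longrightarrow> (\<And>i. i \<in> I \<Longrightarrow> \<pi> i x = \<pi> i y) \<Longrightarrow> x = y"
    and zero_closed: "\<zero>\<^bsub>G\<^esub> \<in> carrier G" and zero: "\<And>i. i \<in> I \<Longrightarrow> \<pi> i \<zero>\<^bsub>G\<^esub> = \<zero>\<^bsub>E\<^esub>"
    and add_closed: "\<And>x y. x \<in> carrier G \<Longrightarrow> y \<in> carrier G \<Longrightarrow> x \<oplus>\<^bsub>G\<^esub> y \<in> carrier G"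
    and add: "\<And>i x y. i \<in> I \<Longrightarrow> x \<in> carrier G \<Longrightarrow> y \<in> carrier G \<Longrightarrow>
      \<pi> i (x \<oplus>\<^bsub>G\<^esub> y) = \<pi> i x \<oplus>\<^bsub>E\<^esub> \<pi> i y"
    and smult_closed: "\<And>a x. x \<in> carrier G \<Longrightarrow> a \<odot>\<^bsub>G\<^esub> x \<in> carrier G"
    and smult: "\<And>i a x. i \<in> I \<Longrightarrow> x \<in> carrier G \<Longrightarrow> \<pi> i (a \<odot>\<^bsub>G\<^esub> x) = a \<odot>\<^bsub>E\<^esub> \<pi> i x"
    and continuous: "\<And>i. i \<in> I \<Longrightarrow> continuous_map (topo G) (topo E) (\<pi> i)"
    and neighbourhood: "\<And>U x. openin (topo G) U \<Longrightarrow> x \<in> U \<Longrightarrow>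
      \<exists>V. (\<forall>i\<in>I. openin (topo E) (V i) \<and> \<pi> i x \<in> V i) \<and> {y \<in> carrier G. \<forall>i\<in>I. \<pi> i y \<in> V i} \<subseteq> U"
begin

lemma continuous_map_into:
  assumes f: "f \<in> topspace X \<rightarrow> carrier G"
    and cont: "\<And>i. i \<in> I \<Longrightarrow> continuous_map X (topo E) (\<lambda>x. \<pi> i (f x))"
  shows "continuous_map X (topo G) f"
  unfolding continuous_map_def
proof (intro conjI allI impI)
  show "f \<in> topspace X \<rightarrow> topspace (topo G)"
    using f topspace by simp
  fix U assume U: "openin (topo G) U"
  show "openin X {x \<in> topspace X. f x \<in> U}"
  proof (subst openin_subopen, clarify)
    fix x assume x: "x \<in> topspace X" "f x \<in> U"
    obtain V where V: "\<forall>i\<in>I. openin (topo E) (V i) \<and> \<pi> i (f x) \<in> V i"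
      "{y \<in> carrier G. \<forall>i\<in>I. \<pi> i y \<in> V i} \<subseteq> U"
      using neighbourhood[OF U x(2)] by blast
    define T where "T = (if I = {} then topspace X else (\<Inter>i\<in>I. {x \<in> topspace X. \<pi> i (f x) \<in> V i}))"
    have "openin X T"
      using finite V(1) cont
      by (auto simp: T_def intro!: openin_Inter openin_continuous_map_preimage)
    moreover have "x \<in> T"
      using x V(1) by (simp add: T_def)
    moreover have "T \<subseteq> {x \<in> topspace X. f x \<in> U}"
      using V(2) f by (fastforce simp: T_def split: if_splits)
    ultimately show "\<exists>T. openin X T \<and> x \<in> T \<and> T \<subseteq> {x \<in> topspace X. f x \<in> U}"
      by blast
  qed
qed

lemma limitin_into:
  assumes "l \<in> carrier G" "\<forall>\<^sub>F t in F. f t \<in> carrier G"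
    and lim: "\<And>i. i \<in> I \<Longrightarrow> limitin (topo E) (\<lambda>t. \<pi> i (f t)) (\<pi> i l) F"
  shows "limitin (topo G) f l F"
  unfolding limitin_def
proof (intro conjI allI impI)
  show "l \<in> topspace (topo G)"
    using assms(1) topspace by simp
  fix U assume U: "openin (topo G) U \<and> l \<in> U"
  obtain V where V: "\<forall>i\<in>I. openin (topo E) (V i) \<and> \<pi> i l \<in> V i"
    "{y \<in> carrier G. \<forall>i\<in>I. \<pi> i y \<in> V i} \<subseteq> U"
    using neighbourhood[OF U[THEN conjunct1] U[THEN conjunct2]] by blast
  have "\<forall>\<^sub>F t in F. \<forall>i\<in>I. \<pi> i (f t) \<in> V i"
    using finite V(1) lim by (intro eventually_ball_finite) (auto simp: limitin_def)
  with assms(2) show "\<forall>\<^sub>F t in F. f t \<in> U"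
    by eventually_elim (use V(2) in blast)
qed

lemma lcs_domain: "lcs G"
proof -
  note E = lcs_codomain and top = topspace
  have closed: "\<pi> i x \<in> carrier E" if "i \<in> I" "x \<in> carrier G" for i x
    using continuous_map_into_carrier[OF E continuous[OF that(1)]] that(2) top by simp
  have cring: "cring real_ring"
    using E lcs_module Module.module.axioms(1) by blast
  have neg: "(-1) \<odot>\<^bsub>G\<^esub> x \<oplus>\<^bsub>G\<^esub> x = \<zero>\<^bsub>G\<^esub>" if "x \<in> carrier G" for x
  proof (rule inj)
    fix i assume "i \<in> I"
    then show "\<pi> i ((-1) \<odot>\<^bsub>G\<^esub> x \<oplus>\<^bsub>G\<^esub> x) = \<pi> i \<zero>\<^bsub>G\<^esub>"
      using that E by (simp add: add smult smult_closed zero closed lcs_add_commute[OF E] lcs_diff_eq[OF E, symmetric])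
  qed (use that in \<open>auto intro: add_closed smult_closed zero_closed\<close>)
  have ab: "abelian_group G"
  proof (rule abelian_groupI)
    show "\<exists>y\<in>carrier G. y \<oplus>\<^bsub>G\<^esub> x = \<zero>\<^bsub>G\<^esub>" if "x \<in> carrier G" for x
      using neg[OF that] smult_closed[OF that] by blast
  qed (use E in \<open>auto intro!: inj simp: add add_closed zero zero_closed closed lcs_add_assoc lcs_add_left_commute lcs_add_commute\<close>)
  have mod: "Module.module real_ring G"
    using E by (intro module.intro cring ab module_axioms.intro)
      (auto intro!: inj simp: add add_closed smult smult_closed closed lcs_smult_add_left lcs_smult_add_right)
  have Hausdorff: "Hausdorff_space (topo G)"
    unfolding Hausdorff_space_def top
  proof (intro allI impI, elim conjE)
    fix x y assume xy: "x \<in> carrier G" "y \<in> carrier G" "x \<noteq> y"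
    then obtain i where i: "i \<in> I" "\<pi> i x \<noteq> \<pi> i y"
      using inj by blast
    then obtain U V where UV: "openin (topo E) U" "openin (topo E) V" "\<pi> i x \<in> U" "\<pi> i y \<in> V" "disjnt U V"
      using lcs_Hausdorff[OF E] closed[OF i(1)] xy lcs_topspace[OF E] unfolding Hausdorff_space_def by metis
    show "\<exists>U V. openin (topo G) U \<and> openin (topo G) V \<and> x \<in> U \<and> y \<in> V \<and> disjnt U V"
      using openin_continuous_map_preimage[OF continuous[OF i(1)] UV(1)]
        openin_continuous_map_preimage[OF continuous[OF i(1)] UV(2)] UV(3-) xy top
      by (intro exI[of _ "{z \<in> topspace (topo G). \<pi> i z \<in> U}"]
          exI[of _ "{z \<in> topspace (topo G). \<pi> i z \<in> V}"]) (auto simp: disjnt_iff)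
  qed
  have comp: "continuous_map X (topo E) (\<lambda>z. \<pi> i (f z))" if "i \<in> I" "continuous_map X (topo G) f" for X i f
    using continuous_map_compose[OF that(2) continuous[OF that(1)]] by (simp add: o_def)
  have "continuous_map (prod_topology (topo G) (topo G)) (topo G) (\<lambda>(x, y). x \<oplus>\<^bsub>G\<^esub> y)"
  proof (rule continuous_map_into)
    fix i assume i: "i \<in> I"
    have "continuous_map (prod_topology (topo G) (topo G)) (topo E) (\<lambda>z. \<pi> i (fst z) \<oplus>\<^bsub>E\<^esub> \<pi> i (snd z))"
      using i by (intro continuous_map_lcs_add[OF E] comp continuous_map_fst continuous_map_snd)
    then show "continuous_map (prod_topology (topo G) (topo G)) (topo E) (\<lambda>z. \<pi> i (case z of (x, y) \<Rightarrow> x \<oplus>\<^bsub>G\<^esub> y))"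
      by (rule continuous_map_eq) (use i in \<open>auto simp: add top\<close>)
  qed (auto intro: add_closed simp: top)
  moreover have "continuous_map (prod_topology euclideanreal (topo G)) (topo G) (\<lambda>(a, x). a \<odot>\<^bsub>G\<^esub> x)"
  proof (rule continuous_map_into)
    fix i assume i: "i \<in> I"
    have "continuous_map (prod_topology euclideanreal (topo G)) (topo E) (\<lambda>z. fst z \<odot>\<^bsub>E\<^esub> \<pi> i (snd z))"
      using i by (intro continuous_map_lcs_smult[OF E] comp continuous_map_fst continuous_map_snd)
    then show "continuous_map (prod_topology euclideanreal (topo G)) (topo E) (\<lambda>z. \<pi> i (case z of (a, x) \<Rightarrow> a \<odot>\<^bsub>G\<^esub> x))"
      by (rule continuous_map_eq) (use i in \<open>auto simp: smult top\<close>)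
  qed (auto intro: smult_closed simp: top)
  moreover have "\<exists>C W. convex_in G C \<and> openin (topo G) W \<and> \<zero>\<^bsub>G\<^esub> \<in> W \<and> W \<subseteq> C \<and> C \<subseteq> U"
    if U: "openin (topo G) U" "\<zero>\<^bsub>G\<^esub> \<in> U" for U
  proof -
    obtain V' where V': "\<forall>i\<in>I. openin (topo E) (V' i) \<and> \<pi> i \<zero>\<^bsub>G\<^esub> \<in> V' i"
      "{y \<in> carrier G. \<forall>i\<in>I. \<pi> i y \<in> V' i} \<subseteq> U"
      using neighbourhood[OF U] by blast
    define V where "V = (if I = {} then topspace (topo E) else (\<Inter>i\<in>I. V' i))"
    have V: "openin (topo E) V" "\<zero>\<^bsub>E\<^esub> \<in> V" "{x \<in> carrier G. \<forall>i\<in>I. \<pi> i x \<in> V} \<subseteq> U"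
      using V' finite zero E lcs_topspace[OF E] openin_topspace[of "topo E"] by (auto simp: V_def intro!: openin_Inter)
    obtain C W where CW: "convex_in E C" "openin (topo E) W" "\<zero>\<^bsub>E\<^esub> \<in> W" "W \<subseteq> C" "C \<subseteq> V"
      using E V(1,2) unfolding lcs_def by meson
    define C' W' where "C' = {x \<in> carrier G. \<forall>i\<in>I. \<pi> i x \<in> C}"
      and "W' = {x \<in> carrier G. \<forall>i\<in>I. \<pi> i x \<in> W}"
    have "convex_in G C'"
      using CW(1) by (auto simp: convex_in_def C'_def add add_closed smult smult_closed)
    moreover have "W' = (if I = {} then topspace (topo G) else (\<Inter>i\<in>I. {x \<in> topspace (topo G). \<pi> i x \<in> W}))"
      by (auto simp: W'_def top)
    then have "openin (topo G) W'"
      using finite CW(2) continuous by (auto intro!: openin_Inter openin_continuous_map_preimage)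
    moreover have "\<zero>\<^bsub>G\<^esub> \<in> W'" "W' \<subseteq> C'"
      using CW(3,4) zero zero_closed by (auto simp: W'_def C'_def)
    moreover have "C' \<subseteq> U"
      using CW(5) V(3) unfolding C'_def by blast
    ultimately show ?thesis
      by blast
  qed
  ultimately show ?thesis
    unfolding lcs_def using mod top Hausdorff by blast
qed

end

lemma real_tvs_simps [simp]:
  "carrier real_tvs = UNIV" "add real_tvs = (+)" "zero real_tvs = 0" "smult real_tvs = (*)"
  "topo real_tvs = euclideanreal"
  by (simp_all add: real_tvs_def)

lemma lcs_real_tvs [simp]: "lcs real_tvs"
proof -
  have cring: "cring real_ring"
    by (intro cringI abelian_groupI comm_monoidI) (auto simp: algebra_simps intro: exI[of _ "- _"])
  have ab: "abelian_group real_tvs"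
    by (rule abelian_groupI) (auto intro: exI[of _ "- _"])
  have mod: "Module.module real_ring real_tvs"
    by (intro module.intro cring ab module_axioms.intro) (auto simp: algebra_simps)
  have "\<exists>C W. convex_in real_tvs C \<and> open W \<and> 0 \<in> W \<and> W \<subseteq> C \<and> C \<subseteq> U" if "open U" "0 \<in> U" for U
  proof -
    obtain e where e: "e > 0" "ball 0 e \<subseteq> U"
      using \<open>open U\<close> \<open>0 \<in> U\<close> open_contains_ball by blast
    have "convex_in real_tvs (ball 0 e)"
      using convex_ball[of "0::real" e] unfolding convex_in_def convex_def by auto
    then show ?thesis
      using e by (intro exI[of _ "ball 0 e"]) auto
  qed
  then show ?thesis
    unfolding lcs_def using mod
    by (auto simp: case_prod_beta intro!: continuous_intros)
qed

lemma real_tvs_minus [simp]: "x \<ominus>\<^bsub>real_tvs\<^esub> y = x - y"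
  using lcs_diff_eq[OF lcs_real_tvs, of x y] by simp

lemma base_tvs_simps [simp]:
  "carrier (base_tvs E) = Base ` carrier E" "zero (base_tvs E) = Base \<zero>\<^bsub>E\<^esub>"
  "x \<oplus>\<^bsub>base_tvs E\<^esub> y = Base (unBase x \<oplus>\<^bsub>E\<^esub> unBase y)"
  "a \<odot>\<^bsub>base_tvs E\<^esub> x = Base (a \<odot>\<^bsub>E\<^esub> unBase x)"
  by (simp_all add: base_tvs_def transport_tvs_def)

lemma initial_base_tvs:
  assumes "lcs E"
  shows "initial_family {()} (\<lambda>_. unBase) (base_tvs E) E"
proof -
  have topo: "topo (base_tvs E) = pullback_topology (Base ` carrier E) unBase (topo E)"
    by (simp add: base_tvs_def transport_tvs_def)
  have cont: "continuous_map (topo (base_tvs E)) (topo E) unBase"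
    using continuous_map_pullback[of "topo E" "topo E" id "Base ` carrier E" unBase] by (simp add: topo)
  have top: "topspace (topo (base_tvs E)) = Base ` carrier E"
    using lcs_topspace[OF assms] by (auto simp: topo topspace_pullback_topology)
  have nb: "\<exists>V. openin (topo E) V \<and> unBase x \<in> V \<and> {y \<in> Base ` carrier E. unBase y \<in> V} \<subseteq> U"
    if "openin (topo (base_tvs E)) U" "x \<in> U" for U x
    using that by (auto simp: topo openin_pullback_topology)
  show ?thesis
  proof unfold_locales
    fix U x assume U: "openin (topo (base_tvs E)) U" "x \<in> U"
    obtain V where "openin (topo E) V" "unBase x \<in> V" "{y \<in> Base ` carrier E. unBase y \<in> V} \<subseteq> U"
      using nb[OF U] by blast
    then show "\<exists>V. (\<forall>i\<in>{()}. openin (topo E) (V i) \<and> unBase x \<in> V i) \<and>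
        {y \<in> carrier (base_tvs E). \<forall>i\<in>{()}. unBase y \<in> V i} \<subseteq> U"
      by (intro exI[of _ "\<lambda>_. V"]) simp
  next
    fix x y assume xy: "x \<in> carrier (base_tvs E)" "y \<in> carrier (base_tvs E)"
      "\<And>i. i \<in> {()} \<Longrightarrow> unBase x = unBase y"
    show "x = y"
      using xy(1,2) xy(3)[of "()"] by auto
  qed (use cont top assms in auto)
qed

lemma lcs_base_tvs [simp]: "lcs E \<Longrightarrow> lcs (base_tvs E)"
  by (rule initial_family.lcs_domain[OF initial_base_tvs])

lemma openin_base_tvs:
  assumes "lcs E" "openin (topo E) U"
  shows "openin (topo (base_tvs E)) (Base ` U)"
proof -
  have "openin (topo (base_tvs E)) {x \<in> topspace (topo (base_tvs E)). unBase x \<in> U}"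
    using initial_family.continuous[OF initial_base_tvs[OF assms(1)]] assms(2)
    by (intro openin_continuous_map_preimage) auto
  moreover have "{x \<in> topspace (topo (base_tvs E)). unBase x \<in> U} = Base ` U"
    using openin_subset[OF assms(2)] assms by (auto simp: lcs_topspace)
  ultimately show ?thesis
    by simp
qed

lemma square_tvs_simps [simp]:
  "carrier (square_tvs E) = {Pair x v |x v. x \<in> carrier E \<and> v \<in> carrier E}"
  "zero (square_tvs E) = Pair \<zero>\<^bsub>E\<^esub> \<zero>\<^bsub>E\<^esub>"
  "p \<oplus>\<^bsub>square_tvs E\<^esub> q = Pair (pfst p \<oplus>\<^bsub>E\<^esub> pfst q) (psnd p \<oplus>\<^bsub>E\<^esub> psnd q)"
  "a \<odot>\<^bsub>square_tvs E\<^esub> p = Pair (a \<odot>\<^bsub>E\<^esub> pfst p) (a \<odot>\<^bsub>E\<^esub> psnd p)"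
  by (auto simp: square_tvs_def transport_tvs_def prod_tvs_def)

lemma initial_square_tvs:
  assumes "lcs E"
  shows "initial_family UNIV (\<lambda>b. if b then pfst else psnd) (square_tvs E) E"
proof -
  let ?C = "{Pair x v |x v. x \<in> carrier E \<and> v \<in> carrier E}"
  have C: "(\<lambda>(x, v). Pair x v) ` (carrier E \<times> carrier E) = ?C"
    by auto
  have topo: "topo (square_tvs E) =
      pullback_topology ?C (\<lambda>p. (pfst p, psnd p)) (prod_topology (topo E) (topo E))"
    by (simp add: square_tvs_def transport_tvs_def prod_tvs_def C)
  have cont: "continuous_map (topo (square_tvs E)) (topo E) pfst"
    "continuous_map (topo (square_tvs E)) (topo E) psnd"
    using continuous_map_pullback[OF continuous_map_fst[of "topo E" "topo E"], of ?C "\<lambda>p. (pfst p, psnd p)"]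
      continuous_map_pullback[OF continuous_map_snd[of "topo E" "topo E"], of ?C "\<lambda>p. (pfst p, psnd p)"]
    by (simp_all add: topo o_def)
  have top: "topspace (topo (square_tvs E)) = ?C"
    using lcs_topspace[OF assms] by (auto simp: topo topspace_pullback_topology)
  have nb: "\<exists>V. (\<forall>b. openin (topo E) (V b) \<and> (if b then pfst else psnd) x \<in> V b) \<and>
      {y \<in> ?C. \<forall>b. (if b then pfst else psnd) y \<in> V b} \<subseteq> U"
    if U: "openin (topo (square_tvs E)) U" "x \<in> U" for U x
  proof -
    obtain W where W: "openin (prod_topology (topo E) (topo E)) W" "U = (\<lambda>p. (pfst p, psnd p)) -` W \<inter> ?C"
      using U(1) unfolding topo openin_pullback_topology by blast
    then obtain V1 V2 where V: "openin (topo E) V1" "openin (topo E) V2" "pfst x \<in> V1" "psnd x \<in> V2" "V1 \<times> V2 \<subseteq> W"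
    proof -
      have "(pfst x, psnd x) \<in> W"
        using U(2) W(2) by simp
      then show thesis
        using W(1) that unfolding openin_prod_topology_alt by blast
    qed
    have "{y \<in> ?C. \<forall>b. (if b then pfst else psnd) y \<in> (if b then V1 else V2)} \<subseteq> U"
      using V(5) unfolding W(2) by (auto simp: all_bool_eq)
    then show ?thesis
      using V(1-4) by (intro exI[of _ "\<lambda>b. if b then V1 else V2"]) auto
  qed
  show ?thesis
  proof unfold_locales
    fix U x assume "openin (topo (square_tvs E)) U" "x \<in> U"
    from nb[OF this] show "\<exists>V. (\<forall>b\<in>UNIV. openin (topo E) (V b) \<and> (if b then pfst else psnd) x \<in> V b) \<and>
        {y \<in> carrier (square_tvs E). \<forall>b\<in>UNIV. (if b then pfst else psnd) y \<in> V b} \<subseteq> U"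
      by simp
  next
    fix x y assume "x \<in> carrier (square_tvs E)" "y \<in> carrier (square_tvs E)"
      "\<And>b. b \<in> UNIV \<Longrightarrow> (if b then pfst else psnd) x = (if b then pfst else psnd) y"
    then show "x = y"
      using \<open>\<And>b. b \<in> UNIV \<Longrightarrow> (if b then pfst else psnd) x = (if b then pfst else psnd) y\<close>[of True]
        \<open>\<And>b. b \<in> UNIV \<Longrightarrow> (if b then pfst else psnd) x = (if b then pfst else psnd) y\<close>[of False]
      by auto
  qed (use cont top assms in auto)
qed

lemma lcs_square_tvs [simp]: "lcs E \<Longrightarrow> lcs (square_tvs E)"
  by (rule initial_family.lcs_domain[OF initial_square_tvs])

lemma continuous_map_pfst_psnd:
  assumes "lcs E"
  shows "continuous_map (topo (square_tvs E)) (topo E) pfst"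
    "continuous_map (topo (square_tvs E)) (topo E) psnd"
  using initial_family.continuous[OF initial_square_tvs[OF assms], of True]
    initial_family.continuous[OF initial_square_tvs[OF assms], of False] by simp_all

lemma continuous_map_Pair:
  assumes E: "lcs E" and "continuous_map X (topo E) f" "continuous_map X (topo E) g"
  shows "continuous_map X (topo (square_tvs E)) (\<lambda>x. Pair (f x) (g x))"
  using assms continuous_map_into_carrier[OF E]
  by (intro initial_family.continuous_map_into[OF initial_square_tvs[OF E]]) auto

lemma limitin_Pair:
  assumes E: "lcs E" and f: "limitin (topo E) f l F" and g: "limitin (topo E) g m F"
  shows "limitin (topo (square_tvs E)) (\<lambda>t. Pair (f t) (g t)) (Pair l m) F"
proof (rule initial_family.limitin_into[OF initial_square_tvs[OF E]])
  show "\<forall>\<^sub>F t in F. Pair (f t) (g t) \<in> carrier (square_tvs E)"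
    using limitin_lcs_iff[OF E, THEN iffD1, OF f, THEN conjunct2, THEN conjunct1]
      limitin_lcs_iff[OF E, THEN iffD1, OF g, THEN conjunct2, THEN conjunct1]
    by eventually_elim simp
qed (use f g E in \<open>auto simp: limitin_lcs_iff[OF E]\<close>)

lemma square_tvs_diff:
  assumes E: "lcs E" and "a \<in> carrier E" "b \<in> carrier E" "c \<in> carrier E" "d \<in> carrier E"
  shows "Pair a b \<ominus>\<^bsub>square_tvs E\<^esub> Pair c d = Pair (a \<ominus>\<^bsub>E\<^esub> c) (b \<ominus>\<^bsub>E\<^esub> d)"
  using assms lcs_diff_eq[OF lcs_square_tvs[OF E], of "Pair a b" "Pair c d"] by (simp add: lcs_diff_eq)

abbreviation times_carrier :: "'a iter tvs \<Rightarrow> 'a iter set \<Rightarrow> 'a iter set" where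
  "times_carrier E U \<equiv> {Pair x v |x v. x \<in> U \<and> v \<in> carrier E}"

lemma openin_times_carrier:
  assumes E: "lcs E" and U: "openin (topo E) U"
  shows "openin (topo (square_tvs E)) (times_carrier E U)"
proof -
  have "openin (topo (square_tvs E)) {p \<in> topspace (topo (square_tvs E)). pfst p \<in> U}"
    using continuous_map_pfst_psnd(1)[OF E] U by (rule openin_continuous_map_preimage)
  moreover have "{p \<in> topspace (topo (square_tvs E)). pfst p \<in> U} = times_carrier E U"
    using openin_subset[OF U] E by (auto simp: lcs_topspace)
  ultimately show ?thesis
    by simp
qed

lemma power_tvs_simps [simp]:
  "carrier (power_tvs E n) = (\<Pi>\<^sub>E i\<in>{..<n}. carrier E)" "zero (power_tvs E n) = (\<lambda>i\<in>{..<n}. \<zero>\<^bsub>E\<^esub>)"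
  "x \<oplus>\<^bsub>power_tvs E n\<^esub> y = (\<lambda>i\<in>{..<n}. x i \<oplus>\<^bsub>E\<^esub> y i)"
  "a \<odot>\<^bsub>power_tvs E n\<^esub> x = (\<lambda>i\<in>{..<n}. a \<odot>\<^bsub>E\<^esub> x i)"
  "topo (power_tvs E n) = product_topology (\<lambda>_. topo E) {..<n}"
  by (simp_all add: power_tvs_def)

lemma initial_power_tvs:
  assumes E: "lcs E"
  shows "initial_family {..<n} (\<lambda>i x. x i) (power_tvs E n) E"
proof -
  have nb: "\<exists>V. (\<forall>i\<in>{..<n}. openin (topo E) (V i) \<and> x i \<in> V i) \<and>
      {y \<in> (\<Pi>\<^sub>E i\<in>{..<n}. carrier E). \<forall>i\<in>{..<n}. y i \<in> V i} \<subseteq> U"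
    if U: "openin (product_topology (\<lambda>_. topo E) {..<n}) U" "x \<in> U" for U x
  proof -
    obtain V where V: "\<forall>i\<in>{..<n}. openin (topo E) (V i)" "x \<in> Pi\<^sub>E {..<n} V" "Pi\<^sub>E {..<n} V \<subseteq> U"
      using U unfolding openin_product_topology_alt by meson
    have "{y \<in> (\<Pi>\<^sub>E i\<in>{..<n}. carrier E). \<forall>i\<in>{..<n}. y i \<in> V i} \<subseteq> Pi\<^sub>E {..<n} V"
      by (auto simp: PiE_def)
    then have "{y \<in> (\<Pi>\<^sub>E i\<in>{..<n}. carrier E). \<forall>i\<in>{..<n}. y i \<in> V i} \<subseteq> U"
      using V(3) by (rule order_trans)
    moreover have "\<forall>i\<in>{..<n}. openin (topo E) (V i) \<and> x i \<in> V i"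
      using V(1,2) by (simp add: PiE_iff)
    ultimately show ?thesis
      by blast
  qed
  have cont: "\<forall>i\<in>{..<n}. continuous_map (product_topology (\<lambda>_. topo E) {..<n}) (topo E) (\<lambda>x. x i)"
    by (auto intro: continuous_map_product_projection)
  have inj: "x = y" if "x \<in> (\<Pi>\<^sub>E i\<in>{..<n}. carrier E)" "y \<in> (\<Pi>\<^sub>E i\<in>{..<n}. carrier E)"
    "\<forall>i\<in>{..<n}. x i = y i" for x y
    using that by (intro PiE_ext[OF that(1,2)]) auto
  show ?thesis
  proof unfold_locales
    fix U x assume "openin (topo (power_tvs E n)) U" "x \<in> U"
    then show "\<exists>V. (\<forall>i\<in>{..<n}. openin (topo E) (V i) \<and> x i \<in> V i) \<and>
        {y \<in> carrier (power_tvs E n). \<forall>i\<in>{..<n}. y i \<in> V i} \<subseteq> U"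
      using nb by simp
  next
    fix x y assume "x \<in> carrier (power_tvs E n)" "y \<in> carrier (power_tvs E n)"
      "\<And>i. i \<in> {..<n} \<Longrightarrow> x i = y i"
    then show "x = y"
      using inj by simp
  qed (use E cont in \<open>simp_all add: lcs_topspace[OF E] PiE_iff\<close>)
qed

lemma lcs_power_tvs: "lcs E \<Longrightarrow> lcs (power_tvs E n)"
  by (rule initial_family.lcs_domain[OF initial_power_tvs])

section \<open>Directional derivatives\<close>

text \<open>
  The limit used in the recursion for \<open>Ck\<close>, for spaces that need not be iterated squares.
\<close>

definition has_ddir :: "'a tvs \<Rightarrow> 'b tvs \<Rightarrow> ('a \<Rightarrow> 'b) \<Rightarrow> 'a \<Rightarrow> 'a \<Rightarrow> 'b \<Rightarrow> bool" where
  "has_ddir E F \<Phi> x v l \<longleftrightarrow>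
     limitin (topo F) (\<lambda>t. (1 / t) \<odot>\<^bsub>F\<^esub> (\<Phi> (x \<oplus>\<^bsub>E\<^esub> t \<odot>\<^bsub>E\<^esub> v) \<ominus>\<^bsub>F\<^esub> \<Phi> x)) l (at 0)"

definition C1_map :: "'a tvs \<Rightarrow> 'b tvs \<Rightarrow> 'a set \<Rightarrow> ('a \<Rightarrow> 'b) \<Rightarrow> ('a \<Rightarrow> 'a \<Rightarrow> 'b) \<Rightarrow> bool" where
  "C1_map E F U \<Phi> d \<longleftrightarrow> continuous_map (subtopology (topo E) U) (topo F) \<Phi> \<and>
     (\<forall>x\<in>U. \<forall>v\<in>carrier E. has_ddir E F \<Phi> x v (d x v)) \<and>
     continuous_map (prod_topology (subtopology (topo E) U) (topo E)) (topo F) (\<lambda>(x, v). d x v)"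

lemma limitin_dual:
  assumes "limitin (topo F) f l G" "ell \<in> dual F"
  shows "((\<lambda>t. ell (f t)) \<longlongrightarrow> ell l) G"
  using continuous_map_limit[OF dual_continuous[OF assms(2)] assms(1)] by (simp add: o_def)

lemma lcs_add_diff_cancel_left:
  assumes E: "lcs E" and "x \<in> carrier E" "y \<in> carrier E"
  shows "(x \<oplus>\<^bsub>E\<^esub> y) \<ominus>\<^bsub>E\<^esub> x = y"
  using assms by (intro dual_eqI[OF E]) (simp_all add: dual_simps)

text \<open>
  The direction may move with \<open>t\<close>: since it converges, its seminorms stay bounded.
\<close>

lemma eventually_segment_in_open:
  fixes E (structure)
  assumes E: "lcs E" and U: "openin (topo E) U" "x \<in> U" and v: "limitin (topo E) v w (at (0::real))"
  shows "\<forall>\<^sub>F t in at 0. v t \<in> carrier E \<and> (\<forall>s. \<bar>s\<bar> \<le> \<bar>t\<bar> \<longrightarrow> x \<oplus> s \<odot> v t \<in> U)"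
proof -
  obtain p where p: "cseminorm E p" "{y \<in> carrier E. p (y \<ominus> x) < 1} \<subseteq> U"
    by (rule cseminorm_ball_in_open[OF E U])
  have x: "x \<in> carrier E"
    using openin_subset[OF U(1)] U(2) lcs_topspace[OF E] by auto
  have "((\<lambda>t. p (v t)) \<longlongrightarrow> p w) (at 0)"
    using continuous_map_limit[OF cseminorm_continuous[OF p(1)] v] by (simp add: o_def)
  then have "((\<lambda>t. \<bar>t\<bar> * p (v t)) \<longlongrightarrow> \<bar>0\<bar> * p w) (at 0)"
    by (intro tendsto_intros)
  then have "\<forall>\<^sub>F t in at 0. \<bar>t\<bar> * p (v t) < 1"
    by (intro order_tendstoD(2)[where y = "\<bar>0\<bar> * p w"]) auto
  moreover have "\<forall>\<^sub>F t in at 0. v t \<in> carrier E"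
    using v limitin_lcs_iff[OF E] by blast
  ultimately show ?thesis
  proof eventually_elim
    case (elim t)
    have "x \<oplus> s \<odot> v t \<in> U" if s: "\<bar>s\<bar> \<le> \<bar>t\<bar>" for s
    proof -
      have "p ((x \<oplus> s \<odot> v t) \<ominus> x) = \<bar>s\<bar> * p (v t)"
        using E x elim cseminorm_smult[OF p(1)] by (simp add: lcs_add_diff_cancel_left)
      also have "\<dots> \<le> \<bar>t\<bar> * p (v t)"
        using s cseminorm_nonneg[OF E p(1)] elim by (intro mult_right_mono) auto
      finally show ?thesis
        using p(2) elim E x by auto
    qed
    with elim show ?case by blast
  qed
qed

lemma eventually_line_in_open:
  assumes E: "lcs E" and U: "openin (topo E) U" "x \<in> U" and v: "v \<in> carrier E"
  shows "\<forall>\<^sub>F t in at (0::real). x \<oplus>\<^bsub>E\<^esub> t \<odot>\<^bsub>E\<^esub> v \<in> U"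
proof -
  have "limitin (topo E) (\<lambda>_. v) v (at (0::real))"
    using v lcs_topspace[OF E] by simp
  from eventually_segment_in_open[OF E U this] show ?thesis
    by eventually_elim auto
qed

lemma real_derivative_along_line:
  fixes E (structure)
  assumes E: "lcs E" and F: "lcs F" and U: "openin (topo E) U" and \<Phi>: "\<Phi> \<in> U \<rightarrow> carrier F"
    and d: "has_ddir E F \<Phi> (x \<oplus> s \<odot> v) v l" and ell: "ell \<in> dual F"
    and x: "x \<in> carrier E" and v: "v \<in> carrier E" and xs: "x \<oplus> s \<odot> v \<in> U"
  shows "((\<lambda>s. ell (\<Phi> (x \<oplus> s \<odot> v))) has_real_derivative ell l) (at s)"
proof -
  define y where "y = x \<oplus> s \<odot> v"
  have shift: "y \<oplus> h \<odot> v = x \<oplus> (s + h) \<odot> v" for h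
    using E x v by (simp add: y_def lcs_smult_add_left lcs_add_assoc)
  have "((\<lambda>h. ell ((1 / h) \<odot>\<^bsub>F\<^esub> (\<Phi> (y \<oplus> h \<odot> v) \<ominus>\<^bsub>F\<^esub> \<Phi> y))) \<longlongrightarrow> ell l) (at 0)"
    using limitin_dual[OF d[unfolded has_ddir_def] ell] by (simp add: y_def)
  moreover have "\<forall>\<^sub>F h in at 0. y \<oplus> h \<odot> v \<in> U"
    using eventually_line_in_open[OF E U _ v] xs by (simp add: y_def)
  then have "\<forall>\<^sub>F h in at 0. ell ((1 / h) \<odot>\<^bsub>F\<^esub> (\<Phi> (y \<oplus> h \<odot> v) \<ominus>\<^bsub>F\<^esub> \<Phi> y)) =
      (ell (\<Phi> (x \<oplus> (s + h) \<odot> v)) - ell (\<Phi> (x \<oplus> s \<odot> v))) / h"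
  proof eventually_elim
    case (elim h)
    have "\<Phi> (y \<oplus> h \<odot> v) \<in> carrier F" "\<Phi> y \<in> carrier F"
      using elim \<Phi> xs by (auto simp: y_def)
    then have "ell ((1 / h) \<odot>\<^bsub>F\<^esub> (\<Phi> (y \<oplus> h \<odot> v) \<ominus>\<^bsub>F\<^esub> \<Phi> y)) =
        (1 / h) * (ell (\<Phi> (y \<oplus> h \<odot> v)) - ell (\<Phi> y))"
      using dual_smult[OF ell] dual_diff[OF F ell] F by simp
    then show ?case
      by (simp add: shift) (simp add: y_def)
  qed
  ultimately show ?thesis
    unfolding DERIV_def by (rule Lim_transform_eventually)
qed

lemma mean_value_from_zero:
  fixes g :: "real \<Rightarrow> real"
  assumes "\<And>s. \<bar>s\<bar> \<le> \<bar>t\<bar> \<Longrightarrow> (g has_real_derivative g' s) (at s)"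
  shows "\<exists>s. \<bar>s\<bar> \<le> \<bar>t\<bar> \<and> g t - g 0 = t * g' s"
proof (cases t "0 :: real" rule: linorder_cases)
  case less
  then have "\<exists>z. t < z \<and> z < 0 \<and> g 0 - g t = (0 - t) * g' z"
    using assms by (intro MVT2) auto
  then obtain z where "t < z" "z < 0" "g 0 - g t = (0 - t) * g' z"
    by blast
  then show ?thesis
    by (intro exI[of _ z]) simp
next
  case equal
  then show ?thesis
    by (intro exI[of _ 0]) simp
next
  case greater
  then have "\<exists>z. 0 < z \<and> z < t \<and> g t - g 0 = (t - 0) * g' z"
    using assms by (intro MVT2) auto
  then obtain z where "0 < z" "z < t" "g t - g 0 = (t - 0) * g' z"
    by blast
  then show ?thesis
    by (intro exI[of _ z]) simp
qed

text \<open>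
  The difference quotients of a \<open>C\<^sup>1\<close> map converge even if the direction moves: by the mean value
  theorem, applied to a functional that norms the error, the quotient at \<open>t\<close> is as close to
  \<open>d x w\<close> as some derivative at a point of the segment is. This is what makes the chain rule work.
\<close>

theorem C1_map_moving_direction:
  fixes E (structure)
  assumes E: "lcs E" and F: "lcs F" and U: "openin (topo E) U" and C1: "C1_map E F U \<Phi> d"
    and x: "x \<in> U" and v: "limitin (topo E) v w (at 0)"
  shows "limitin (topo F) (\<lambda>t. (1 / t) \<odot>\<^bsub>F\<^esub> (\<Phi> (x \<oplus> t \<odot> v t) \<ominus>\<^bsub>F\<^esub> \<Phi> x)) (d x w) (at 0)"
proof -
  have UC: "U \<subseteq> carrier E"
    using openin_subset[OF U] lcs_topspace[OF E] by simp
  have xC: "x \<in> carrier E"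
    using x UC by blast
  have wC: "w \<in> carrier E"
    using v lcs_topspace[OF E] by (simp add: limitin_def)
  have \<Phi>: "\<Phi> y \<in> carrier F" if "y \<in> U" for y
    using C1 continuous_map_into_carrier[OF F] that UC lcs_topspace[OF E] unfolding C1_map_def by force
  have dcont: "continuous_map (prod_topology (subtopology (topo E) U) (topo E)) (topo F) (\<lambda>(x, v). d x v)"
    using C1 by (simp add: C1_map_def)
  have dC: "d y u \<in> carrier F" if "y \<in> U" "u \<in> carrier E" for y u
    using continuous_map_into_carrier[OF F dcont, of "(y, u)"] that UC lcs_topspace[OF E] by auto
  have seg: "\<forall>\<^sub>F t in at 0. v t \<in> carrier E \<and> (\<forall>s. \<bar>s\<bar> \<le> \<bar>t\<bar> \<longrightarrow> x \<oplus> s \<odot> v t \<in> U)"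
    by (rule eventually_segment_in_open[OF E U x v])
  have ne: "\<forall>\<^sub>F t in at 0. (t::real) \<noteq> 0"
    by (simp add: eventually_at_filter)
  show ?thesis
    unfolding limitin_lcs_iff[OF F]
  proof (intro conjI allI impI)
    show "d x w \<in> carrier F"
      using x wC by (rule dC)
    show "\<forall>\<^sub>F t in at 0. (1 / t) \<odot>\<^bsub>F\<^esub> (\<Phi> (x \<oplus> t \<odot> v t) \<ominus>\<^bsub>F\<^esub> \<Phi> x) \<in> carrier F"
      using seg by eventually_elim (use F \<Phi> x in simp)
    fix p assume p: "cseminorm F p"
    show "((\<lambda>t. p ((1 / t) \<odot>\<^bsub>F\<^esub> (\<Phi> (x \<oplus> t \<odot> v t) \<ominus>\<^bsub>F\<^esub> \<Phi> x) \<ominus>\<^bsub>F\<^esub> d x w)) \<longlongrightarrow> 0) (at 0)"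
    proof (rule tendstoI)
      fix e :: real assume e: "e > 0"
      have xw: "(x, w) \<in> topspace (prod_topology (subtopology (topo E) U) (topo E))"
        using x xC wC lcs_topspace[OF E] by simp
      obtain W where W: "openin (prod_topology (subtopology (topo E) U) (topo E)) W" "(x, w) \<in> W"
        "\<forall>z\<in>W. p ((case z of (x, v) \<Rightarrow> d x v) \<ominus>\<^bsub>F\<^esub> d x w) < e"
        using dcont[unfolded continuous_map_into_lcs_iff[OF F], THEN conjunct2, rule_format, OF xw p e]
        unfolding case_prod_conv by blast
      obtain N N' where N: "openin (subtopology (topo E) U) N" "x \<in> N"
        and N': "openin (topo E) N'" "w \<in> N'" and NW: "N \<times> N' \<subseteq> W"
        using W(1)[unfolded openin_prod_topology_alt, rule_format, OF W(2)] by blast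
      have openN: "openin (topo E) N" and NU: "N \<subseteq> U"
        using N(1) U by (simp_all add: openin_open_subtopology)
      have "\<forall>\<^sub>F t in at 0. v t \<in> N'"
        using v N' by (simp add: limitin_def)
      with ne eventually_segment_in_open[OF E openN N(2) v]
      show "\<forall>\<^sub>F t in at 0. dist (p ((1 / t) \<odot>\<^bsub>F\<^esub> (\<Phi> (x \<oplus> t \<odot> v t) \<ominus>\<^bsub>F\<^esub> \<Phi> x) \<ominus>\<^bsub>F\<^esub> d x w)) 0 < e"
      proof eventually_elim
        case (elim t)
        have vt: "v t \<in> carrier E" and segN: "\<And>s. \<bar>s\<bar> \<le> \<bar>t\<bar> \<Longrightarrow> x \<oplus> s \<odot> v t \<in> N"
          using elim by auto
        let ?z = "(1 / t) \<odot>\<^bsub>F\<^esub> (\<Phi> (x \<oplus> t \<odot> v t) \<ominus>\<^bsub>F\<^esub> \<Phi> x) \<ominus>\<^bsub>F\<^esub> d x w"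
        have tU: "x \<oplus> t \<odot> v t \<in> U"
          using segN[of t] NU by auto
        have zC: "?z \<in> carrier F"
          using \<Phi>[OF tU] \<Phi>[OF x] dC[OF x wC] F by simp
        \<comment> \<open>A functional that norms the error reduces the claim to the mean value theorem for \<open>ell \<circ> \<Phi>\<close>.\<close>
        obtain ell where ell: "ell \<in> dual F" "ell ?z = p ?z" "\<forall>y\<in>carrier F. \<bar>ell y\<bar> \<le> p y"
          by (rule Hahn_Banach[OF F p zC])
        have "\<exists>s. \<bar>s\<bar> \<le> \<bar>t\<bar> \<and> ell (\<Phi> (x \<oplus> t \<odot> v t)) - ell (\<Phi> (x \<oplus> 0 \<odot> v t)) =
            t * ell (d (x \<oplus> s \<odot> v t) (v t))"
        proof (rule mean_value_from_zero)
          fix s assume "\<bar>s\<bar> \<le> \<bar>t\<bar>"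
          then have sU: "x \<oplus> s \<odot> v t \<in> U"
            using segN NU by blast
          then have "has_ddir E F \<Phi> (x \<oplus> s \<odot> v t) (v t) (d (x \<oplus> s \<odot> v t) (v t))"
            using C1 vt by (simp add: C1_map_def)
          then show "((\<lambda>s. ell (\<Phi> (x \<oplus> s \<odot> v t))) has_real_derivative
              ell (d (x \<oplus> s \<odot> v t) (v t))) (at s)"
            by (intro real_derivative_along_line[OF E F U _ _ ell(1) xC vt sU]) (auto intro: \<Phi>)
        qed
        then obtain s where s: "\<bar>s\<bar> \<le> \<bar>t\<bar>" "ell (\<Phi> (x \<oplus> t \<odot> v t)) - ell (\<Phi> x) =
            t * ell (d (x \<oplus> s \<odot> v t) (v t))"
          using E xC vt by auto
        let ?y = "d (x \<oplus> s \<odot> v t) (v t)"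
        have yC: "?y \<in> carrier F"
          using segN[OF s(1)] NU by (intro dC[OF _ vt]) blast
        have "ell ?z = ell (?y \<ominus>\<^bsub>F\<^esub> d x w)"
          using s(2) \<Phi>[OF tU] \<Phi>[OF x] dC[OF x wC] yC F elim
          by (simp add: dual_smult[OF ell(1)] dual_diff[OF F ell(1)])
        then have "p ?z \<le> p (?y \<ominus>\<^bsub>F\<^esub> d x w)"
          using ell(2) ell(3)[THEN bspec, of "?y \<ominus>\<^bsub>F\<^esub> d x w"] yC dC[OF x wC] F by simp
        also have "\<dots> < e"
          using W(3)[THEN bspec, of "(x \<oplus> s \<odot> v t, v t)"] segN[OF s(1)] elim NW by auto
        finally show ?case
          using cseminorm_nonneg[OF F p zC] by simp
      qed
    qed
  qed
qed

section \<open>Curves\<close>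

definition C1_curve :: "'a tvs \<Rightarrow> (real \<Rightarrow> 'a) \<Rightarrow> (real \<Rightarrow> 'a) \<Rightarrow> bool" where
  "C1_curve E c c' \<longleftrightarrow> continuous_map euclideanreal (topo E) c \<and> continuous_map euclideanreal (topo E) c' \<and>
     (\<forall>t. limitin (topo E) (\<lambda>h. (1 / h) \<odot>\<^bsub>E\<^esub> (c (t + h) \<ominus>\<^bsub>E\<^esub> c t)) (c' t) (at 0))"

lemma C1_curve_carrier: "lcs E \<Longrightarrow> C1_curve E c c' \<Longrightarrow> c t \<in> carrier E"
  using continuous_map_into_carrier[of E euclideanreal c t] by (simp add: C1_curve_def)

text \<open>
  The curve is \<open>c (t + s) = c t + s v\<close> with the difference quotient \<open>v\<close> as moving direction.
\<close>

lemma C1_map_curve_derivative: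
  fixes E (structure)
  assumes E: "lcs E" and U: "openin (topo E) U" and h: "C1_map E real_tvs U h d"
    and c: "C1_curve E c c'" and t: "c t \<in> U"
  shows "((\<lambda>t. h (c t)) has_real_derivative d (c t) (c' t)) (at t)"
proof -
  have "limitin (topo real_tvs) (\<lambda>s. (1 / s) \<odot>\<^bsub>real_tvs\<^esub> (h (c t \<oplus> s \<odot> ((1 / s) \<odot> (c (t + s) \<ominus> c t))) \<ominus>\<^bsub>real_tvs\<^esub> h (c t)))
      (d (c t) (c' t)) (at 0)"
    using c by (intro C1_map_moving_direction[OF E lcs_real_tvs U h t]) (simp add: C1_curve_def)
  then have lim: "((\<lambda>s. (1 / s) * (h (c t \<oplus> s \<odot> ((1 / s) \<odot> (c (t + s) \<ominus> c t))) - h (c t)))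
      \<longlongrightarrow> d (c t) (c' t)) (at 0)"
    by simp
  have "\<forall>\<^sub>F s in at 0. (s::real) \<noteq> 0"
    by (simp add: eventually_at_filter)
  then have ev: "\<forall>\<^sub>F s in at 0. (1 / s) * (h (c t \<oplus> s \<odot> ((1 / s) \<odot> (c (t + s) \<ominus> c t))) - h (c t)) =
      (h (c (t + s)) - h (c t)) / s"
    by eventually_elim (use E C1_curve_carrier[OF E c] in simp)
  show ?thesis
    unfolding DERIV_def using lim ev by (rule Lim_transform_eventually)
qed

lemma C1_map_curve_continuous_derivative:
  assumes E: "lcs E" and h: "C1_map E real_tvs U h d" and c: "C1_curve E c c'" and S: "\<And>t. t \<in> S \<Longrightarrow> c t \<in> U"
  shows "continuous_on S (\<lambda>t. d (c t) (c' t))"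
proof -
  have "continuous_map (top_of_set S) (subtopology (topo E) U) c"
    using c S by (auto simp: C1_curve_def continuous_map_in_subtopology intro: continuous_map_from_subtopology)
  moreover have "continuous_map (top_of_set S) (topo E) c'"
    using c by (auto simp: C1_curve_def intro: continuous_map_from_subtopology)
  ultimately have "continuous_map (top_of_set S) (prod_topology (subtopology (topo E) U) (topo E)) (\<lambda>t. (c t, c' t))"
    by (rule continuous_map_pairedI)
  moreover have "continuous_map (prod_topology (subtopology (topo E) U) (topo E)) euclideanreal (\<lambda>(x, v). d x v)"
    using h by (simp add: C1_map_def)
  ultimately have "continuous_map (top_of_set S) euclideanreal ((\<lambda>(x, v). d x v) \<circ> (\<lambda>t. (c t, c' t)))"
    by (rule continuous_map_compose)
  then show ?thesis
    by (simp add: o_def)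
qed

lemma C1_imp_Lipschitz_on_interval:
  fixes f :: "real \<Rightarrow> real"
  assumes "\<And>t. t \<in> {a..b} \<Longrightarrow> (f has_real_derivative f' t) (at t)" "continuous_on {a..b} f'"
  shows "\<exists>K. \<forall>s\<in>{a..b}. \<forall>t\<in>{a..b}. \<bar>f t - f s\<bar> \<le> K * \<bar>t - s\<bar>"
proof -
  have "bounded (f' ` {a..b})"
    using assms(2) by (intro compact_imp_bounded compact_continuous_image) auto
  then obtain K where K: "\<And>t. t \<in> {a..b} \<Longrightarrow> \<bar>f' t\<bar> \<le> K"
    unfolding bounded_iff by (metis imageI real_norm_def)
  have "norm (f t - f s) \<le> K * norm (t - s)" if "s \<in> {a..b}" "t \<in> {a..b}" for s t
    by (rule field_differentiable_bound[of "{a..b}" f f' K])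
      (use assms(1) K that in \<open>auto intro: has_field_derivative_at_within\<close>)
  then show ?thesis
    by (intro exI[of _ K] ballI) simp
qed

section \<open>The calculus of \<open>C\<^sup>k\<close> maps\<close>

definition clinear :: "'a tvs \<Rightarrow> 'b tvs \<Rightarrow> ('a \<Rightarrow> 'b) \<Rightarrow> bool" where
  "clinear E F L \<longleftrightarrow> (\<forall>x\<in>carrier E. \<forall>y\<in>carrier E. L (x \<oplus>\<^bsub>E\<^esub> y) = L x \<oplus>\<^bsub>F\<^esub> L y) \<and>
     (\<forall>x\<in>carrier E. \<forall>a. L (a \<odot>\<^bsub>E\<^esub> x) = a \<odot>\<^bsub>F\<^esub> L x) \<and> continuous_map (topo E) (topo F) L"

lemma clinear_add: "clinear E F L \<Longrightarrow> x \<in> carrier E \<Longrightarrow> y \<in> carrier E \<Longrightarrow> L (x \<oplus>\<^bsub>E\<^esub> y) = L x \<oplus>\<^bsub>F\<^esub> L y"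
  by (simp add: clinear_def)

lemma clinear_smult: "clinear E F L \<Longrightarrow> x \<in> carrier E \<Longrightarrow> L (a \<odot>\<^bsub>E\<^esub> x) = a \<odot>\<^bsub>F\<^esub> L x"
  by (simp add: clinear_def)

lemma clinear_continuous: "clinear E F L \<Longrightarrow> continuous_map (topo E) (topo F) L"
  by (simp add: clinear_def)

lemma clinear_carrier: "lcs E \<Longrightarrow> lcs F \<Longrightarrow> clinear E F L \<Longrightarrow> x \<in> carrier E \<Longrightarrow> L x \<in> carrier F"
  using continuous_map_into_carrier[of F "topo E" L x] clinear_continuous[of E F L] lcs_topspace[of E] by simp

lemma clinear_diff:
  "lcs E \<Longrightarrow> lcs F \<Longrightarrow> clinear E F L \<Longrightarrow> x \<in> carrier E \<Longrightarrow> y \<in> carrier E \<Longrightarrow> L (x \<ominus>\<^bsub>E\<^esub> y) = L x \<ominus>\<^bsub>F\<^esub> L y"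
  by (simp add: lcs_diff_eq clinear_add clinear_smult clinear_carrier)

lemma dual_imp_clinear: "l \<in> dual E \<Longrightarrow> clinear E real_tvs l"
  by (simp add: dual_def clinear_def)

lemma clinear_id: "clinear E E (\<lambda>x. x)"
  by (simp add: clinear_def)

lemma clinear_Base: "lcs E \<Longrightarrow> clinear E (base_tvs E) Base"
  using initial_family.continuous_map_into[OF initial_base_tvs, of E Base "topo E"]
  by (simp add: clinear_def lcs_topspace)

lemma clinear_pfst: "lcs E \<Longrightarrow> clinear (square_tvs E) E pfst"
  using continuous_map_pfst_psnd by (auto simp: clinear_def)

lemma has_ddir_unique:
  "lcs F \<Longrightarrow> has_ddir E F \<Phi> x v l \<Longrightarrow> has_ddir E F \<Phi> x v l' \<Longrightarrow> l = l'"
  unfolding has_ddir_def by (rule limitin_Hausdorff_unique) (auto intro: lcs_Hausdorff)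

text \<open>
  As the derivative is determined by the map, the derivative in the recursion for \<open>Ck\<close> can be chosen
  globally.
\<close>

definition differential :: "'a iter tvs \<Rightarrow> 'b tvs \<Rightarrow> ('a iter \<Rightarrow> 'b) \<Rightarrow> 'a iter \<Rightarrow> 'b" where
  "differential E F \<Phi> p = (SOME l. has_ddir E F \<Phi> (pfst p) (psnd p) l)"

lemma differential_eq: "lcs F \<Longrightarrow> has_ddir E F \<Phi> x v l \<Longrightarrow> differential E F \<Phi> (Pair x v) = l"
  unfolding differential_def by (rule some_equality) (auto intro: has_ddir_unique)

lemma has_ddir_cong:
  assumes E: "lcs E" and U: "openin (topo E) U" "x \<in> U" and v: "v \<in> carrier E"
    and eq: "\<And>y. y \<in> U \<Longrightarrow> \<Phi> y = \<Psi> y" and d: "has_ddir E F \<Phi> x v l"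
  shows "has_ddir E F \<Psi> x v l"
  unfolding has_ddir_def
proof (rule limitin_transform_eventually[OF _ d[unfolded has_ddir_def]])
  show "\<forall>\<^sub>F t in at 0. (1 / t) \<odot>\<^bsub>F\<^esub> (\<Phi> (x \<oplus>\<^bsub>E\<^esub> t \<odot>\<^bsub>E\<^esub> v) \<ominus>\<^bsub>F\<^esub> \<Phi> x) =
      (1 / t) \<odot>\<^bsub>F\<^esub> (\<Psi> (x \<oplus>\<^bsub>E\<^esub> t \<odot>\<^bsub>E\<^esub> v) \<ominus>\<^bsub>F\<^esub> \<Psi> x)"
    using eventually_line_in_open[OF E U v] by eventually_elim (simp add: eq U)
qed

lemma Ck_imp_continuous: "Ck k E F U \<Phi> \<Longrightarrow> continuous_map (subtopology (topo E) U) (topo F) \<Phi>"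
  by (cases k) auto

lemma Ck_carrier:
  assumes "lcs E" "lcs F" "openin (topo E) U" "Ck k E F U \<Phi>" "x \<in> U"
  shows "\<Phi> x \<in> carrier F"
  using continuous_map_into_carrier[OF assms(2) Ck_imp_continuous[OF assms(4)]] assms(5)
    openin_subset[OF assms(3)] by auto

lemma Ck_Suc_has_ddir:
  "Ck (Suc k) E F U \<Phi> \<longleftrightarrow> continuous_map (subtopology (topo E) U) (topo F) \<Phi> \<and>
    (\<exists>d. (\<forall>x\<in>U. \<forall>v\<in>carrier E. has_ddir E F \<Phi> x v (d (Pair x v))) \<and>
       Ck k (square_tvs E) F (times_carrier E U) d)"
  by (simp add: has_ddir_def)

lemma Ck_SucI:
  assumes "continuous_map (subtopology (topo E) U) (topo F) \<Phi>"
    and "\<And>x v. x \<in> U \<Longrightarrow> v \<in> carrier E \<Longrightarrow> has_ddir E F \<Phi> x v (d (Pair x v))"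
    and "Ck k (square_tvs E) F (times_carrier E U) d"
  shows "Ck (Suc k) E F U \<Phi>"
  unfolding Ck_Suc_has_ddir using assms(1,3) by (intro conjI exI[of _ d] ballI assms(2))

lemma Ck_SucE:
  assumes "Ck (Suc k) E F U \<Phi>"
  obtains d where "\<forall>x\<in>U. \<forall>v\<in>carrier E. has_ddir E F \<Phi> x v (d (Pair x v))"
    "Ck k (square_tvs E) F (times_carrier E U) d"
proof -
  obtain d where "\<forall>x\<in>U. \<forall>v\<in>carrier E. has_ddir E F \<Phi> x v (d (Pair x v))"
    "Ck k (square_tvs E) F (times_carrier E U) d"
    using assms unfolding Ck_Suc_has_ddir by (elim conjE exE)
  then show thesis
    by (intro that[of d])
qed

lemma Ck_cong:
  assumes E: "lcs E" and U: "openin (topo E) U" and eq: "\<And>x. x \<in> U \<Longrightarrow> \<Phi> x = \<Psi> x"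
    and Ck: "Ck k E F U \<Phi>"
  shows "Ck k E F U \<Psi>"
proof -
  have cont: "continuous_map (subtopology (topo E) U) (topo F) \<Psi>"
    using Ck_imp_continuous[OF Ck] by (rule continuous_map_eq) (auto simp: eq)
  show ?thesis
  proof (cases k)
    case 0
    then show ?thesis using cont by simp
  next
    case (Suc m)
    obtain d where d: "\<forall>x\<in>U. \<forall>v\<in>carrier E. has_ddir E F \<Phi> x v (d (Pair x v))"
      "Ck m (square_tvs E) F (times_carrier E U) d"
      using Ck[unfolded Suc] by (rule Ck_SucE)
    have "has_ddir E F \<Psi> x v (d (Pair x v))" if "x \<in> U" "v \<in> carrier E" for x v
      by (rule has_ddir_cong[OF E U that eq d(1)[rule_format, OF that]])
    then show ?thesis
      unfolding Suc by (intro Ck_SucI[OF cont _ d(2)])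
  qed
qed

lemma Ck_Suc_iff:
  assumes E: "lcs E" and F: "lcs F" and U: "openin (topo E) U"
  shows "Ck (Suc k) E F U \<Phi> \<longleftrightarrow> continuous_map (subtopology (topo E) U) (topo F) \<Phi> \<and>
    (\<forall>x\<in>U. \<forall>v\<in>carrier E. has_ddir E F \<Phi> x v (differential E F \<Phi> (Pair x v))) \<and>
    Ck k (square_tvs E) F (times_carrier E U) (differential E F \<Phi>)" (is "?L \<longleftrightarrow> ?R")
proof
  assume L: ?L
  then have cont: "continuous_map (subtopology (topo E) U) (topo F) \<Phi>"
    by (rule Ck_imp_continuous)
  obtain d where d: "\<forall>x\<in>U. \<forall>v\<in>carrier E. has_ddir E F \<Phi> x v (d (Pair x v))"
      "Ck k (square_tvs E) F (times_carrier E U) d"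
    using L by (rule Ck_SucE)
  have eq: "differential E F \<Phi> (Pair x v) = d (Pair x v)" if "x \<in> U" "v \<in> carrier E" for x v
    by (rule differential_eq[OF F d(1)[rule_format, OF that]])
  have "Ck k (square_tvs E) F (times_carrier E U) (differential E F \<Phi>)"
    using d(2) by (rule Ck_cong[OF lcs_square_tvs[OF E] openin_times_carrier[OF E U], rotated])
      (auto simp: eq)
  then show ?R
    using cont d(1) eq by simp
next
  assume ?R
  then show ?L
    by (intro Ck_SucI[of _ _ _ _ "differential E F \<Phi>"]) simp_all
qed

lemma Ck_Suc_has_ddir_differential:
  assumes "lcs E" "lcs F" "openin (topo E) U" "Ck (Suc k) E F U \<Phi>" "x \<in> U" "v \<in> carrier E"
  shows "has_ddir E F \<Phi> x v (differential E F \<Phi> (Pair x v))"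
  using assms(4-6) unfolding Ck_Suc_iff[OF assms(1-3)] by blast

lemma Ck_differential:
  assumes "lcs E" "lcs F" "openin (topo E) U" "Ck (Suc k) E F U \<Phi>"
  shows "Ck k (square_tvs E) F (times_carrier E U) (differential E F \<Phi>)"
  using assms(4) unfolding Ck_Suc_iff[OF assms(1-3)] by (elim conjE)

lemma Ck_Suc_imp_C1_map:
  assumes E: "lcs E" and F: "lcs F" and U: "openin (topo E) U" and Ck: "Ck (Suc k) E F U \<Phi>"
  shows "C1_map E F U \<Phi> (\<lambda>x v. differential E F \<Phi> (Pair x v))"
proof -
  let ?X = "prod_topology (subtopology (topo E) U) (topo E)"
  have "continuous_map ?X (topo (square_tvs E)) (\<lambda>z. Pair (fst z) (snd z))"
    by (intro continuous_map_Pair[OF E] continuous_map_snd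
        continuous_map_into_fulltopology[OF continuous_map_fst])
  then have "continuous_map ?X (subtopology (topo (square_tvs E)) (times_carrier E U)) (\<lambda>z. Pair (fst z) (snd z))"
    using lcs_topspace[OF E] by (auto simp: continuous_map_in_subtopology)
  moreover have "continuous_map (subtopology (topo (square_tvs E)) (times_carrier E U)) (topo F) (differential E F \<Phi>)"
    using Ck unfolding Ck_Suc_iff[OF E F U] by (blast intro: Ck_imp_continuous)
  ultimately have "continuous_map ?X (topo F) (differential E F \<Phi> \<circ> (\<lambda>z. Pair (fst z) (snd z)))"
    by (rule continuous_map_compose)
  then show ?thesis
    using Ck unfolding Ck_Suc_iff[OF E F U] by (simp add: C1_map_def o_def case_prod_unfold)
qed

lemma Ck_Suc_imp_Ck: "Ck (Suc k) E F U \<Phi> \<Longrightarrow> Ck k E F U \<Phi>"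
proof (induction k arbitrary: E U \<Phi>)
  case 0
  then show ?case by simp
next
  case (Suc k)
  obtain d where d: "\<forall>x\<in>U. \<forall>v\<in>carrier E. has_ddir E F \<Phi> x v (d (Pair x v))"
    "Ck (Suc k) (square_tvs E) F (times_carrier E U) d"
    using Suc.prems by (rule Ck_SucE)
  show ?case
    by (rule Ck_SucI[OF Ck_imp_continuous[OF Suc.prems] d(1)[rule_format] Suc.IH[OF d(2)]])
qed

lemma has_ddir_post_linear:
  fixes E (structure)
  assumes E: "lcs E" and F: "lcs F" and G: "lcs G" and L: "clinear F G L" and U: "openin (topo E) U"
    and \<Phi>: "\<And>x. x \<in> U \<Longrightarrow> \<Phi> x \<in> carrier F" and d: "has_ddir E F \<Phi> x v l"
    and xv: "x \<in> U" "v \<in> carrier E"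
  shows "has_ddir E G (\<lambda>x. L (\<Phi> x)) x v (L l)"
  unfolding has_ddir_def
proof (rule limitin_transform_eventually)
  show "limitin (topo G) (L \<circ> (\<lambda>t. (1 / t) \<odot>\<^bsub>F\<^esub> (\<Phi> (x \<oplus> t \<odot> v) \<ominus>\<^bsub>F\<^esub> \<Phi> x))) (L l) (at 0)"
    by (rule continuous_map_limit[OF clinear_continuous[OF L] d[unfolded has_ddir_def]])
  show "\<forall>\<^sub>F t in at 0. (L \<circ> (\<lambda>t. (1 / t) \<odot>\<^bsub>F\<^esub> (\<Phi> (x \<oplus> t \<odot> v) \<ominus>\<^bsub>F\<^esub> \<Phi> x))) t =
      (1 / t) \<odot>\<^bsub>G\<^esub> (L (\<Phi> (x \<oplus> t \<odot> v)) \<ominus>\<^bsub>G\<^esub> L (\<Phi> x))"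
    using eventually_line_in_open[OF E U xv]
    by eventually_elim (use \<Phi> xv F G in \<open>simp add: clinear_smult[OF L] clinear_diff[OF F G L]\<close>)
qed

lemma Ck_post_linear:
  assumes F: "lcs F" and G: "lcs G" and L: "clinear F G L"
  shows "lcs E \<Longrightarrow> openin (topo E) U \<Longrightarrow> Ck k E F U \<Phi> \<Longrightarrow> Ck k E G U (\<lambda>x. L (\<Phi> x))"
proof (induction k arbitrary: E U \<Phi>)
  case 0
  then show ?case
    using continuous_map_compose[OF _ clinear_continuous[OF L]] by (auto simp: o_def)
next
  case (Suc k)
  obtain d where d: "\<forall>x\<in>U. \<forall>v\<in>carrier E. has_ddir E F \<Phi> x v (d (Pair x v))"
    "Ck k (square_tvs E) F (times_carrier E U) d"
    using Suc.prems(3) by (rule Ck_SucE)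
  have "\<And>x. x \<in> U \<Longrightarrow> \<Phi> x \<in> carrier F"
    by (rule Ck_carrier[OF Suc.prems(1) F Suc.prems(2,3)])
  then have "has_ddir E G (\<lambda>x. L (\<Phi> x)) x v (L (d (Pair x v)))" if "x \<in> U" "v \<in> carrier E" for x v
    by (rule has_ddir_post_linear[OF Suc.prems(1) F G L Suc.prems(2) _ d(1)[rule_format, OF that] that])
  moreover have "Ck k (square_tvs E) G (times_carrier E U) (\<lambda>x. L (d x))"
    using Suc.prems d(2) by (intro Suc.IH lcs_square_tvs openin_times_carrier)
  moreover have "continuous_map (subtopology (topo E) U) (topo G) (\<lambda>x. L (\<Phi> x))"
    using continuous_map_compose[OF Ck_imp_continuous[OF Suc.prems(3)] clinear_continuous[OF L]]
    by (simp add: o_def)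
  ultimately show ?case
    by (intro Ck_SucI[where d = "\<lambda>x. L (d x)"])
qed

lemma clinear_psnd: "lcs E \<Longrightarrow> clinear (square_tvs E) E psnd"
  using continuous_map_pfst_psnd by (auto simp: clinear_def)

lemma clinear_compose:
  "lcs E \<Longrightarrow> lcs F \<Longrightarrow> clinear E F L \<Longrightarrow> clinear F G K \<Longrightarrow> clinear E G (\<lambda>x. K (L x))"
  using continuous_map_compose[OF clinear_continuous clinear_continuous, of E F L G K]
  by (simp add: clinear_def[of E G] clinear_add clinear_smult clinear_carrier o_def)

text \<open>
  The derivative of a linear map at \<open>(x, v)\<close> is its value at \<open>v\<close>, again a linear function of \<open>(x, v)\<close>.
\<close>

lemma Ck_linear:
  assumes F: "lcs F"
  shows "lcs E \<Longrightarrow> clinear E F L \<Longrightarrow> openin (topo E) U \<Longrightarrow> Ck k E F U L"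
proof (induction k arbitrary: E L U)
  case 0
  then show ?case
    by (auto intro: continuous_map_from_subtopology clinear_continuous)
next
  case (Suc k)
  note E = Suc.prems(1) and L = Suc.prems(2) and U = Suc.prems(3)
  have UC: "U \<subseteq> carrier E"
    using openin_subset[OF U] lcs_topspace[OF E] by simp
  have ne: "\<forall>\<^sub>F t in at 0. (t::real) \<noteq> 0"
    by (simp add: eventually_at_filter)
  have "has_ddir E F L x v (L (psnd (Pair x v)))" if xv: "x \<in> U" "v \<in> carrier E" for x v
    unfolding has_ddir_def
  proof (rule limitin_transform_eventually)
    have x: "x \<in> carrier E"
      using xv UC by blast
    show "\<forall>\<^sub>F t in at 0. L v = (1 / t) \<odot>\<^bsub>F\<^esub> (L (x \<oplus>\<^bsub>E\<^esub> t \<odot>\<^bsub>E\<^esub> v) \<ominus>\<^bsub>F\<^esub> L x)"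
      using ne
    proof eventually_elim
      case (elim t)
      show ?case
        using elim E F x xv(2) clinear_carrier[OF E F L]
        by (simp add: clinear_add[OF L] clinear_smult[OF L] lcs_add_diff_cancel_left)
    qed
    show "limitin (topo F) (\<lambda>t. L v) (L (psnd (Pair x v))) (at (0::real))"
      using clinear_carrier[OF E F L xv(2)] lcs_topspace[OF F] by simp
  qed
  moreover have "Ck k (square_tvs E) F (times_carrier E U) (\<lambda>p. L (psnd p))"
    using E L U by (intro Suc.IH lcs_square_tvs openin_times_carrier clinear_compose[OF _ _ clinear_psnd])
  moreover have "continuous_map (subtopology (topo E) U) (topo F) L"
    by (intro continuous_map_from_subtopology clinear_continuous L)
  ultimately show ?case
    by (intro Ck_SucI[where d = "\<lambda>p. L (psnd p)"])
qed

lemma clinear_square: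
  assumes E: "lcs E" and F: "lcs F" and L: "clinear E F L"
  shows "clinear (square_tvs E) (square_tvs F) (\<lambda>p. Pair (L (pfst p)) (L (psnd p)))"
proof -
  have "continuous_map (topo (square_tvs E)) (topo (square_tvs F)) (\<lambda>p. Pair (L (pfst p)) (L (psnd p)))"
    using continuous_map_compose[OF continuous_map_pfst_psnd(1)[rule_format, OF E] clinear_continuous[OF L]]
      continuous_map_compose[OF continuous_map_pfst_psnd(2)[OF E] clinear_continuous[OF L]]
    by (intro continuous_map_Pair[OF F]) (simp_all add: o_def)
  then show ?thesis
    by (auto simp: clinear_def clinear_add[OF L] clinear_smult[OF L])
qed

lemma Ck_pre_linear:
  assumes F: "lcs F"
  shows "lcs E' \<Longrightarrow> lcs E \<Longrightarrow> clinear E' E L \<Longrightarrow> openin (topo E') U' \<Longrightarrow> L ` U' \<subseteq> U \<Longrightarrow>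
    Ck k E F U \<Phi> \<Longrightarrow> Ck k E' F U' (\<lambda>x. \<Phi> (L x))"
proof (induction k arbitrary: E E' U U' \<Phi> L)
  case 0
  have "continuous_map (subtopology (topo E') U') (subtopology (topo E) U) L"
    using clinear_continuous[OF 0(3)] 0(5)
    by (auto simp: continuous_map_in_subtopology intro: continuous_map_from_subtopology)
  from continuous_map_compose[OF this] 0(6) show ?case
    by (auto simp: o_def)
next
  case (Suc k)
  note E' = Suc.prems(1) and E = Suc.prems(2) and L = Suc.prems(3)
  have U'C: "U' \<subseteq> carrier E'"
    using openin_subset[OF Suc.prems(4)] lcs_topspace[OF E'] by simp
  obtain d where d: "\<forall>x\<in>U. \<forall>v\<in>carrier E. has_ddir E F \<Phi> x v (d (Pair x v))"
    "Ck k (square_tvs E) F (times_carrier E U) d"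
    using Suc.prems(6) by (rule Ck_SucE)
  have "has_ddir E' F (\<lambda>x. \<Phi> (L x)) x v (d (Pair (L x) (L v)))" if xv: "x \<in> U'" "v \<in> carrier E'" for x v
  proof -
    have "L (x \<oplus>\<^bsub>E'\<^esub> t \<odot>\<^bsub>E'\<^esub> v) = L x \<oplus>\<^bsub>E\<^esub> t \<odot>\<^bsub>E\<^esub> L v" for t
      using xv U'C E' by (subst clinear_add[OF L]) (auto simp: clinear_smult[OF L])
    then show ?thesis
      using d(1)[rule_format, of "L x" "L v"] Suc.prems(5) xv clinear_carrier[OF E' E L xv(2)]
      by (auto simp: has_ddir_def)
  qed
  moreover have "Ck k (square_tvs E') F (times_carrier E' U') (\<lambda>p. d (Pair (L (pfst p)) (L (psnd p))))"
    using Suc.prems(4,5) clinear_carrier[OF E' E L]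
    by (intro Suc.IH[OF _ _ clinear_square[OF E' E L] _ _ d(2)] lcs_square_tvs E E' openin_times_carrier) auto
  moreover have "continuous_map (subtopology (topo E') U') (subtopology (topo E) U) L"
    using clinear_continuous[OF L] Suc.prems(5)
    by (auto simp: continuous_map_in_subtopology intro: continuous_map_from_subtopology)
  from continuous_map_compose[OF this Ck_imp_continuous[OF Suc.prems(6)]]
  have "continuous_map (subtopology (topo E') U') (topo F) (\<lambda>x. \<Phi> (L x))"
    by (simp add: o_def)
  ultimately show ?case
    by (intro Ck_SucI[where d = "\<lambda>p. d (Pair (L (pfst p)) (L (psnd p)))"]) simp_all
qed

lemma Ck_subset:
  "lcs E \<Longrightarrow> lcs F \<Longrightarrow> Ck k E F U \<Phi> \<Longrightarrow> openin (topo E) V \<Longrightarrow> V \<subseteq> U \<Longrightarrow> Ck k E F V \<Phi>"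
  using Ck_pre_linear[of F E E "\<lambda>x. x" V U k \<Phi>] clinear_id[of E] by simp

lemma Ck_Pair:
  assumes F: "lcs F"
  shows "lcs E \<Longrightarrow> openin (topo E) U \<Longrightarrow> Ck k E F U \<Phi> \<Longrightarrow> Ck k E F U \<Psi> \<Longrightarrow>
    Ck k E (square_tvs F) U (\<lambda>x. Pair (\<Phi> x) (\<Psi> x))"
proof (induction k arbitrary: E U \<Phi> \<Psi>)
  case 0
  then show ?case
    using continuous_map_Pair[OF F] by simp
next
  case (Suc k)
  note E = Suc.prems(1) and U = Suc.prems(2)
  obtain d1 where d1: "\<forall>x\<in>U. \<forall>v\<in>carrier E. has_ddir E F \<Phi> x v (d1 (Pair x v))"
    "Ck k (square_tvs E) F (times_carrier E U) d1"
    using Suc.prems(3) by (rule Ck_SucE)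
  obtain d2 where d2: "\<forall>x\<in>U. \<forall>v\<in>carrier E. has_ddir E F \<Psi> x v (d2 (Pair x v))"
    "Ck k (square_tvs E) F (times_carrier E U) d2"
    using Suc.prems(4) by (rule Ck_SucE)
  have "has_ddir E (square_tvs F) (\<lambda>x. Pair (\<Phi> x) (\<Psi> x)) x v (Pair (d1 (Pair x v)) (d2 (Pair x v)))"
    if xv: "x \<in> U" "v \<in> carrier E" for x v
    unfolding has_ddir_def
  proof (rule limitin_transform_eventually)
    show "limitin (topo (square_tvs F)) (\<lambda>t. Pair ((1 / t) \<odot>\<^bsub>F\<^esub> (\<Phi> (x \<oplus>\<^bsub>E\<^esub> t \<odot>\<^bsub>E\<^esub> v) \<ominus>\<^bsub>F\<^esub> \<Phi> x))
        ((1 / t) \<odot>\<^bsub>F\<^esub> (\<Psi> (x \<oplus>\<^bsub>E\<^esub> t \<odot>\<^bsub>E\<^esub> v) \<ominus>\<^bsub>F\<^esub> \<Psi> x))) (Pair (d1 (Pair x v)) (d2 (Pair x v))) (at 0)"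
      using d1(1)[rule_format, OF xv] d2(1)[rule_format, OF xv] unfolding has_ddir_def by (rule limitin_Pair[OF F])
    show "\<forall>\<^sub>F t in at 0. Pair ((1 / t) \<odot>\<^bsub>F\<^esub> (\<Phi> (x \<oplus>\<^bsub>E\<^esub> t \<odot>\<^bsub>E\<^esub> v) \<ominus>\<^bsub>F\<^esub> \<Phi> x))
        ((1 / t) \<odot>\<^bsub>F\<^esub> (\<Psi> (x \<oplus>\<^bsub>E\<^esub> t \<odot>\<^bsub>E\<^esub> v) \<ominus>\<^bsub>F\<^esub> \<Psi> x)) =
        (1 / t) \<odot>\<^bsub>square_tvs F\<^esub> (Pair (\<Phi> (x \<oplus>\<^bsub>E\<^esub> t \<odot>\<^bsub>E\<^esub> v)) (\<Psi> (x \<oplus>\<^bsub>E\<^esub> t \<odot>\<^bsub>E\<^esub> v))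
          \<ominus>\<^bsub>square_tvs F\<^esub> Pair (\<Phi> x) (\<Psi> x))"
      using eventually_line_in_open[OF E U xv]
    proof eventually_elim
      case (elim t)
      show ?case
        using xv(1) elim by (simp add: square_tvs_diff[OF F] Ck_carrier[OF E F U Suc.prems(3)]
            Ck_carrier[OF E F U Suc.prems(4)])
    qed
  qed
  moreover have "Ck k (square_tvs E) (square_tvs F) (times_carrier E U) (\<lambda>p. Pair (d1 p) (d2 p))"
    using E U d1(2) d2(2) by (intro Suc.IH lcs_square_tvs openin_times_carrier)
  moreover have "continuous_map (subtopology (topo E) U) (topo (square_tvs F)) (\<lambda>x. Pair (\<Phi> x) (\<Psi> x))"
    using Suc.prems by (intro continuous_map_Pair[OF F] Ck_imp_continuous)
  ultimately show ?case
    by (intro Ck_SucI[where d = "\<lambda>p. Pair (d1 p) (d2 p)"])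
qed

text \<open>
  Apply \<open>C1_map_moving_direction\<close> to \<open>\<Psi>\<close>, with the difference quotients of \<open>\<Phi>\<close> as moving direction.
\<close>

lemma has_ddir_compose:
  fixes F (structure)
  assumes E: "lcs E" and F: "lcs F" and G: "lcs G" and U: "openin (topo E) U" and V: "openin (topo F) V"
    and UV: "\<Phi> ` U \<subseteq> V" and \<Psi>: "C1_map F G V \<Psi> e" and d: "has_ddir E F \<Phi> x v l"
    and xv: "x \<in> U" "v \<in> carrier E"
  shows "has_ddir E G (\<lambda>x. \<Psi> (\<Phi> x)) x v (e (\<Phi> x) l)"
proof -
  let ?q = "\<lambda>t. (1 / t) \<odot> (\<Phi> (x \<oplus>\<^bsub>E\<^esub> t \<odot>\<^bsub>E\<^esub> v) \<ominus> \<Phi> x)"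
  have VC: "V \<subseteq> carrier F"
    using openin_subset[OF V] lcs_topspace[OF F] by simp
  have "\<Phi> x \<in> V"
    using UV xv by blast
  then have lim: "limitin (topo G) (\<lambda>t. (1 / t) \<odot>\<^bsub>G\<^esub> (\<Psi> (\<Phi> x \<oplus> t \<odot> ?q t) \<ominus>\<^bsub>G\<^esub> \<Psi> (\<Phi> x))) (e (\<Phi> x) l) (at 0)"
    using d unfolding has_ddir_def by (rule C1_map_moving_direction[OF F G V \<Psi>])
  have ne: "\<forall>\<^sub>F t in at 0. (t::real) \<noteq> 0"
    by (simp add: eventually_at_filter)
  have "\<forall>\<^sub>F t in at 0. (1 / t) \<odot>\<^bsub>G\<^esub> (\<Psi> (\<Phi> x \<oplus> t \<odot> ?q t) \<ominus>\<^bsub>G\<^esub> \<Psi> (\<Phi> x)) =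
      (1 / t) \<odot>\<^bsub>G\<^esub> (\<Psi> (\<Phi> (x \<oplus>\<^bsub>E\<^esub> t \<odot>\<^bsub>E\<^esub> v)) \<ominus>\<^bsub>G\<^esub> \<Psi> (\<Phi> x))"
    using eventually_line_in_open[OF E U xv] ne
  proof eventually_elim
    case (elim t)
    have "\<Phi> (x \<oplus>\<^bsub>E\<^esub> t \<odot>\<^bsub>E\<^esub> v) \<in> carrier F" "\<Phi> x \<in> carrier F"
      using elim xv UV VC by auto
    then show ?case
      using F elim by simp
  qed
  from limitin_transform_eventually[OF this lim] show ?thesis
    by (simp add: has_ddir_def)
qed

text \<open>
  The derivative of a composition is the derivative of \<open>\<Psi>\<close> composed with the tangent map
  \<open>(x, v) \<mapsto> (\<Phi> x, d\<Phi> x v)\<close>, which is again a map between squares; so the induction hypothesis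
  applies to it.
\<close>

theorem Ck_compose:
  assumes G: "lcs G"
  shows "lcs E \<Longrightarrow> lcs F \<Longrightarrow> openin (topo E) U \<Longrightarrow> openin (topo F) V \<Longrightarrow> \<Phi> ` U \<subseteq> V \<Longrightarrow>
    Ck k E F U \<Phi> \<Longrightarrow> Ck k F G V \<Psi> \<Longrightarrow> Ck k E G U (\<lambda>x. \<Psi> (\<Phi> x))"
proof (induction k arbitrary: E F U V \<Phi> \<Psi>)
  case 0
  then have "continuous_map (subtopology (topo E) U) (subtopology (topo F) V) \<Phi>"
    by (auto simp: continuous_map_in_subtopology)
  from continuous_map_compose[OF this] 0 show ?case
    by (auto simp: o_def)
next
  case (Suc k)
  note E = Suc.prems(1) and F = Suc.prems(2) and U = Suc.prems(3) and V = Suc.prems(4) and UV = Suc.prems(5)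
  let ?d = "differential E F \<Phi>" and ?e = "differential F G \<Psi>"
  have \<Phi>: "Ck k (square_tvs E) F (times_carrier E U) ?d"
    by (rule Ck_differential[OF E F U Suc.prems(6)])
  have e: "Ck k (square_tvs F) G (times_carrier F V) ?e"
    by (rule Ck_differential[OF F G V Suc.prems(7)])
  have \<Psi>: "C1_map F G V \<Psi> (\<lambda>x v. ?e (Pair x v))"
    by (rule Ck_Suc_imp_C1_map[OF F G V Suc.prems(7)])
  have "has_ddir E G (\<lambda>x. \<Psi> (\<Phi> x)) x v (?e (Pair (\<Phi> x) (?d (Pair x v))))" if xv: "x \<in> U" "v \<in> carrier E" for x v
    by (rule has_ddir_compose[OF E F G U V UV \<Psi> Ck_Suc_has_ddir_differential[OF E F U Suc.prems(6) xv] xv])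
  moreover have "Ck k (square_tvs E) F (times_carrier E U) (\<lambda>p. \<Phi> (pfst p))"
    by (rule Ck_pre_linear[OF F lcs_square_tvs[OF E] E clinear_pfst[OF E] openin_times_carrier[OF E U] _
          Ck_Suc_imp_Ck[OF Suc.prems(6)]]) auto
  then have tangent: "Ck k (square_tvs E) (square_tvs F) (times_carrier E U) (\<lambda>p. Pair (\<Phi> (pfst p)) (?d p))"
    using \<Phi> by (intro Ck_Pair[OF F] lcs_square_tvs[OF E] openin_times_carrier[OF E U])
  have "?d p \<in> carrier F" if "p \<in> times_carrier E U" for p
    using that by (rule Ck_carrier[OF lcs_square_tvs[OF E] F openin_times_carrier[OF E U] \<Phi>])
  then have "(\<lambda>p. Pair (\<Phi> (pfst p)) (?d p)) ` times_carrier E U \<subseteq> times_carrier F V"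
    using UV by auto
  then have "Ck k (square_tvs E) G (times_carrier E U) (\<lambda>p. ?e (Pair (\<Phi> (pfst p)) (?d p)))"
    by (rule Suc.IH[OF lcs_square_tvs[OF E] lcs_square_tvs[OF F] openin_times_carrier[OF E U]
          openin_times_carrier[OF F V] _ tangent e])
  moreover have "continuous_map (subtopology (topo E) U) (subtopology (topo F) V) \<Phi>"
    using Ck_imp_continuous[OF Suc.prems(6)] UV by (auto simp: continuous_map_in_subtopology)
  from continuous_map_compose[OF this Ck_imp_continuous[OF Suc.prems(7)]]
  have "continuous_map (subtopology (topo E) U) (topo G) (\<lambda>x. \<Psi> (\<Phi> x))"
    by (simp add: o_def)
  ultimately show ?case
    by (intro Ck_SucI[where d = "\<lambda>p. ?e (Pair (\<Phi> (pfst p)) (?d p))"]) simp_all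
qed

lemma continuous_map_locally:
  assumes "\<And>x. x \<in> U \<Longrightarrow> \<exists>V. openin X V \<and> x \<in> V \<and> V \<subseteq> U \<and> continuous_map (subtopology X V) Y f"
  shows "continuous_map (subtopology X U) Y f"
proof (rule pasting_lemma[where T = "\<lambda>V. V" and f = "\<lambda>_. f"])
  let ?I = "{V. openin X V \<and> V \<subseteq> U \<and> continuous_map (subtopology X V) Y f}"
  show "openin (subtopology X U) V" if "V \<in> ?I" for V
    using that by (auto simp: openin_subtopology intro!: exI[of _ V])
  show "continuous_map (subtopology (subtopology X U) V) Y f" if "V \<in> ?I" for V
    using that by (simp add: subtopology_subtopology Int_absorb1)
  show "\<exists>V. V \<in> ?I \<and> x \<in> V \<and> f x = f x" if "x \<in> topspace (subtopology X U)" for x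
    using that assms[of x] by auto
qed simp

text \<open>
  Local derivatives glue because they are values of the one function \<open>differential E F \<Phi>\<close>.
\<close>

lemma Ck_locally:
  assumes F: "lcs F"
  shows "lcs E \<Longrightarrow> openin (topo E) U \<Longrightarrow>
    (\<And>x. x \<in> U \<Longrightarrow> \<exists>V. openin (topo E) V \<and> x \<in> V \<and> V \<subseteq> U \<and> Ck k E F V \<Phi>) \<Longrightarrow> Ck k E F U \<Phi>"
proof (induction k arbitrary: E U \<Phi>)
  case 0
  then show ?case
    by (simp add: continuous_map_locally)
next
  case (Suc k)
  note E = Suc.prems(1) and U = Suc.prems(2)
  show ?case
    unfolding Ck_Suc_iff[OF E F U]
  proof (intro conjI ballI)
    show "continuous_map (subtopology (topo E) U) (topo F) \<Phi>"
    proof (rule continuous_map_locally)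
      fix x assume "x \<in> U"
      then obtain V where "openin (topo E) V" "x \<in> V" "V \<subseteq> U" "Ck (Suc k) E F V \<Phi>"
        using Suc.prems(3) by blast
      then show "\<exists>V. openin (topo E) V \<and> x \<in> V \<and> V \<subseteq> U \<and> continuous_map (subtopology (topo E) V) (topo F) \<Phi>"
        by (intro exI[of _ V] conjI Ck_imp_continuous)
    qed
  next
    fix x v assume x: "x \<in> U" and v: "v \<in> carrier E"
    obtain V where V: "openin (topo E) V" "x \<in> V" "Ck (Suc k) E F V \<Phi>"
      using Suc.prems(3)[OF x] by blast
    show "has_ddir E F \<Phi> x v (differential E F \<Phi> (Pair x v))"
      by (rule Ck_Suc_has_ddir_differential[OF E F V(1,3,2) v])
  next
    show "Ck k (square_tvs E) F (times_carrier E U) (differential E F \<Phi>)"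
    proof (rule Suc.IH[OF lcs_square_tvs[OF E] openin_times_carrier[OF E U]])
      fix p assume "p \<in> times_carrier E U"
      then obtain x v where p: "p = Pair x v" "x \<in> U" "v \<in> carrier E"
        by blast
      obtain V where V: "openin (topo E) V" "x \<in> V" "V \<subseteq> U" "Ck (Suc k) E F V \<Phi>"
        using Suc.prems(3)[OF p(2)] by blast
      have "Ck k (square_tvs E) F (times_carrier E V) (differential E F \<Phi>)"
        by (rule Ck_differential[OF E F V(1,4)])
      then show "\<exists>W. openin (topo (square_tvs E)) W \<and> p \<in> W \<and> W \<subseteq> times_carrier E U \<and>
          Ck k (square_tvs E) F W (differential E F \<Phi>)"
        using V(2,3) p openin_times_carrier[OF E V(1)] by (intro exI[of _ "times_carrier E V"]) auto
    qed
  qed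
qed

section \<open>Smooth maps between open sets\<close>

lemma smooth_map_openin: "smooth_map E F U \<Phi> \<Longrightarrow> openin (topo E) U"
  by (simp add: smooth_map_def)

lemma continuous_map_Base: "lcs E \<Longrightarrow> continuous_map (topo E) (topo (base_tvs E)) Base"
  by (rule clinear_continuous[OF clinear_Base])

lemma smooth_map_continuous:
  assumes E: "lcs E" and \<Phi>: "smooth_map E F U \<Phi>"
  shows "continuous_map (subtopology (topo E) U) (topo F) \<Phi>"
proof -
  have "continuous_map (subtopology (topo E) U) (subtopology (topo (base_tvs E)) (Base ` U)) Base"
    by (auto simp: continuous_map_in_subtopology intro: continuous_map_from_subtopology continuous_map_Base[OF E])
  moreover have "continuous_map (subtopology (topo (base_tvs E)) (Base ` U)) (topo F) (\<Phi> \<circ> unBase)"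
    using \<Phi> unfolding smooth_map_def by (blast intro: Ck_imp_continuous)
  ultimately have "continuous_map (subtopology (topo E) U) (topo F) ((\<Phi> \<circ> unBase) \<circ> Base)"
    by (rule continuous_map_compose)
  then show ?thesis
    by (simp add: o_def)
qed

lemma smooth_map_cong:
  assumes E: "lcs E" and \<Phi>: "smooth_map E F U \<Phi>" and eq: "\<And>x. x \<in> U \<Longrightarrow> \<Phi> x = \<Psi> x"
  shows "smooth_map E F U \<Psi>"
  unfolding smooth_map_def
proof (intro conjI allI smooth_map_openin[OF \<Phi>])
  fix k
  show "Ck k (base_tvs E) F (Base ` U) (\<Psi> \<circ> unBase)"
  proof (rule Ck_cong[OF lcs_base_tvs[OF E] openin_base_tvs[OF E smooth_map_openin[OF \<Phi>]]])
    show "Ck k (base_tvs E) F (Base ` U) (\<Phi> \<circ> unBase)"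
      using \<Phi> by (simp add: smooth_map_def)
  qed (auto simp: eq)
qed

lemma smooth_map_subset:
  assumes E: "lcs E" and F: "lcs F" and \<Phi>: "smooth_map E F U \<Phi>" and V: "openin (topo E) V" "V \<subseteq> U"
  shows "smooth_map E F V \<Phi>"
  unfolding smooth_map_def
proof (intro conjI allI V)
  fix k
  show "Ck k (base_tvs E) F (Base ` V) (\<Phi> \<circ> unBase)"
    using \<Phi> V(2) by (intro Ck_subset[OF lcs_base_tvs[OF E] F _ openin_base_tvs[OF E V(1)], of k "Base ` U"])
      (auto simp: smooth_map_def)
qed

lemma smooth_map_locally:
  assumes E: "lcs E" and F: "lcs F" and U: "openin (topo E) U"
    and local: "\<And>x. x \<in> U \<Longrightarrow> \<exists>V. x \<in> V \<and> V \<subseteq> U \<and> smooth_map E F V \<Phi>"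
  shows "smooth_map E F U \<Phi>"
  unfolding smooth_map_def
proof (intro conjI allI U)
  fix k
  show "Ck k (base_tvs E) F (Base ` U) (\<Phi> \<circ> unBase)"
  proof (rule Ck_locally[OF F lcs_base_tvs[OF E] openin_base_tvs[OF E U]])
    fix p assume "p \<in> Base ` U"
    then obtain x where x: "p = Base x" "x \<in> U"
      by blast
    obtain V where V: "x \<in> V" "V \<subseteq> U" "smooth_map E F V \<Phi>"
      using local[OF x(2)] by blast
    then show "\<exists>W. openin (topo (base_tvs E)) W \<and> p \<in> W \<and> W \<subseteq> Base ` U \<and> Ck k (base_tvs E) F W (\<Phi> \<circ> unBase)"
      using x openin_base_tvs[OF E smooth_map_openin[OF V(3)]]
      by (intro exI[of _ "Base ` V"]) (auto simp: smooth_map_def)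
  qed
qed

theorem smooth_map_compose:
  assumes E: "lcs E" and F: "lcs F" and G: "lcs G" and \<Phi>: "smooth_map E F U \<Phi>" and \<Psi>: "smooth_map F G V \<Psi>"
    and UV: "\<Phi> ` U \<subseteq> V"
  shows "smooth_map E G U (\<lambda>x. \<Psi> (\<Phi> x))"
  unfolding smooth_map_def
proof (intro conjI allI smooth_map_openin[OF \<Phi>])
  fix k
  note U = openin_base_tvs[OF E smooth_map_openin[OF \<Phi>]] and V = openin_base_tvs[OF F smooth_map_openin[OF \<Psi>]]
  have 1: "Ck k (base_tvs E) (base_tvs F) (Base ` U) (\<lambda>x. Base ((\<Phi> \<circ> unBase) x))"
    using \<Phi> by (intro Ck_post_linear[OF F lcs_base_tvs[OF F] clinear_Base[OF F] lcs_base_tvs[OF E] U])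
      (simp add: smooth_map_def o_def)
  have 2: "Ck k (base_tvs F) G (Base ` V) (\<Psi> \<circ> unBase)"
    using \<Psi> by (simp add: smooth_map_def)
  have "Ck k (base_tvs E) G (Base ` U) (\<lambda>x. (\<Psi> \<circ> unBase) (Base ((\<Phi> \<circ> unBase) x)))"
    by (rule Ck_compose[OF G lcs_base_tvs[OF E] lcs_base_tvs[OF F] U V _ 1 2]) (use UV in auto)
  then show "Ck k (base_tvs E) G (Base ` U) ((\<lambda>x. \<Psi> (\<Phi> x)) \<circ> unBase)"
    by (simp add: o_def)
qed

lemma smooth_map_dual:
  assumes E: "lcs E" and F: "lcs F" and \<Phi>: "smooth_map E F U \<Phi>" and l: "l \<in> dual F"
  shows "smooth_map E real_tvs U (\<lambda>x. l (\<Phi> x))"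
  unfolding smooth_map_def
proof (intro conjI allI smooth_map_openin[OF \<Phi>])
  fix k
  have "Ck k (base_tvs E) real_tvs (Base ` U) (\<lambda>x. l ((\<Phi> \<circ> unBase) x))"
    using \<Phi> by (intro Ck_post_linear[OF F lcs_real_tvs dual_imp_clinear[OF l] lcs_base_tvs[OF E]
          openin_base_tvs[OF E smooth_map_openin[OF \<Phi>]]]) (simp add: smooth_map_def o_def)
  then show "Ck k (base_tvs E) real_tvs (Base ` U) ((\<lambda>x. l (\<Phi> x)) \<circ> unBase)"
    by (simp add: o_def)
qed

lemma clinear_unBase: "lcs E \<Longrightarrow> clinear (base_tvs E) E unBase"
  using initial_family.continuous[OF initial_base_tvs, of E "()"] by (auto simp: clinear_def)

lemma smooth_map_ident: "lcs E \<Longrightarrow> openin (topo E) U \<Longrightarrow> smooth_map E E U (\<lambda>x. x)"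
  unfolding smooth_map_def o_def
  by (auto intro!: Ck_linear clinear_unBase openin_base_tvs)

section \<open>Spaces whose topology is determined by curves\<close>

lemma C1_curve_post_linear:
  assumes E: "lcs E" and F: "lcs F" and L: "clinear E F L" and c: "C1_curve E c c'"
  shows "C1_curve F (\<lambda>t. L (c t)) (\<lambda>t. L (c' t))"
proof -
  have "limitin (topo F) (\<lambda>h. (1 / h) \<odot>\<^bsub>F\<^esub> (L (c (t + h)) \<ominus>\<^bsub>F\<^esub> L (c t))) (L (c' t)) (at 0)" for t
  proof -
    have "limitin (topo F) (L \<circ> (\<lambda>h. (1 / h) \<odot>\<^bsub>E\<^esub> (c (t + h) \<ominus>\<^bsub>E\<^esub> c t))) (L (c' t)) (at 0)"
      using c by (intro continuous_map_limit[OF clinear_continuous[OF L]]) (simp add: C1_curve_def)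
    then show ?thesis
      using E C1_curve_carrier[OF E c] by (simp add: o_def clinear_smult[OF L] clinear_diff[OF E F L])
  qed
  moreover have "continuous_map euclideanreal (topo F) (L \<circ> c)" "continuous_map euclideanreal (topo F) (L \<circ> c')"
    using c clinear_continuous[OF L] by (auto simp: C1_curve_def intro: continuous_map_compose)
  ultimately show ?thesis
    by (simp add: C1_curve_def o_def)
qed

lemma C1_curve_Pair:
  fixes E (structure)
  assumes E: "lcs E" and c: "C1_curve E c c'" and e: "C1_curve E e e'"
  shows "C1_curve (square_tvs E) (\<lambda>t. Pair (c t) (e t)) (\<lambda>t. Pair (c' t) (e' t))"
proof -
  have "limitin (topo (square_tvs E)) (\<lambda>h. Pair ((1 / h) \<odot> (c (t + h) \<ominus> c t))
      ((1 / h) \<odot> (e (t + h) \<ominus> e t))) (Pair (c' t) (e' t)) (at 0)" for t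
    using c e by (intro limitin_Pair[OF E]) (auto simp: C1_curve_def)
  then show ?thesis
    using c e E C1_curve_carrier[OF E c] C1_curve_carrier[OF E e]
    by (auto simp: C1_curve_def square_tvs_diff intro!: continuous_map_Pair)
qed

lemma C1_curve_line:
  fixes E (structure)
  assumes E: "lcs E" and x: "x \<in> carrier E" and v: "v \<in> carrier E"
  shows "C1_curve E (\<lambda>t. x \<oplus> t \<odot> v) (\<lambda>_. v)"
proof -
  have ne: "\<forall>\<^sub>F h in at 0. (h::real) \<noteq> 0"
    by (simp add: eventually_at_filter)
  have "limitin (topo E) (\<lambda>h. (1 / h) \<odot> ((x \<oplus> (t + h) \<odot> v) \<ominus> (x \<oplus> t \<odot> v))) v (at 0)" for t
  proof (rule limitin_transform_eventually)
    show "\<forall>\<^sub>F h in at 0. v = (1 / h) \<odot> ((x \<oplus> (t + h) \<odot> v) \<ominus> (x \<oplus> t \<odot> v))"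
      using ne
    proof eventually_elim
      case (elim h)
      have "x \<oplus> (t + h) \<odot> v = (x \<oplus> t \<odot> v) \<oplus> h \<odot> v"
        using E x v by (simp add: lcs_smult_add_left lcs_add_assoc)
      then show ?case
        using E x v elim by (simp add: lcs_add_diff_cancel_left)
    qed
    show "limitin (topo E) (\<lambda>h. v) v (at (0::real))"
      using v lcs_topspace[OF E] by simp
  qed
  then show ?thesis
    using E x v lcs_topspace[OF E] unfolding C1_curve_def
    by (intro conjI allI continuous_map_lcs_add continuous_map_lcs_smult) auto
qed

lemma smooth_curve_imp_C1_curve:
  assumes G: "lcs G" and c: "smooth_map real_tvs G UNIV c"
  obtains c' where "C1_curve G c c'"
proof -
  have R: "lcs (base_tvs real_tvs)"
    by simp
  have U: "openin (topo (base_tvs real_tvs)) (range Base)"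
    using openin_base_tvs[OF lcs_real_tvs, of UNIV] by simp
  have "Ck (Suc 0) (base_tvs real_tvs) G (range Base) (c \<circ> unBase)"
    using c unfolding smooth_map_def by blast
  then obtain d where d: "C1_map (base_tvs real_tvs) G (range Base) (c \<circ> unBase) d"
    using Ck_Suc_imp_C1_map[OF R G U] by blast
  have "limitin (topo G) (\<lambda>h. (1 / h) \<odot>\<^bsub>G\<^esub> (c (t + h) \<ominus>\<^bsub>G\<^esub> c t)) (d (Base t) (Base 1)) (at 0)" for t
  proof -
    have "has_ddir (base_tvs real_tvs) G (c \<circ> unBase) (Base t) (Base 1) (d (Base t) (Base 1))"
      using d by (simp add: C1_map_def)
    then show ?thesis
      by (simp add: has_ddir_def)
  qed
  moreover have "continuous_map euclideanreal (topo G) (\<lambda>t. d (Base t) (Base 1))"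
  proof -
    have "continuous_map euclideanreal (topo (base_tvs real_tvs)) Base"
      using continuous_map_Base[OF lcs_real_tvs] by simp
    then have "continuous_map euclideanreal
        (prod_topology (subtopology (topo (base_tvs real_tvs)) (range Base)) (topo (base_tvs real_tvs)))
        (\<lambda>t. (Base t, Base 1))"
      by (intro continuous_map_pairedI) (auto simp: continuous_map_in_subtopology lcs_topspace[OF R])
    from continuous_map_compose[OF this d[unfolded C1_map_def, THEN conjunct2, THEN conjunct2]] show ?thesis
      by (simp add: o_def)
  qed
  moreover have "continuous_map euclideanreal (topo G) c"
    using smooth_map_continuous[OF lcs_real_tvs c] by simp
  ultimately have "C1_curve G c (\<lambda>t. d (Base t) (Base 1))"
    by (simp add: C1_curve_def)
  then show thesis
    by (rule that)
qed

text \<open>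
  Curves of class \<open>C\<^sup>1\<close> are enough below. As there are more of them than smooth ones, the condition
  follows from the coincidence of the given topology with the \<open>c\<^sup>\<infinity>\<close>-topology.
\<close>

definition curve_generated :: "'a tvs \<Rightarrow> bool" where
  "curve_generated E \<longleftrightarrow> (\<forall>V\<subseteq>carrier E. (\<forall>c c'. C1_curve E c c' \<longrightarrow> open (c -` V)) \<longrightarrow> openin (topo E) V)"

text \<open>
  The linear homeomorphism from the power of \<open>E\<close> with exponent \<open>2 ^ n\<close> onto the \<open>n\<close>-fold iterated
  square of \<open>E\<close>, and its inverse: the first half of the coordinates goes to the left component.
\<close>

primrec pack :: "nat \<Rightarrow> (nat \<Rightarrow> 'a) \<Rightarrow> 'a iter" where
  "pack 0 x = Base (x 0)"
| "pack (Suc n) x = Pair (pack n x) (pack n (\<lambda>i. x (i + 2 ^ n)))"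

primrec unpack :: "nat \<Rightarrow> 'a iter \<Rightarrow> nat \<Rightarrow> 'a" where
  "unpack 0 p i = unBase p"
| "unpack (Suc n) p i = (if i < 2 ^ n then unpack n (pfst p) i else unpack n (psnd p) (i - 2 ^ n))"

lemma pack_cong: "(\<And>i. i < 2 ^ n \<Longrightarrow> x i = y i) \<Longrightarrow> pack n x = pack n y"
proof (induction n arbitrary: x y)
  case (Suc n)
  have "pack n x = pack n y"
    by (rule Suc.IH) (simp add: Suc.prems)
  moreover have "pack n (\<lambda>i. x (i + 2 ^ n)) = pack n (\<lambda>i. y (i + 2 ^ n))"
    by (rule Suc.IH) (simp add: Suc.prems)
  ultimately show ?case
    by simp
qed simp

abbreviation iterated_square :: "nat \<Rightarrow> 'a tvs \<Rightarrow> 'a iter tvs" where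
  "iterated_square n E \<equiv> (square_tvs ^^ n) (base_tvs E)"

lemma lcs_funpow_square: "lcs E \<Longrightarrow> lcs ((square_tvs ^^ n) E)"
  by (induction n) simp_all

lemma pack_unpack: "p \<in> carrier (iterated_square n E) \<Longrightarrow> pack n (unpack n p) = p"
proof (induction n arbitrary: p)
  case 0
  then show ?case by auto
next
  case (Suc n)
  then obtain a b where p: "p = Pair a b" "a \<in> carrier (iterated_square n E)" "b \<in> carrier (iterated_square n E)"
    by auto
  have "pack n (unpack (Suc n) p) = pack n (unpack n a)"
    by (rule pack_cong) (simp add: p)
  moreover have "pack n (\<lambda>i. unpack (Suc n) p (i + 2 ^ n)) = pack n (unpack n b)"
    by (rule pack_cong) (simp add: p)
  ultimately show ?case
    using Suc.IH[OF p(2)] Suc.IH[OF p(3)] p(1) by (simp del: unpack.simps)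
qed

lemma continuous_map_unpack:
  assumes E: "lcs E"
  shows "i < 2 ^ n \<Longrightarrow> continuous_map (topo (iterated_square n E)) (topo E) (\<lambda>p. unpack n p i)"
proof (induction n arbitrary: i)
  case 0
  then show ?case
    using clinear_continuous[OF clinear_unBase[OF E]] by simp
next
  case (Suc n)
  have sq: "lcs (iterated_square n E)"
    using E by (simp add: lcs_funpow_square)
  show ?case
  proof (cases "i < 2 ^ n")
    case True
    from continuous_map_compose[OF continuous_map_pfst_psnd(1)[OF sq] Suc.IH[OF True]] True show ?thesis
      by (simp add: o_def)
  next
    case False
    then have "i - 2 ^ n < 2 ^ n"
      using Suc.prems by simp
    from continuous_map_compose[OF continuous_map_pfst_psnd(2)[OF sq] Suc.IH[OF this]] False show ?thesis
      by (simp add: o_def)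
  qed
qed

lemma C1_curve_pack:
  assumes E: "lcs E"
  shows "(\<And>i. i < 2 ^ n \<Longrightarrow> C1_curve E (\<lambda>t. c t i) (\<lambda>t. c' t i)) \<Longrightarrow>
    C1_curve (iterated_square n E) (\<lambda>t. pack n (c t)) (\<lambda>t. pack n (c' t))"
proof (induction n arbitrary: c c')
  case 0
  then show ?case
    using C1_curve_post_linear[OF E lcs_base_tvs[OF E] clinear_Base[OF E]] by simp
next
  case (Suc n)
  have "C1_curve (iterated_square n E) (\<lambda>t. pack n (c t)) (\<lambda>t. pack n (c' t))"
    by (rule Suc.IH) (simp add: Suc.prems)
  moreover have "C1_curve (iterated_square n E) (\<lambda>t. pack n (\<lambda>i. c t (i + 2 ^ n))) (\<lambda>t. pack n (\<lambda>i. c' t (i + 2 ^ n)))"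
    by (rule Suc.IH) (simp add: Suc.prems)
  ultimately show ?case
    using C1_curve_Pair[of "iterated_square n E"] E by (simp add: lcs_funpow_square)
qed

lemma clinear_power_projection: "lcs E \<Longrightarrow> i < n \<Longrightarrow> clinear (power_tvs E n) E (\<lambda>x. x i)"
  using initial_family.continuous[OF initial_power_tvs, of E i n] by (simp add: clinear_def)

text \<open>
  Curves and open sets are carried over to \<open>E\<close> to the power \<open>2 ^ n\<close>, where the hypothesis on the
  \<open>c\<^sup>\<infinity>\<close>-topology applies.
\<close>

theorem curve_generated_iterated_square:
  assumes E: "E \<in> cinf_lcs"
  shows "curve_generated (iterated_square n E)"
  unfolding curve_generated_def
proof (intro allI impI)
  fix V assume V: "V \<subseteq> carrier (iterated_square n E)"
    and curves: "\<forall>c c'. C1_curve (iterated_square n E) c c' \<longrightarrow> open (c -` V)"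
  have lcs: "lcs E" and cinf: "cinf_topology (power_tvs E (2 ^ n)) = topo (power_tvs E (2 ^ n))"
    using E by (auto simp: cinf_lcs_def)
  let ?P = "power_tvs E (2 ^ n)"
  define V' where "V' = {x \<in> carrier ?P. pack n x \<in> V}"
  have "open (c -` V')" if c: "smooth_map real_tvs ?P UNIV c" for c
  proof -
    obtain c' where c': "C1_curve ?P c c'"
      by (rule smooth_curve_imp_C1_curve[OF lcs_power_tvs[OF lcs] c])
    have "C1_curve (iterated_square n E) (\<lambda>t. pack n (c t)) (\<lambda>t. pack n (c' t))"
      by (rule C1_curve_pack[OF lcs] C1_curve_post_linear[OF lcs_power_tvs[OF lcs] lcs clinear_power_projection[OF lcs] c'])+
    then have "open ((\<lambda>t. pack n (c t)) -` V)"
      using curves by blast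
    moreover have "(\<lambda>t. pack n (c t)) -` V = c -` V'"
      using C1_curve_carrier[OF lcs_power_tvs[OF lcs] c'] by (auto simp: V'_def)
    ultimately show ?thesis
      by simp
  qed
  then have "openin (cinf_topology ?P) V'"
    by (auto simp: openin_cinf_topology V'_def)
  then have V': "openin (topo ?P) V'"
    by (simp only: cinf)
  let ?u = "\<lambda>p. \<lambda>i\<in>{..<2 ^ n}. unpack n p i"
  have sq: "lcs (iterated_square n E)"
    using lcs by (simp add: lcs_funpow_square)
  have "continuous_map (topo (iterated_square n E)) (topo ?P) ?u"
  proof (rule initial_family.continuous_map_into[OF initial_power_tvs[OF lcs]])
    show "?u \<in> topspace (topo (iterated_square n E)) \<rightarrow> carrier ?P"
      using continuous_map_into_carrier[OF lcs continuous_map_unpack[OF lcs]] by auto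
  qed (simp add: continuous_map_unpack[OF lcs])
  then have "openin (topo (iterated_square n E)) {p \<in> topspace (topo (iterated_square n E)). ?u p \<in> V'}"
    using V' by (rule openin_continuous_map_preimage)
  moreover have "{p \<in> topspace (topo (iterated_square n E)). ?u p \<in> V'} = V"
  proof -
    have "pack n (?u p) = p" if "p \<in> carrier (iterated_square n E)" for p
      using pack_unpack[OF that] pack_cong[of n "?u p" "unpack n p"] by simp
    moreover have "?u p \<in> carrier ?P" if "p \<in> carrier (iterated_square n E)" for p
      using that continuous_map_into_carrier[OF lcs continuous_map_unpack[OF lcs]] lcs_topspace[OF sq] by auto
    ultimately show ?thesis
      using V lcs_topspace[OF sq] by (auto simp: V'_def simp del: power_tvs_simps)
  qed
  ultimately show "openin (topo (iterated_square n E)) V"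
    by simp
qed

section \<open>Scalarwise smooth maps into Mackey-complete spaces\<close>

lemma Ck_Lipschitz_along_curve:
  assumes E: "lcs E" and U: "openin (topo E) U" and h: "Ck (Suc 0) E real_tvs U h"
    and c: "C1_curve E c c'" and ab: "\<And>t. t \<in> {a..b} \<Longrightarrow> c t \<in> U"
  shows "\<exists>K. \<forall>s\<in>{a..b}. \<forall>t\<in>{a..b}. \<bar>h (c t) - h (c s)\<bar> \<le> K * \<bar>t - s\<bar>"
proof -
  obtain d where d: "C1_map E real_tvs U h d"
    using Ck_Suc_imp_C1_map[OF E lcs_real_tvs U h] by blast
  show ?thesis
    using C1_map_curve_derivative[OF E U d c ab] C1_map_curve_continuous_derivative[OF E d c ab]
    by (rule C1_imp_Lipschitz_on_interval)
qed

text \<open>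
  The quotients \<open>z i / w i\<close> form a weakly bounded, hence bounded set. The constant may depend on \<open>l\<close> in the
  hypothesis and on \<open>p\<close> in the conclusion.
\<close>

lemma functional_bounds_imp_seminorm_bound:
  fixes F (structure)
  assumes F: "lcs F" and p: "cseminorm F p" and z: "\<And>i. i \<in> I \<Longrightarrow> z i \<in> carrier F"
    and w: "\<And>i. i \<in> I \<Longrightarrow> w i > 0"
    and bound: "\<And>l. l \<in> dual F \<Longrightarrow> \<exists>K. \<forall>i\<in>I. \<bar>l (z i)\<bar> \<le> K * w i"
  shows "\<exists>K. \<forall>i\<in>I. p (z i) \<le> K * w i"
proof -
  define S where "S = (\<lambda>i. (1 / w i) \<odot> z i) ` I"
  have SC: "S \<subseteq> carrier F"
    using F z by (auto simp: S_def)
  have "\<exists>K. \<forall>x\<in>S. \<bar>l x\<bar> \<le> K" if l: "l \<in> dual F" for l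
  proof -
    obtain K where K: "\<forall>i\<in>I. \<bar>l (z i)\<bar> \<le> K * w i"
      using bound[OF l] ..
    have "\<bar>l ((1 / w i) \<odot> z i)\<bar> \<le> K" if i: "i \<in> I" for i
      using K[rule_format, OF i] w[OF i] z[OF i] by (simp add: dual_smult[OF l] pos_divide_le_eq)
    then show ?thesis
      by (auto simp: S_def)
  qed
  then obtain K where K: "\<And>x. x \<in> S \<Longrightarrow> p x \<le> K"
    using weakly_bounded_imp_bounded[OF F SC p] by blast
  have "p (z i) \<le> K * w i" if i: "i \<in> I" for i
    using K[of "(1 / w i) \<odot> z i"] i w[OF i] z[OF i]
    by (simp add: S_def cseminorm_smult[OF p] pos_divide_le_eq)
  then show ?thesis
    by blast
qed

lemma scalarwise_Lipschitz:
  fixes F (structure)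
  assumes F: "lcs F" and \<gamma>: "\<And>t. t \<in> {a..b} \<Longrightarrow> \<gamma> t \<in> carrier F" and p: "cseminorm F p"
    and Lip: "\<And>l. l \<in> dual F \<Longrightarrow> \<exists>K. \<forall>s\<in>{a..b}. \<forall>t\<in>{a..b}. \<bar>l (\<gamma> t) - l (\<gamma> s)\<bar> \<le> K * \<bar>t - s\<bar>"
  shows "\<exists>K. \<forall>s\<in>{a..b}. \<forall>t\<in>{a..b}. p (\<gamma> t \<ominus> \<gamma> s) \<le> K * \<bar>t - s\<bar>"
proof -
  define I where "I = {z. fst z \<in> {a..b} \<and> snd z \<in> {a..b} \<and> fst z \<noteq> snd z}"
  have IC: "\<gamma> (fst z) \<in> carrier F" "\<gamma> (snd z) \<in> carrier F" if "z \<in> I" for z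
    using that by (auto simp: I_def intro!: \<gamma>)
  have "\<exists>K. \<forall>z\<in>I. \<bar>l (\<gamma> (snd z) \<ominus> \<gamma> (fst z))\<bar> \<le> K * \<bar>snd z - fst z\<bar>" if l: "l \<in> dual F" for l
  proof -
    obtain K where K: "\<forall>s\<in>{a..b}. \<forall>t\<in>{a..b}. \<bar>l (\<gamma> t) - l (\<gamma> s)\<bar> \<le> K * \<bar>t - s\<bar>"
      using Lip[OF l] ..
    have "\<bar>l (\<gamma> (snd z) \<ominus> \<gamma> (fst z))\<bar> \<le> K * \<bar>snd z - fst z\<bar>" if z: "z \<in> I" for z
      using K IC[OF z] z by (simp add: dual_diff[OF F l] I_def)
    then show ?thesis
      by blast
  qed
  then have "\<exists>K. \<forall>z\<in>I. p (\<gamma> (snd z) \<ominus> \<gamma> (fst z)) \<le> K * \<bar>snd z - fst z\<bar>"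
    using F IC by (intro functional_bounds_imp_seminorm_bound[OF F p]) (auto simp: I_def)
  then obtain K where K: "\<forall>z\<in>I. p (\<gamma> (snd z) \<ominus> \<gamma> (fst z)) \<le> K * \<bar>snd z - fst z\<bar>" ..
  have "p (\<gamma> t \<ominus> \<gamma> s) \<le> K * \<bar>t - s\<bar>" if st: "s \<in> {a..b}" "t \<in> {a..b}" for s t
    using K[THEN bspec, of "(s, t)"] st F p \<gamma>[OF st(2)] by (cases "s = t") (simp_all add: I_def)
  then show ?thesis
    by blast
qed

text \<open>
  Along a curve \<open>c\<close> of class \<open>C\<^sup>1\<close>, each \<open>l \<circ> f \<circ> c\<close> is Lipschitz on compact intervals, hence \<open>f \<circ> c\<close> is
  Lipschitz for every continuous seminorm. So preimages of open sets under \<open>f\<close> meet every curve in an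
  open set of parameters.
\<close>

lemma scalarwise_C1_imp_continuous:
  fixes F (structure)
  assumes E: "lcs E" and F: "lcs F" and gen: "curve_generated E" and U: "openin (topo E) U"
    and f: "\<And>x. x \<in> U \<Longrightarrow> f x \<in> carrier F"
    and C1: "\<And>l. l \<in> dual F \<Longrightarrow> Ck (Suc 0) E real_tvs U (\<lambda>x. l (f x))"
  shows "continuous_map (subtopology (topo E) U) (topo F) f"
proof -
  have UC: "U \<subseteq> carrier E"
    using openin_subset[OF U] lcs_topspace[OF E] by simp
  have "openin (topo E) {x \<in> U. f x \<in> W}" if W: "openin (topo F) W" for W
  proof -
    have op: "open (c -` {x \<in> U. f x \<in> W})" if c: "C1_curve E c c'" for c c'
      unfolding open_dist
    proof
      fix t assume "t \<in> c -` {x \<in> U. f x \<in> W}"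
      then have t: "c t \<in> U" "f (c t) \<in> W"
        by auto
      obtain p where p: "cseminorm F p" "{y \<in> carrier F. p (y \<ominus> f (c t)) < 1} \<subseteq> W"
        by (rule cseminorm_ball_in_open[OF F W t(2)])
      have "openin euclideanreal {t \<in> topspace euclideanreal. c t \<in> U}"
        using c U by (intro openin_continuous_map_preimage[of _ "topo E"]) (auto simp: C1_curve_def)
      then have "open {t. c t \<in> U}"
        by simp
      then obtain r where r: "r > 0" "cball t r \<subseteq> {t. c t \<in> U}"
        using t(1) unfolding open_contains_cball by blast
      have cU: "c s \<in> U" if "s \<in> {t - r..t + r}" for s
        using r(2) that by (auto simp: dist_real_def subset_iff)
      have fc: "f (c s) \<in> carrier F" if "s \<in> {t - r..t + r}" for s
        by (rule f[OF cU[OF that]])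
      have Lip: "\<exists>K. \<forall>s\<in>{t - r..t + r}. \<forall>u\<in>{t - r..t + r}. \<bar>l (f (c u)) - l (f (c s))\<bar> \<le> K * \<bar>u - s\<bar>"
        if l: "l \<in> dual F" for l
        using cU by (rule Ck_Lipschitz_along_curve[OF E U C1[OF l] c])
      have "\<exists>K. \<forall>s\<in>{t - r..t + r}. \<forall>u\<in>{t - r..t + r}. p (f (c u) \<ominus> f (c s)) \<le> K * \<bar>u - s\<bar>"
        by (rule scalarwise_Lipschitz[where \<gamma> = "\<lambda>t. f (c t)", OF F fc p(1) Lip])
      then obtain K where K: "\<And>s u. s \<in> {t - r..t + r} \<Longrightarrow> u \<in> {t - r..t + r} \<Longrightarrow>
          p (f (c u) \<ominus> f (c s)) \<le> K * \<bar>u - s\<bar>"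
        by blast
      define e where "e = min r (1 / (\<bar>K\<bar> + 1))"
      have "e > 0"
        using r(1) by (simp add: e_def)
      moreover have "s \<in> c -` {x \<in> U. f x \<in> W}" if s: "dist s t < e" for s
      proof -
        have s1: "s \<in> {t - r..t + r}" "t \<in> {t - r..t + r}" "\<bar>s - t\<bar> < 1 / (\<bar>K\<bar> + 1)"
          using s r(1) by (auto simp: dist_real_def e_def)
        have "p (f (c s) \<ominus> f (c t)) \<le> K * \<bar>s - t\<bar>"
          by (rule K[OF s1(2,1)])
        also have "\<dots> \<le> (\<bar>K\<bar> + 1) * \<bar>s - t\<bar>"
          by (intro mult_right_mono) auto
        also have "\<dots> < 1"
          using s1(3) by (simp add: field_simps)
        finally show ?thesis
          using p(2) cU[OF s1(1)] f by auto
      qed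
      ultimately show "\<exists>e>0. \<forall>s. dist s t < e \<longrightarrow> s \<in> c -` {x \<in> U. f x \<in> W}"
        by blast
    qed
    have "{x \<in> U. f x \<in> W} \<subseteq> carrier E"
      using UC by blast
    then show ?thesis
      using op by (rule gen[unfolded curve_generated_def, rule_format])
  qed
  moreover have "{x \<in> topspace (subtopology (topo E) U). f x \<in> W} = {x \<in> U. f x \<in> W}" for W
    using UC lcs_topspace[OF E] by auto
  ultimately have "openin (subtopology (topo E) U) {x \<in> topspace (subtopology (topo E) U). f x \<in> W}"
    if "openin (topo F) W" for W
    using that U by (simp add: openin_open_subtopology)
  then show ?thesis
    using f lcs_topspace[OF F] by (auto simp: continuous_map_def)
qed

text \<open>
  The estimates carry over from functionals to seminorms. So the net \<open>q t\<close>,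
  indexed by the punctured interval directed towards \<open>0\<close>, is Mackey-Cauchy with \<open>\<mu> s t = \<bar>s\<bar> + \<bar>t\<bar>\<close>.
\<close>

lemma scalarwise_Cauchy_imp_limit:
  fixes F (structure)
  assumes F: "lcs F" and complete: "mackey_complete F" and r: "r > (0::real)"
    and q: "\<And>t. 0 < \<bar>t\<bar> \<Longrightarrow> \<bar>t\<bar> \<le> r \<Longrightarrow> q t \<in> carrier F"
    and Cauchy: "\<And>l. l \<in> dual F \<Longrightarrow> \<exists>K. \<forall>s t. 0 < \<bar>s\<bar> \<and> \<bar>s\<bar> \<le> r \<and> 0 < \<bar>t\<bar> \<and> \<bar>t\<bar> \<le> r \<longrightarrow>
      \<bar>l (q s) - l (q t)\<bar> \<le> K * (\<bar>s\<bar> + \<bar>t\<bar>)"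
  shows "\<exists>y. limitin (topo F) q y (at 0)"
proof -
  define D where "D = {t. 0 < \<bar>t\<bar> \<and> \<bar>t\<bar> \<le> r}"
  define leq where "leq s t \<longleftrightarrow> \<bar>t\<bar> \<le> \<bar>s\<bar>" for s t :: real
  have D: "directed_on D leq"
    unfolding directed_on_def
  proof (intro conjI ballI impI)
    show "D \<noteq> {}"
      using r by (auto simp: D_def intro: exI[of _ r])
    fix s t assume "s \<in> D" "t \<in> D"
    then show "\<exists>k\<in>D. leq s k \<and> leq t k"
      by (intro bexI[of _ "if \<bar>s\<bar> \<le> \<bar>t\<bar> then s else t"]) (auto simp: leq_def)
  qed (auto simp: leq_def)
  define I where "I = D \<times> D"
  have qC: "q t \<in> carrier F" if "t \<in> D" for t
    using that q by (simp add: D_def)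
  have pos: "\<bar>fst z\<bar> + \<bar>snd z\<bar> > 0" if "z \<in> I" for z
    using that by (intro add_pos_nonneg) (auto simp: I_def D_def)
  have weak: "\<exists>K. \<forall>z\<in>I. \<bar>l (q (fst z) \<ominus> q (snd z))\<bar> \<le> K * (\<bar>fst z\<bar> + \<bar>snd z\<bar>)" if l: "l \<in> dual F" for l
  proof -
    obtain K where K: "\<forall>s t. 0 < \<bar>s\<bar> \<and> \<bar>s\<bar> \<le> r \<and> 0 < \<bar>t\<bar> \<and> \<bar>t\<bar> \<le> r \<longrightarrow> \<bar>l (q s) - l (q t)\<bar> \<le> K * (\<bar>s\<bar> + \<bar>t\<bar>)"
      using Cauchy[OF l] ..
    have "\<bar>l (q (fst z) \<ominus> q (snd z))\<bar> \<le> K * (\<bar>fst z\<bar> + \<bar>snd z\<bar>)" if z: "z \<in> I" for z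
      using K[rule_format, of "fst z" "snd z"] z qC by (auto simp: dual_diff[OF F l] I_def D_def)
    then show ?thesis
      by blast
  qed
  have diffC: "q (fst z) \<ominus> q (snd z) \<in> carrier F" if "z \<in> I" for z
    using that F qC by (auto simp: I_def)
  have "\<exists>K. \<forall>z\<in>I. p (q (fst z) \<ominus> q (snd z)) \<le> K * (\<bar>fst z\<bar> + \<bar>snd z\<bar>)" if "cseminorm F p" for p
    by (rule functional_bounds_imp_seminorm_bound[where z = "\<lambda>z. q (fst z) \<ominus> q (snd z)", OF F that diffC pos weak])
  then obtain M where M: "\<And>p z. cseminorm F p \<Longrightarrow> z \<in> I \<Longrightarrow>
      p (q (fst z) \<ominus> q (snd z)) \<le> M p * (\<bar>fst z\<bar> + \<bar>snd z\<bar>)"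
    by metis
  \<comment> \<open>Being defined by bounds on seminorms, \<open>B\<close> is absolutely convex.\<close>
  define B where "B = {y \<in> carrier F. \<forall>p. cseminorm F p \<longrightarrow> p y \<le> M p}"
  have "absolutely_convex_in F B"
    unfolding absolutely_convex_in_def
  proof (intro ballI allI impI)
    fix x y and a b :: real assume xy: "x \<in> B" "y \<in> B" and ab: "\<bar>a\<bar> + \<bar>b\<bar> \<le> 1"
    have C: "x \<in> carrier F" "y \<in> carrier F"
      using xy by (simp_all add: B_def)
    have "p (a \<odot> x \<oplus> b \<odot> y) \<le> M p" if p: "cseminorm F p" for p
    proof -
      have le: "p x \<le> M p" "p y \<le> M p"
        using xy p by (simp_all add: B_def)
      then have "M p \<ge> 0"
        using cseminorm_nonneg[OF F p C(1)] by linarith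
      have "p (a \<odot> x \<oplus> b \<odot> y) \<le> \<bar>a\<bar> * p x + \<bar>b\<bar> * p y"
        using cseminorm_add[OF p, of "a \<odot> x" "b \<odot> y"] F C by (simp add: cseminorm_smult[OF p])
      also have "\<dots> \<le> \<bar>a\<bar> * M p + \<bar>b\<bar> * M p"
        using le by (intro add_mono mult_left_mono) auto
      also have "\<dots> = (\<bar>a\<bar> + \<bar>b\<bar>) * M p"
        by (simp add: algebra_simps)
      also have "\<dots> \<le> M p"
        using ab \<open>M p \<ge> 0\<close> by (intro mult_left_le_one_le) auto
      finally show ?thesis .
    qed
    then show "a \<odot> x \<oplus> b \<odot> y \<in> B"
      using F C by (simp add: B_def)
  qed
  moreover have "bounded_in F B"
    unfolding bounded_in_def
  proof (intro conjI allI impI)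
    show "B \<subseteq> carrier F"
      by (auto simp: B_def)
    fix U assume U: "openin (topo F) U \<and> \<zero> \<in> U"
    obtain p where p: "cseminorm F p" "{x \<in> carrier F. p x < 1} \<subseteq> U"
      by (rule cseminorm_below_neighbourhood[OF F U[THEN conjunct1] U[THEN conjunct2]])
    define R where "R = \<bar>M p\<bar> + 1"
    have R: "R > 0"
      by (simp add: R_def)
    have "y \<in> (\<lambda>u. R \<odot> u) ` U" if "y \<in> B" for y
    proof -
      have y: "y \<in> carrier F" "p y < R"
        using that p(1) by (auto simp: B_def R_def abs_if)
      then have "(1 / R) \<odot> y \<in> U"
        using p(2) F R by (auto simp: cseminorm_smult[OF p(1)])
      moreover have "y = R \<odot> ((1 / R) \<odot> y)"
        using F y R by simp
      ultimately show ?thesis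
        by blast
    qed
    then show "\<exists>R>0. B \<subseteq> (\<lambda>u. R \<odot> u) ` U"
      using R by blast
  qed
  moreover have "((\<lambda>(i, j). \<bar>i\<bar> + \<bar>j\<bar>) \<longlongrightarrow> 0) (net_filter D leq \<times>\<^sub>F net_filter D leq)"
  proof -
    have lim: "((\<lambda>i. \<bar>i\<bar>) \<longlongrightarrow> 0) (net_filter D leq)"
    proof (rule tendstoI)
      fix e :: real assume "e > 0"
      then have "min r (e / 2) \<in> D" "min r (e / 2) < e"
        using r by (auto simp: D_def)
      then show "\<forall>\<^sub>F i in net_filter D leq. dist \<bar>i\<bar> 0 < e"
        unfolding eventually_net_filter[OF D]
        by (intro bexI[of _ "min r (e / 2)"]) (auto simp: leq_def D_def)
    qed
    have "((\<lambda>z. \<bar>fst z\<bar> + \<bar>snd z\<bar>) \<longlongrightarrow> 0 + 0) (net_filter D leq \<times>\<^sub>F net_filter D leq)"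
      by (intro tendsto_add filterlim_compose[OF lim] filterlim_fst filterlim_snd)
    then show ?thesis
      by (simp add: case_prod_unfold)
  qed
  moreover have "q i \<ominus> q j \<in> (\<lambda>b. (\<bar>i\<bar> + \<bar>j\<bar>) \<odot> b) ` B" if ij: "i \<in> D" "j \<in> D" for i j
  proof -
    have ij': "\<bar>i\<bar> + \<bar>j\<bar> > 0"
      using pos[of "(i, j)"] ij by (simp add: I_def)
    have "p ((1 / (\<bar>i\<bar> + \<bar>j\<bar>)) \<odot> (q i \<ominus> q j)) \<le> M p" if p: "cseminorm F p" for p
      using M[OF p, of "(i, j)"] ij ij' F qC by (simp add: I_def cseminorm_smult[OF p] pos_divide_le_eq)
    then have "(1 / (\<bar>i\<bar> + \<bar>j\<bar>)) \<odot> (q i \<ominus> q j) \<in> B"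
      using ij F qC by (simp add: B_def)
    moreover have "q i \<ominus> q j = (\<bar>i\<bar> + \<bar>j\<bar>) \<odot> ((1 / (\<bar>i\<bar> + \<bar>j\<bar>)) \<odot> (q i \<ominus> q j))"
      using F qC[OF ij(1)] qC[OF ij(2)] ij' by simp
    ultimately show ?thesis
      by blast
  qed
  ultimately have "mackey_cauchy F D leq q"
    unfolding mackey_cauchy_def using qC
    by (intro conjI exI[of _ B] exI[of _ "\<lambda>i j. \<bar>i\<bar> + \<bar>j\<bar>"] ballI) auto
  then obtain y where y: "limitin (topo F) q y (net_filter D leq)"
    using mackey_complete_net[OF F complete D] by blast
  have "limitin (topo F) q y (at 0)"
    unfolding limitin_def
  proof (intro conjI allI impI)
    show "y \<in> topspace (topo F)"
      using y by (simp add: limitin_def)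
    fix U assume "openin (topo F) U \<and> y \<in> U"
    then have "\<forall>\<^sub>F t in net_filter D leq. q t \<in> U"
      using y by (simp add: limitin_def)
    then obtain i where i: "i \<in> D" "\<And>t. t \<in> D \<Longrightarrow> leq i t \<Longrightarrow> q t \<in> U"
      unfolding eventually_net_filter[OF D] by blast
    have "\<forall>t. t \<noteq> 0 \<and> dist t 0 < \<bar>i\<bar> \<longrightarrow> q t \<in> U"
      using i by (auto simp: D_def leq_def)
    then show "\<forall>\<^sub>F t in at 0. q t \<in> U"
      using i(1) unfolding eventually_at by (intro exI[of _ "\<bar>i\<bar>"]) (auto simp: D_def)
  qed
  then show ?thesis ..
qed

lemma dual_real_tvs_ident: "(\<lambda>x. x) \<in> dual real_tvs"
  by (simp add: dual_def)

text \<open>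
  By the mean value theorem the difference quotient of \<open>l \<circ> f\<close> at \<open>t\<close> is a value of the derivative of
  \<open>l \<circ> f\<close> on the segment up to \<open>t\<close>. As \<open>l \<circ> f\<close> is of class \<open>C\<^sup>2\<close>, that derivative is Lipschitz along the
  line near \<open>x\<close>, so the quotient differs from the derivative at \<open>x\<close> by at most a multiple of \<open>\<bar>t\<bar>\<close>.
\<close>

lemma scalarwise_C2_imp_has_ddir:
  fixes E (structure)
  assumes E: "lcs E" and F: "lcs F" and complete: "mackey_complete F" and U: "openin (topo E) U"
    and f: "\<And>x. x \<in> U \<Longrightarrow> f x \<in> carrier F"
    and C2: "\<And>l. l \<in> dual F \<Longrightarrow> Ck (Suc (Suc 0)) E real_tvs U (\<lambda>x. l (f x))"
    and x: "x \<in> U" and v: "v \<in> carrier E"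
  shows "\<exists>y. has_ddir E F f x v y"
proof -
  have xC: "x \<in> carrier E"
    using openin_subset[OF U] lcs_topspace[OF E] x by auto
  obtain e where e: "e > 0" "\<And>t. t \<noteq> 0 \<Longrightarrow> \<bar>t\<bar> < e \<Longrightarrow> x \<oplus> t \<odot> v \<in> U"
    using eventually_line_in_open[OF E U x v] by (auto simp: eventually_at dist_real_def)
  define r where "r = e / 2"
  have r: "r > 0"
    using e(1) by (simp add: r_def)
  have line: "x \<oplus> t \<odot> v \<in> U" if "\<bar>t\<bar> \<le> r" for t
    using e that x E v xC by (cases "t = 0") (auto simp: r_def)
  let ?q = "\<lambda>t. (1 / t) \<odot>\<^bsub>F\<^esub> (f (x \<oplus> t \<odot> v) \<ominus>\<^bsub>F\<^esub> f x)"
  have "\<exists>K. \<forall>s t. 0 < \<bar>s\<bar> \<and> \<bar>s\<bar> \<le> r \<and> 0 < \<bar>t\<bar> \<and> \<bar>t\<bar> \<le> r \<longrightarrow> \<bar>l (?q s) - l (?q t)\<bar> \<le> K * (\<bar>s\<bar> + \<bar>t\<bar>)"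
    if l: "l \<in> dual F" for l
  proof -
    let ?h = "\<lambda>x. l (f x)"
    let ?D = "differential E real_tvs ?h"
    note sq = lcs_square_tvs[OF E] and U2 = openin_times_carrier[OF E U]
    have deriv: "((\<lambda>s. ?h (x \<oplus> s \<odot> v)) has_real_derivative ?D (Pair (x \<oplus> s \<odot> v) v)) (at s)"
      if s: "\<bar>s\<bar> \<le> r" for s
      by (rule real_derivative_along_line[OF E lcs_real_tvs U _
            Ck_Suc_has_ddir_differential[OF E lcs_real_tvs U C2[OF l] line[OF s] v]
            dual_real_tvs_ident xC v line[OF s]]) simp
    \<comment> \<open>In the square of \<open>E\<close>, the derivative is evaluated along the line through \<open>(x, v)\<close> with direction \<open>(v, 0)\<close>.\<close>
    have "C1_curve (square_tvs E) (\<lambda>s. Pair x v \<oplus>\<^bsub>square_tvs E\<^esub> s \<odot>\<^bsub>square_tvs E\<^esub> Pair v \<zero>) (\<lambda>_. Pair v \<zero>)"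
      using xC v E by (intro C1_curve_line[OF sq]) auto
    then have curve: "C1_curve (square_tvs E) (\<lambda>s. Pair (x \<oplus> s \<odot> v) v) (\<lambda>_. Pair v \<zero>)"
      using v E by simp
    have "\<exists>K. \<forall>s\<in>{-r..r}. \<forall>t\<in>{-r..r}. \<bar>?D (Pair (x \<oplus> t \<odot> v) v) - ?D (Pair (x \<oplus> s \<odot> v) v)\<bar> \<le> K * \<bar>t - s\<bar>"
      using line v
      by (intro Ck_Lipschitz_along_curve[OF sq U2 Ck_differential[OF E lcs_real_tvs U C2[OF l]] curve]) auto
    then obtain K where K: "\<forall>s\<in>{-r..r}. \<forall>t\<in>{-r..r}.
        \<bar>?D (Pair (x \<oplus> t \<odot> v) v) - ?D (Pair (x \<oplus> s \<odot> v) v)\<bar> \<le> K * \<bar>t - s\<bar>" ..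
    let ?d0 = "?D (Pair (x \<oplus> 0 \<odot> v) v)"
    have near: "\<bar>l (?q t) - ?d0\<bar> \<le> \<bar>K\<bar> * \<bar>t\<bar>" if t: "0 < \<bar>t\<bar>" "\<bar>t\<bar> \<le> r" for t
    proof -
      have "\<exists>s. \<bar>s\<bar> \<le> \<bar>t\<bar> \<and> ?h (x \<oplus> t \<odot> v) - ?h (x \<oplus> 0 \<odot> v) = t * ?D (Pair (x \<oplus> s \<odot> v) v)"
        using t by (intro mean_value_from_zero deriv) auto
      then obtain s where s: "\<bar>s\<bar> \<le> \<bar>t\<bar>" "?h (x \<oplus> t \<odot> v) - ?h x = t * ?D (Pair (x \<oplus> s \<odot> v) v)"
        using E xC v by auto
      have "l (?q t) = ?D (Pair (x \<oplus> s \<odot> v) v)"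
        using s(2) t(1) F f[OF line[OF t(2)]] f[OF x] by (simp add: dual_smult[OF l] dual_diff[OF F l])
      moreover have "0 \<in> {-r..r}" "s \<in> {-r..r}"
        using s(1) t by auto
      ultimately have "\<bar>l (?q t) - ?d0\<bar> \<le> K * \<bar>s - 0\<bar>"
        using K by (simp only:)
      also have "\<dots> \<le> \<bar>K\<bar> * \<bar>t\<bar>"
        using s(1) by (intro mult_mono) auto
      finally show ?thesis .
    qed
    have "\<bar>l (?q s) - l (?q t)\<bar> \<le> \<bar>K\<bar> * (\<bar>s\<bar> + \<bar>t\<bar>)"
      if "0 < \<bar>s\<bar> \<and> \<bar>s\<bar> \<le> r \<and> 0 < \<bar>t\<bar> \<and> \<bar>t\<bar> \<le> r" for s t
    proof -
      have "\<bar>l (?q s) - l (?q t)\<bar> \<le> \<bar>l (?q s) - ?d0\<bar> + \<bar>l (?q t) - ?d0\<bar>"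
        by linarith
      also have "\<dots> \<le> \<bar>K\<bar> * \<bar>s\<bar> + \<bar>K\<bar> * \<bar>t\<bar>"
        using that by (intro add_mono near) auto
      finally show ?thesis
        by (simp add: algebra_simps)
    qed
    then show ?thesis
      by blast
  qed
  moreover have "?q t \<in> carrier F" if "\<bar>t\<bar> \<le> r" for t
    using F f[OF line[OF that]] f[OF x] by simp
  ultimately show ?thesis
    unfolding has_ddir_def by (intro scalarwise_Cauchy_imp_limit[OF F complete r])
qed

text \<open>
  The hypothesis on \<open>f\<close> passes to its derivative, since \<open>l\<close> commutes with differentiation; the hypothesis
  on the iterated squares passes from \<open>E\<close> to its square.
\<close>

theorem scalarwise_smooth_imp_Ck:
  assumes F: "lcs F" and complete: "mackey_complete F"
  shows "lcs E \<Longrightarrow> (\<And>n. curve_generated ((square_tvs ^^ n) E)) \<Longrightarrow> openin (topo E) U \<Longrightarrow>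
    (\<And>x. x \<in> U \<Longrightarrow> f x \<in> carrier F) \<Longrightarrow>
    (\<And>l m. l \<in> dual F \<Longrightarrow> Ck m E real_tvs U (\<lambda>x. l (f x))) \<Longrightarrow> Ck k E F U f"
proof (induction k arbitrary: E U f)
  case 0
  have "curve_generated E"
    using 0(2)[of 0] by simp
  then show ?case
    using scalarwise_C1_imp_continuous[where f = f, OF 0(1) F _ 0(3,4,5)] by simp
next
  case (Suc k)
  note E = Suc.prems(1) and gen = Suc.prems(2) and U = Suc.prems(3) and f = Suc.prems(4) and sc = Suc.prems(5)
  note sq = lcs_square_tvs[OF E] and U2 = openin_times_carrier[OF E U]
  let ?d = "differential E F f"
  have d: "has_ddir E F f x v (?d (Pair x v))" if xv: "x \<in> U" "v \<in> carrier E" for x v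
  proof -
    obtain y where "has_ddir E F f x v y"
      using scalarwise_C2_imp_has_ddir[where f = f, OF E F complete U f sc xv] by blast
    then show ?thesis
      using differential_eq[OF F] by metis
  qed
  have "Ck k (square_tvs E) F (times_carrier E U) ?d"
  proof (rule Suc.IH[OF sq _ U2])
    show "curve_generated ((square_tvs ^^ n) (square_tvs E))" for n
      using gen[of "Suc n"] by (simp add: funpow_swap1)
    show "?d p \<in> carrier F" if "p \<in> times_carrier E U" for p
      using that d lcs_topspace[OF F] by (auto simp: has_ddir_def limitin_def)
    fix l m assume l: "l \<in> dual F"
    have "differential E real_tvs (\<lambda>x. l (f x)) p = l (?d p)" if p: "p \<in> times_carrier E U" for p
    proof -
      obtain x v where xv: "p = Pair x v" "x \<in> U" "v \<in> carrier E"
        using p by blast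
      have "has_ddir E real_tvs (\<lambda>x. l (f x)) x v (l (?d p))"
        unfolding xv(1)
        by (rule has_ddir_post_linear[OF E F lcs_real_tvs dual_imp_clinear[OF l] U f d[OF xv(2,3)] xv(2,3)])
      then show ?thesis
        unfolding xv(1) by (rule differential_eq[OF lcs_real_tvs])
    qed
    then show "Ck m (square_tvs E) real_tvs (times_carrier E U) (\<lambda>p. l (?d p))"
      by (rule Ck_cong[OF sq U2 _ Ck_differential[OF E lcs_real_tvs U sc[OF l]]])
  qed
  moreover have "continuous_map (subtopology (topo E) U) (topo F) f"
    using gen[of 0] by (intro scalarwise_C1_imp_continuous[where f = f, OF E F _ U f sc]) simp_all
  ultimately show ?case
    using d by (intro Ck_SucI[where d = ?d])
qed

theorem scalarwise_smooth_imp_smooth: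
  assumes E: "E \<in> cinf_lcs" and F: "F \<in> mackey_lcs" and U: "openin (topo E) U"
    and f: "\<And>x. x \<in> U \<Longrightarrow> f x \<in> carrier F"
    and sc: "\<And>l. l \<in> dual F \<Longrightarrow> smooth_map E real_tvs U (\<lambda>x. l (f x))"
  shows "smooth_map E F U f"
  unfolding smooth_map_def
proof (intro conjI allI U)
  fix k
  have lcs: "lcs E" "lcs F" "mackey_complete F"
    using E F by (simp_all add: cinf_lcs_def mackey_lcs_def)
  show "Ck k (base_tvs E) F (Base ` U) (f \<circ> unBase)"
  proof (rule scalarwise_smooth_imp_Ck[OF lcs(2,3) lcs_base_tvs[OF lcs(1)] _ openin_base_tvs[OF lcs(1) U]])
    show "curve_generated (iterated_square n E)" for n
      by (rule curve_generated_iterated_square[OF E])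
    show "Ck m (base_tvs E) real_tvs (Base ` U) (\<lambda>x. l ((f \<circ> unBase) x))" if "l \<in> dual F" for l m
      using sc[OF that] by (simp add: smooth_map_def o_def)
  qed (auto simp: f)
qed

section \<open>Charts\<close>

lemma cinf_lcs_lcs: "\<forall>E\<in>cinf_lcs. lcs E"
  by (simp add: cinf_lcs_def)

lemma mackey_lcs_lcs: "\<forall>E\<in>mackey_lcs. lcs E"
  by (simp add: mackey_lcs_def)

context
  fixes \<E> :: "'e tvs set" and M :: "'m topology" and U :: "'m set" and \<phi> :: "'m \<Rightarrow> 'e" and E :: "'e tvs"
  assumes chart: "is_chart \<E> M (U, \<phi>, E)"
begin

lemma chart_open: "openin M U"
  using chart by (simp add: is_chart_def)

lemma chart_space: "E \<in> \<E>"
  using chart by (simp add: is_chart_def)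

lemma chart_homeomorphic: "homeomorphic_map (subtopology M U) (subtopology (topo E) (\<phi> ` U)) \<phi>"
  using chart by (simp add: is_chart_def)

lemma chart_topspace: "topspace (subtopology M U) = U"
  using openin_subset[OF chart_open] by auto

lemma chart_inj_on: "inj_on \<phi> U"
  using homeomorphic_imp_injective_map[OF chart_homeomorphic] by (simp only: chart_topspace)

lemma chart_inv: "x \<in> U \<Longrightarrow> inv_into U \<phi> (\<phi> x) = x"
  using chart_inj_on by (rule inv_into_f_f)

lemma chart_inv_subset: "V \<subseteq> U \<Longrightarrow> x \<in> V \<Longrightarrow> inv_into V \<phi> (\<phi> x) = x"
  using inj_on_subset[OF chart_inj_on] by (auto intro: inv_into_f_f)

lemma chart_image_open: "openin (topo E) (\<phi> ` V)" if V: "openin M V" "V \<subseteq> U"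
proof -
  have "openin (subtopology (topo E) (\<phi> ` U)) (\<phi> ` V)"
    using V homeomorphic_imp_open_map[OF chart_homeomorphic] chart_open
    by (auto simp: open_map_def openin_open_subtopology)
  moreover have "openin (topo E) (\<phi> ` U)"
    using chart by (simp add: is_chart_def)
  ultimately show ?thesis
    using openin_trans_full by blast
qed

lemma chart_restrict: "is_chart \<E> M (V, \<phi>, E)" if V: "openin M V" "V \<subseteq> U"
proof -
  have "homeomorphic_map (subtopology (subtopology M U) V)
      (subtopology (subtopology (topo E) (\<phi> ` U)) (\<phi> ` V)) \<phi>"
  proof (rule homeomorphic_map_subtopologies[OF chart_homeomorphic])
    have UE: "topspace (subtopology (topo E) (\<phi> ` U)) = \<phi> ` U"
      using homeomorphic_imp_surjective_map[OF chart_homeomorphic] by (simp only: chart_topspace)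
    show "\<phi> ` (topspace (subtopology M U) \<inter> V) = topspace (subtopology (topo E) (\<phi> ` U)) \<inter> \<phi> ` V"
      unfolding chart_topspace UE using V(2) by blast
  qed
  moreover have "U \<inter> V = V" "\<phi> ` U \<inter> \<phi> ` V = \<phi> ` V"
    using V(2) by auto
  ultimately have "homeomorphic_map (subtopology M V) (subtopology (topo E) (\<phi> ` V)) \<phi>"
    by (simp add: subtopology_subtopology)
  then show ?thesis
    using V chart_image_open[OF V] chart_space by (simp add: is_chart_def)
qed

end

text \<open>Two local representatives of \<open>f\<close> differ by the transition map between their charts.\<close>

lemma smooth_representative_transition:
  assumes c: "is_chart \<E> M (U, \<phi>, E)" "lcs E" and c': "is_chart \<E> M (U', \<psi>, F)" "lcs F" and G: "lcs G"
    and trans: "smooth_transition (U, \<phi>, E) (U', \<psi>, F)"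
    and W: "openin M W" "W \<subseteq> U" "W \<subseteq> U'"
    and f: "smooth_map E G (\<phi> ` W) (f \<circ> inv_into U \<phi>)"
  shows "smooth_map F G (\<psi> ` W) (f \<circ> inv_into U' \<psi>)"
proof -
  have "smooth_map F E (\<psi> ` (U \<inter> U')) (\<phi> \<circ> inv_into U' \<psi>)"
    using trans by (simp add: smooth_transition_def)
  then have trans': "smooth_map F E (\<psi> ` W) (\<phi> \<circ> inv_into U' \<psi>)"
    by (rule smooth_map_subset[OF c'(2) c(2) _ chart_image_open[OF c'(1) W(1,3)]]) (use W in blast)
  have inv: "inv_into U' \<psi> (\<psi> x) = x" "inv_into U \<phi> (\<phi> x) = x" if "x \<in> W" for x
    using that W(2,3) chart_inv[OF c(1)] chart_inv[OF c'(1)] by blast+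
  have "smooth_map F G (\<psi> ` W) (\<lambda>y. (f \<circ> inv_into U \<phi>) ((\<phi> \<circ> inv_into U' \<psi>) y))"
    by (rule smooth_map_compose[OF c'(2) c(2) G trans' f]) (auto simp: inv)
  then show ?thesis
    by (rule smooth_map_cong[OF c'(2)]) (auto simp: inv)
qed

lemma atlas_transition: "smooth_atlas \<E> M A \<Longrightarrow> c \<in> A \<Longrightarrow> c' \<in> A \<Longrightarrow> smooth_transition c c'"
  by (simp add: smooth_atlas_def)

lemma mem_cinf_sheaf_iff:
  "f \<in> cinf_sheaf M A V \<longleftrightarrow> f \<in> extensional V \<and> continuous_map (subtopology M V) euclideanreal f \<and>
     (\<forall>U \<phi> E. (U, \<phi>, E) \<in> A \<and> U \<subseteq> V \<longrightarrow> smooth_map E real_tvs (\<phi> ` U) (f \<circ> inv_into U \<phi>))"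
  unfolding cinf_sheaf_def smooth_manifold_map_def by (auto simp: comp_assoc id_comp)

context
  fixes \<E> :: "'e tvs set" and M :: "'m topology" and A :: "('m, 'e) chart set"
  assumes \<E>: "\<forall>E\<in>\<E>. lcs E"
begin

lemma atlas_chart:
  assumes "smooth_atlas \<E> M A" "(U, \<phi>, E) \<in> A"
  shows "is_chart \<E> M (U, \<phi>, E)" "lcs E"
proof -
  show "is_chart \<E> M (U, \<phi>, E)"
    using assms by (auto simp: smooth_atlas_def)
  then show "lcs E"
    using \<E> chart_space by blast
qed

lemma atlas_cover:
  assumes "smooth_atlas \<E> M A" "x \<in> topspace M"
  obtains U \<phi> E where "(U, \<phi>, E) \<in> A" "x \<in> U"
  using assms unfolding smooth_atlas_def by (metis UN_E prod.collapse)

text \<open>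
  Restricting a chart preserves compatibility with the atlas, so maximality applies. This provides
  charts inside any given open set.
\<close>

lemma maximal_atlas_restrict:
  assumes A: "maximal_atlas \<E> M A" and c: "(U, \<phi>, E) \<in> A" and V: "openin M V" "V \<subseteq> U"
  shows "(V, \<phi>, E) \<in> A"
proof -
  have at: "smooth_atlas \<E> M A"
    using A by (simp add: maximal_atlas_def)
  note ch = atlas_chart[OF at c]
  have "smooth_transition (V, \<phi>, E) c' \<and> smooth_transition c' (V, \<phi>, E)" if c': "c' \<in> A" for c'
  proof -
    obtain U' \<psi> F where c'_eq: "c' = (U', \<psi>, F)"
      by (cases c')
    note ch' = atlas_chart[OF at c'[unfolded c'_eq]]
    have W: "openin M (V \<inter> U')"
      using V(1) chart_open[OF ch'(1)] by blast
    have "smooth_map F E (\<psi> ` (U \<inter> U')) (\<phi> \<circ> inv_into U' \<psi>)"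
      using atlas_transition[OF at c c'] by (simp add: smooth_transition_def c'_eq)
    then have "smooth_map F E (\<psi> ` (V \<inter> U')) (\<phi> \<circ> inv_into U' \<psi>)"
      by (rule smooth_map_subset[OF ch'(2) ch(2) _ chart_image_open[OF ch'(1) W]]) (use V in auto)
    moreover have "smooth_map E F (\<phi> ` (U' \<inter> V)) (\<psi> \<circ> inv_into V \<phi>)"
    proof (rule smooth_map_cong[OF ch(2)])
      have "smooth_map E F (\<phi> ` (U' \<inter> U)) (\<psi> \<circ> inv_into U \<phi>)"
        using atlas_transition[OF at c' c] by (simp add: smooth_transition_def c'_eq)
      then show "smooth_map E F (\<phi> ` (U' \<inter> V)) (\<psi> \<circ> inv_into U \<phi>)"
        by (rule smooth_map_subset[OF ch(2) ch'(2) _ chart_image_open[OF ch(1)]])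
          (use V W in \<open>auto simp: Int_commute\<close>)
    qed (use V(2) in \<open>auto simp: chart_inv[OF ch(1)] chart_inv_subset[OF ch(1) V(2)]\<close>)
    ultimately show ?thesis
      by (simp add: smooth_transition_def c'_eq)
  qed
  then show ?thesis
    using A chart_restrict[OF ch(1) V] unfolding maximal_atlas_def by blast
qed

section \<open>The sheaf of smooth functions\<close>

text \<open>
  Smoothness of a function can be checked in any one chart around each point, rather than in all
  charts contained in \<open>V\<close>.
\<close>

lemma cinf_sheaf_locally:
  assumes A: "smooth_atlas \<E> M A" and V: "openin M V" and f: "f \<in> extensional V"
    and local: "\<And>x. x \<in> V \<Longrightarrow> \<exists>U \<phi> E W. (U, \<phi>, E) \<in> A \<and> openin M W \<and> x \<in> W \<and> W \<subseteq> U \<and> W \<subseteq> V \<and>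
      smooth_map E real_tvs (\<phi> ` W) (f \<circ> inv_into U \<phi>)"
  shows "f \<in> cinf_sheaf M A V"
  unfolding mem_cinf_sheaf_iff
proof (intro conjI allI impI f)
  show "continuous_map (subtopology M V) euclideanreal f"
  proof (rule continuous_map_locally)
    fix x assume x: "x \<in> V"
    obtain U \<phi> E W where c: "(U, \<phi>, E) \<in> A" and W: "openin M W" "x \<in> W" "W \<subseteq> U" "W \<subseteq> V"
      and sm: "smooth_map E real_tvs (\<phi> ` W) (f \<circ> inv_into U \<phi>)"
      using local[OF x] by blast
    note ch = atlas_chart[OF A c]
    have "continuous_map (subtopology M W) (subtopology (topo E) (\<phi> ` W)) \<phi>"
      by (rule homeomorphic_imp_continuous_map[OF chart_homeomorphic[OF chart_restrict[OF ch(1) W(1,3)]]])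
    from continuous_map_compose[OF this smooth_map_continuous[OF ch(2) sm]]
    have "continuous_map (subtopology M W) euclideanreal (f \<circ> inv_into U \<phi> \<circ> \<phi>)"
      by simp
    then have "continuous_map (subtopology M W) euclideanreal f"
      by (rule continuous_map_eq) (use W(3) chart_inv[OF ch(1)] in auto)
    then show "\<exists>W. openin M W \<and> x \<in> W \<and> W \<subseteq> V \<and> continuous_map (subtopology M W) euclideanreal f"
      using W by blast
  qed
next
  fix U' \<psi> F assume c': "(U', \<psi>, F) \<in> A \<and> U' \<subseteq> V"
  note ch' = atlas_chart[OF A c'[THEN conjunct1]]
  show "smooth_map F real_tvs (\<psi> ` U') (f \<circ> inv_into U' \<psi>)"
  proof (rule smooth_map_locally[OF ch'(2) lcs_real_tvs])
    show "openin (topo F) (\<psi> ` U')"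
      using chart_image_open[OF ch'(1) chart_open[OF ch'(1)]] by simp
    fix y assume "y \<in> \<psi> ` U'"
    then obtain x where x: "x \<in> U'" "y = \<psi> x"
      by blast
    have xV: "x \<in> V"
      using x(1) c' by blast
    obtain U \<phi> E W where c: "(U, \<phi>, E) \<in> A" and W: "openin M W" "x \<in> W" "W \<subseteq> U" "W \<subseteq> V"
      and sm: "smooth_map E real_tvs (\<phi> ` W) (f \<circ> inv_into U \<phi>)"
      using local[OF xV] by blast
    note ch = atlas_chart[OF A c]
    have W': "openin M (W \<inter> U')" "W \<inter> U' \<subseteq> U" "W \<inter> U' \<subseteq> U'"
      using W chart_open[OF ch'(1)] by auto
    have "smooth_map E real_tvs (\<phi> ` (W \<inter> U')) (f \<circ> inv_into U \<phi>)"
      by (rule smooth_map_subset[OF ch(2) lcs_real_tvs sm chart_image_open[OF ch(1) W'(1,2)]]) auto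
    then have "smooth_map F real_tvs (\<psi> ` (W \<inter> U')) (f \<circ> inv_into U' \<psi>)"
      by (rule smooth_representative_transition[OF ch ch' lcs_real_tvs
            atlas_transition[OF A c c'[THEN conjunct1]] W'])
    then show "\<exists>V. y \<in> V \<and> V \<subseteq> \<psi> ` U' \<and> smooth_map F real_tvs V (f \<circ> inv_into U' \<psi>)"
      using x W(2) by (intro exI[of _ "\<psi> ` (W \<inter> U')"]) auto
  qed
qed

end

lemma smooth_manifold_map_representative:
  assumes \<Phi>: "smooth_manifold_map M A N B \<Phi>" and c: "(U, \<phi>, E) \<in> A" and c': "(V, \<psi>, F) \<in> B"
    and UV: "\<Phi> ` U \<subseteq> V"
  shows "smooth_map E F (\<phi> ` U) (\<psi> \<circ> \<Phi> \<circ> inv_into U \<phi>)"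
proof -
  have "\<forall>(V, \<psi>, F)\<in>B. \<Phi> ` U \<subseteq> V \<longrightarrow> smooth_map E F (\<phi> ` U) (\<psi> \<circ> \<Phi> \<circ> inv_into U \<phi>)"
    using bspec[OF \<Phi>[unfolded smooth_manifold_map_def, THEN conjunct2] c] by simp
  from bspec[OF this c'] UV show ?thesis
    by simp
qed

text \<open>
  In terms of ringed spaces: \<open>\<phi>\<close> is an isomorphism from the restriction of \<open>\<O>\<close> to \<open>U\<close> onto the sheaf of
  smooth functions on \<open>\<phi> ` U\<close>.
\<close>

definition adapted_chart :: "'m topology \<Rightarrow> 'm fun_sheaf \<Rightarrow> ('m, 'e) chart \<Rightarrow> bool" where
  "adapted_chart X \<O> = (\<lambda>(U, \<phi>, E). \<forall>V f. openin X V \<and> V \<subseteq> U \<and> f \<in> extensional V \<longrightarrow>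
     (f \<in> \<O> V \<longleftrightarrow> smooth_map E real_tvs (\<phi> ` V) (f \<circ> inv_into U \<phi>)))"

lemma adapted_chartD:
  assumes "adapted_chart X \<O> (U, \<phi>, E)" "openin X V" "V \<subseteq> U" "f \<in> extensional V"
  shows "f \<in> \<O> V \<longleftrightarrow> smooth_map E real_tvs (\<phi> ` V) (f \<circ> inv_into U \<phi>)"
  using assms by (simp add: adapted_chart_def)

text \<open>
  One implication reads a section in the restricted chart \<open>(V, \<phi>, E)\<close>, which belongs to the atlas by
  maximality; the other one is the local criterion applied to the single chart.
\<close>

lemma maximal_atlas_adapted:
  assumes \<E>: "\<forall>E\<in>\<E>. lcs E" and A: "maximal_atlas \<E> M A" and c: "(U, \<phi>, E) \<in> A"
  shows "adapted_chart M (cinf_sheaf M A) (U, \<phi>, E)"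
proof -
  have at: "smooth_atlas \<E> M A"
    using A by (simp add: maximal_atlas_def)
  note ch = atlas_chart[OF \<E> at c]
  have "f \<in> cinf_sheaf M A V \<longleftrightarrow> smooth_map E real_tvs (\<phi> ` V) (f \<circ> inv_into U \<phi>)"
    if V: "openin M V" "V \<subseteq> U" and f: "f \<in> extensional V" for V f
  proof
    assume "f \<in> cinf_sheaf M A V"
    then have "smooth_map E real_tvs (\<phi> ` V) (f \<circ> inv_into V \<phi>)"
      using maximal_atlas_restrict[OF \<E> A c V] by (simp add: mem_cinf_sheaf_iff)
    then show "smooth_map E real_tvs (\<phi> ` V) (f \<circ> inv_into U \<phi>)"
      by (rule smooth_map_cong[OF ch(2)])
        (use V(2) in \<open>auto simp: chart_inv[OF ch(1)] chart_inv_subset[OF ch(1) V(2)]\<close>)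
  next
    assume "smooth_map E real_tvs (\<phi> ` V) (f \<circ> inv_into U \<phi>)"
    then show "f \<in> cinf_sheaf M A V"
      using V c by (intro cinf_sheaf_locally[OF \<E> at V(1) f]) blast+
  qed
  then show ?thesis
    by (simp add: adapted_chart_def)
qed

text \<open>
  Functionals composed with an adapted chart are sections; these are the test functions for the
  scalarwise criterion.
\<close>

lemma adapted_dual_section:
  assumes c: "is_chart \<E> X (U, \<phi>, E)" "lcs E" and ad: "adapted_chart X \<O> (U, \<phi>, E)"
    and l: "l \<in> dual E" and V: "openin X V" "V \<subseteq> U"
  shows "(\<lambda>x\<in>V. l (\<phi> x)) \<in> \<O> V"
proof -
  have "smooth_map E real_tvs (\<phi> ` V) (\<lambda>y. l y)"
    by (rule smooth_map_dual[OF c(2) c(2) smooth_map_ident[OF c(2) chart_image_open[OF c(1) V]] l])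
  then have "smooth_map E real_tvs (\<phi> ` V) ((\<lambda>x\<in>V. l (\<phi> x)) \<circ> inv_into U \<phi>)"
    by (rule smooth_map_cong[OF c(2)]) (use V(2) in \<open>auto simp: chart_inv[OF c(1)]\<close>)
  then show ?thesis
    using adapted_chartD[OF ad V, of "\<lambda>x\<in>V. l (\<phi> x)"] by simp
qed

section \<open>Smooth maps are the morphisms of ringed spaces\<close>

text \<open>
  Locally the pullback of \<open>g\<close>, read in charts, is the composition of the representatives \<open>g \<circ> \<psi>\<^sup>-\<^sup>1\<close> and
  \<open>\<psi> \<circ> \<Phi> \<circ> \<phi>\<^sup>-\<^sup>1\<close>; small charts that fit together exist because maximal atlases contain restrictions.
\<close>

lemma smooth_imp_lrs_morphism:
  assumes \<E>: "\<forall>E\<in>\<E>. lcs E" and \<F>: "\<forall>F\<in>\<F>. lcs F"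
    and A: "maximal_atlas \<E> M A" and B: "maximal_atlas \<F> N B" and \<Phi>: "smooth_manifold_map M A N B \<Phi>"
  shows "lrs_morphism M (cinf_sheaf M A) N (cinf_sheaf N B) \<Phi>"
  unfolding lrs_morphism_def
proof (intro conjI allI impI ballI)
  have at: "smooth_atlas \<E> M A" "smooth_atlas \<F> N B"
    using A B by (simp_all add: maximal_atlas_def)
  show cont: "continuous_map M N \<Phi>"
    using \<Phi> by (simp add: smooth_manifold_map_def)
  fix W g assume W: "openin N W" and g: "g \<in> cinf_sheaf N B W"
  define P where "P = {x \<in> topspace M. \<Phi> x \<in> W}"
  have P: "openin M P"
    unfolding P_def using cont W by (rule openin_continuous_map_preimage)
  have "restrict (g \<circ> \<Phi>) P \<in> cinf_sheaf M A P"
  proof (rule cinf_sheaf_locally[OF \<E> at(1) P])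
    fix x assume x: "x \<in> P"
    then have xM: "x \<in> topspace M" and xW: "\<Phi> x \<in> W"
      by (simp_all add: P_def)
    have "\<Phi> x \<in> topspace N"
      using openin_subset[OF W] xW by blast
    then obtain V \<psi> F where c': "(V, \<psi>, F) \<in> B" "\<Phi> x \<in> V"
      by (rule atlas_cover[OF \<F> at(2)])
    obtain U \<phi> E where c: "(U, \<phi>, E) \<in> A" "x \<in> U"
      by (rule atlas_cover[OF \<E> at(1) xM])
    note ch = atlas_chart[OF \<E> at(1) c(1)] and ch' = atlas_chart[OF \<F> at(2) c'(1)]
    define V' where "V' = V \<inter> W"
    have V': "openin N V'" "V' \<subseteq> V" "V' \<subseteq> W"
      using W chart_open[OF ch'(1)] by (auto simp: V'_def)
    define U' where "U' = U \<inter> {x \<in> topspace M. \<Phi> x \<in> V'}"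
    have "openin M {x \<in> topspace M. \<Phi> x \<in> V'}"
      using cont V'(1) by (rule openin_continuous_map_preimage)
    then have U': "openin M U'" "U' \<subseteq> U" "U' \<subseteq> P" "\<Phi> ` U' \<subseteq> V'" "x \<in> U'"
      using chart_open[OF ch(1)] V'(3) c(2) c'(2) xM xW by (auto simp: U'_def V'_def P_def)
    have c1: "(U', \<phi>, E) \<in> A" and c1': "(V', \<psi>, F) \<in> B"
      using maximal_atlas_restrict[OF \<E> A c(1) U'(1,2)] maximal_atlas_restrict[OF \<F> B c'(1) V'(1,2)] by auto
    have sm: "smooth_map E F (\<phi> ` U') (\<psi> \<circ> \<Phi> \<circ> inv_into U' \<phi>)"
      using U'(4) by (rule smooth_manifold_map_representative[OF \<Phi> c1 c1'])
    have smg: "smooth_map F real_tvs (\<psi> ` V') (g \<circ> inv_into V' \<psi>)"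
      using g c1' V'(3) by (simp add: mem_cinf_sheaf_iff)
    have inv: "inv_into U' \<phi> (\<phi> z) = z" "inv_into V' \<psi> (\<psi> (\<Phi> z)) = \<Phi> z" if "z \<in> U'" for z
      using that U'(4) chart_inv_subset[OF ch(1) U'(2)] chart_inv_subset[OF ch'(1) V'(2)] by auto
    have "smooth_map E real_tvs (\<phi> ` U') (\<lambda>y. (g \<circ> inv_into V' \<psi>) ((\<psi> \<circ> \<Phi> \<circ> inv_into U' \<phi>) y))"
      by (rule smooth_map_compose[OF ch(2) ch'(2) lcs_real_tvs sm smg]) (use U'(4) in \<open>auto simp: inv\<close>)
    then have "smooth_map E real_tvs (\<phi> ` U') (restrict (g \<circ> \<Phi>) P \<circ> inv_into U' \<phi>)"
      by (rule smooth_map_cong[OF ch(2)]) (use U'(3) in \<open>auto simp: inv\<close>)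
    then show "\<exists>U \<phi> E W. (U, \<phi>, E) \<in> A \<and> openin M W \<and> x \<in> W \<and> W \<subseteq> U \<and> W \<subseteq> P \<and>
        smooth_map E real_tvs (\<phi> ` W) (restrict (g \<circ> \<Phi>) P \<circ> inv_into U \<phi>)"
      using c1 U' by blast
  qed simp
  then show "restrict (g \<circ> \<Phi>) {x \<in> topspace M. \<Phi> x \<in> W} \<in> cinf_sheaf M A {x \<in> topspace M. \<Phi> x \<in> W}"
    by (simp add: P_def)
qed

text \<open>
  The pullback along \<open>\<Phi>\<close> of a chart of \<open>N\<close> followed by a functional is smooth, so the local
  representatives of \<open>\<Phi>\<close> are scalarwise smooth.
\<close>

lemma lrs_morphism_imp_smooth:
  assumes A: "maximal_atlas cinf_lcs M A" and B: "maximal_atlas mackey_lcs N B"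
    and \<Phi>: "lrs_morphism M (cinf_sheaf M A) N (cinf_sheaf N B) \<Phi>"
  shows "smooth_manifold_map M A N B \<Phi>"
proof -
  have lcs: "\<forall>E\<in>cinf_lcs. lcs E" "\<forall>F\<in>mackey_lcs. lcs F"
    by (simp_all add: cinf_lcs_def mackey_lcs_def)
  have at: "smooth_atlas cinf_lcs M A" "smooth_atlas mackey_lcs N B"
    using A B by (simp_all add: maximal_atlas_def)
  have cont: "continuous_map M N \<Phi>"
    using \<Phi> by (simp add: lrs_morphism_def)
  have rep: "smooth_map E F (\<phi> ` U) (\<psi> \<circ> \<Phi> \<circ> inv_into U \<phi>)"
    if c: "(U, \<phi>, E) \<in> A" and c': "(V, \<psi>, F) \<in> B" and UV: "\<Phi> ` U \<subseteq> V" for U \<phi> E V \<psi> F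
  proof -
    note ch = atlas_chart[OF lcs(1) at(1) c] and ch' = atlas_chart[OF lcs(2) at(2) c']
    have V: "openin N V"
      by (rule chart_open[OF ch'(1)])
    define P where "P = {x \<in> topspace M. \<Phi> x \<in> V}"
    have UP: "U \<subseteq> P"
      using UV openin_subset[OF chart_open[OF ch(1)]] by (auto simp: P_def)
    show ?thesis
    proof (rule scalarwise_smooth_imp_smooth[OF chart_space[OF ch(1)] chart_space[OF ch'(1)]])
      show "openin (topo E) (\<phi> ` U)"
        by (rule chart_image_open[OF ch(1) chart_open[OF ch(1)] subset_refl])
      have "\<psi> ` V \<subseteq> carrier F"
        using openin_subset[OF chart_image_open[OF ch'(1) V subset_refl]] lcs_topspace[OF ch'(2)] by simp
      then show "(\<psi> \<circ> \<Phi> \<circ> inv_into U \<phi>) y \<in> carrier F" if "y \<in> \<phi> ` U" for y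
        using that UV by (auto simp: chart_inv[OF ch(1)] image_subset_iff)
      fix l assume l: "l \<in> dual F"
      have "(\<lambda>x\<in>V. l (\<psi> x)) \<in> cinf_sheaf N B V"
        by (rule adapted_dual_section[OF ch' maximal_atlas_adapted[OF lcs(2) B c'] l V subset_refl])
      then have "restrict ((\<lambda>x\<in>V. l (\<psi> x)) \<circ> \<Phi>) P \<in> cinf_sheaf M A P"
        using \<Phi> V unfolding lrs_morphism_def P_def by blast
      then have "smooth_map E real_tvs (\<phi> ` U) (restrict ((\<lambda>x\<in>V. l (\<psi> x)) \<circ> \<Phi>) P \<circ> inv_into U \<phi>)"
        using c UP by (simp add: mem_cinf_sheaf_iff)
      then show "smooth_map E real_tvs (\<phi> ` U) (\<lambda>y. l ((\<psi> \<circ> \<Phi> \<circ> inv_into U \<phi>) y))"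
        by (rule smooth_map_cong[OF ch(2)]) (use UP UV in \<open>auto simp: chart_inv[OF ch(1)]\<close>)
    qed
  qed
  show ?thesis
    by (auto simp: smooth_manifold_map_def intro!: cont rep)
qed

section \<open>The atlas of a structure sheaf\<close>

context
  fixes X :: "'x topology" and \<O> :: "'x fun_sheaf"
  assumes sheaf: "algebra_sheaf X \<O>"
begin

lemma sheaf_extensional: "openin X V \<Longrightarrow> f \<in> \<O> V \<Longrightarrow> f \<in> extensional V"
  using sheaf by (auto simp: algebra_sheaf_def)

lemma sheaf_restrict: "openin X U \<Longrightarrow> openin X V \<Longrightarrow> V \<subseteq> U \<Longrightarrow> f \<in> \<O> U \<Longrightarrow> restrict f V \<in> \<O> V"
  using sheaf by (simp add: algebra_sheaf_def)

lemma sheaf_locally: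
  assumes f: "f \<in> extensional V"
    and local: "\<And>x. x \<in> V \<Longrightarrow> \<exists>W. openin X W \<and> x \<in> W \<and> W \<subseteq> V \<and> restrict f W \<in> \<O> W"
  shows "f \<in> \<O> V"
proof -
  define \<W> where "\<W> = {W. openin X W \<and> W \<subseteq> V \<and> restrict f W \<in> \<O> W}"
  have V: "\<Union>\<W> = V"
    using local by (auto simp: \<W>_def)
  have "\<forall>W\<in>\<W>. openin X W \<and> restrict f W \<in> \<O> W"
    by (simp add: \<W>_def)
  then have "f \<in> \<O> (\<Union>\<W>)"
    using sheaf f unfolding algebra_sheaf_def V[symmetric] by blast
  then show ?thesis
    by (simp only: V)
qed

text \<open>
  A functional composed with \<open>\<phi>\<close> is a section of \<open>\<O>\<close>, and a section read through \<open>\<psi>\<close> is smooth: the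
  transition map is scalarwise smooth.
\<close>

lemma adapted_charts_transition:
  assumes c: "is_chart cinf_lcs X (U, \<phi>, E)" "adapted_chart X \<O> (U, \<phi>, E)"
    and c': "is_chart cinf_lcs X (U', \<psi>, F)" "adapted_chart X \<O> (U', \<psi>, F)"
  shows "smooth_transition (U, \<phi>, E) (U', \<psi>, F)"
proof -
  have F: "F \<in> cinf_lcs" "lcs F" and E: "E \<in> mackey_lcs" "lcs E"
    using chart_space[OF c(1)] chart_space[OF c'(1)] by (auto simp: cinf_lcs_def mackey_lcs_def)
  have W: "openin X (U \<inter> U')"
    using chart_open[OF c(1)] chart_open[OF c'(1)] by blast
  have "smooth_map F E (\<psi> ` (U \<inter> U')) (\<phi> \<circ> inv_into U' \<psi>)"
  proof (rule scalarwise_smooth_imp_smooth[OF F(1) E(1) chart_image_open[OF c'(1) W Int_lower2]])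
    have "\<phi> ` U \<subseteq> carrier E"
      using openin_subset[OF chart_image_open[OF c(1) chart_open[OF c(1)] subset_refl]] lcs_topspace[OF E(2)] by simp
    then show "(\<phi> \<circ> inv_into U' \<psi>) y \<in> carrier E" if "y \<in> \<psi> ` (U \<inter> U')" for y
      using that by (auto simp: chart_inv[OF c'(1)] image_subset_iff)
    fix l assume l: "l \<in> dual E"
    have "(\<lambda>x\<in>U \<inter> U'. l (\<phi> x)) \<in> \<O> (U \<inter> U')"
      by (rule adapted_dual_section[OF c(1) E(2) c(2) l W Int_lower1])
    then have "smooth_map F real_tvs (\<psi> ` (U \<inter> U')) ((\<lambda>x\<in>U \<inter> U'. l (\<phi> x)) \<circ> inv_into U' \<psi>)"
      using adapted_chartD[OF c'(2) W Int_lower2, of "\<lambda>x\<in>U \<inter> U'. l (\<phi> x)"] by simp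
    then show "smooth_map F real_tvs (\<psi> ` (U \<inter> U')) (\<lambda>y. l ((\<phi> \<circ> inv_into U' \<psi>) y))"
      by (rule smooth_map_cong[OF F(2)]) (auto simp: chart_inv[OF c'(1)])
  qed
  then show ?thesis
    by (simp add: smooth_transition_def)
qed

text \<open>
  The two implications in \<open>adapted_chart\<close> are the pullbacks along the two mutually inverse morphisms.
\<close>

lemma lrs_isomorphism_adapted_chart:
  assumes U: "openin X U" and E: "E \<in> \<E>" "lcs E" and D: "openin (topo E) D"
    and iso: "lrs_isomorphic (subtopology X U) \<O> (subtopology (topo E) D) (cinf_model E)"
  obtains \<phi> where "is_chart \<E> X (U, \<phi>, E)" "adapted_chart X \<O> (U, \<phi>, E)"
proof -
  have tU: "topspace (subtopology X U) = U"
    using openin_subset[OF U] by auto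
  have tD: "topspace (subtopology (topo E) D) = D"
    using openin_subset[OF D] by auto
  obtain \<phi> \<psi> where \<phi>: "lrs_morphism (subtopology X U) \<O> (subtopology (topo E) D) (cinf_model E) \<phi>"
    and \<psi>: "lrs_morphism (subtopology (topo E) D) (cinf_model E) (subtopology X U) \<O> \<psi>"
    and inv: "\<forall>x\<in>U. \<psi> (\<phi> x) = x" "\<forall>y\<in>D. \<phi> (\<psi> y) = y"
    using iso unfolding lrs_isomorphic_def tU tD by blast
  have homeo: "homeomorphic_maps (subtopology X U) (subtopology (topo E) D) \<phi> \<psi>"
    using \<phi> \<psi> inv by (simp add: homeomorphic_maps_def lrs_morphism_def tU tD)
  then have hm: "homeomorphic_map (subtopology X U) (subtopology (topo E) D) \<phi>"
    by (rule homeomorphic_maps_imp_map)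
  have image: "\<phi> ` U = D"
    using homeomorphic_imp_surjective_map[OF hm] by (simp only: tU tD)
  have c: "is_chart \<E> X (U, \<phi>, E)"
    using U E(1) D hm by (simp add: is_chart_def image)
  have "f \<in> \<O> V \<longleftrightarrow> smooth_map E real_tvs (\<phi> ` V) (f \<circ> inv_into U \<phi>)"
    if V: "openin X V" "V \<subseteq> U" and f: "f \<in> extensional V" for V f
  proof
    have VU: "openin (subtopology X U) V"
      using V U by (simp add: openin_open_subtopology)
    have set: "{y \<in> D. \<psi> y \<in> V} = \<phi> ` V"
      using inv V(2) image by (auto simp: image_iff)
    assume "f \<in> \<O> V"
    then have "restrict (f \<circ> \<psi>) (\<phi> ` V) \<in> cinf_model E (\<phi> ` V)"
      using \<psi> VU unfolding lrs_morphism_def tD set[symmetric] by blast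
    then have "smooth_map E real_tvs (\<phi> ` V) (restrict (f \<circ> \<psi>) (\<phi> ` V))"
      by (simp add: cinf_model_def)
    then show "smooth_map E real_tvs (\<phi> ` V) (f \<circ> inv_into U \<phi>)"
      by (rule smooth_map_cong[OF E(2)]) (use V(2) inv(1) in \<open>auto simp: chart_inv[OF c]\<close>)
  next
    assume sm: "smooth_map E real_tvs (\<phi> ` V) (f \<circ> inv_into U \<phi>)"
    have "\<phi> ` V \<subseteq> D"
      using V(2) image by blast
    then have WD: "openin (subtopology (topo E) D) (\<phi> ` V)"
      using chart_image_open[OF c V] D by (simp add: openin_open_subtopology)
    have set: "{x \<in> U. \<phi> x \<in> \<phi> ` V} = V"
      using V(2) chart_inj_on[OF c] by (auto simp: inj_on_def)
    let ?g = "restrict (f \<circ> inv_into U \<phi>) (\<phi> ` V)"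
    have "smooth_map E real_tvs (\<phi> ` V) ?g"
      using sm by (rule smooth_map_cong[OF E(2)]) simp
    then have "?g \<in> cinf_model E (\<phi> ` V)"
      by (simp add: cinf_model_def)
    then have "restrict (?g \<circ> \<phi>) {x \<in> U. \<phi> x \<in> \<phi> ` V} \<in> \<O> {x \<in> U. \<phi> x \<in> \<phi> ` V}"
      using \<phi> WD unfolding lrs_morphism_def tU by blast
    then have "restrict (?g \<circ> \<phi>) V \<in> \<O> V"
      by (simp only: set)
    moreover have "restrict (?g \<circ> \<phi>) V = f"
      using f V(2) by (intro extensionalityI[of _ V]) (auto simp: chart_inv[OF c])
    ultimately show "f \<in> \<O> V"
      by simp
  qed
  then have "adapted_chart X \<O> (U, \<phi>, E)"
    by (simp add: adapted_chart_def)
  with c show thesis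
    by (rule that)
qed

end

definition sheaf_atlas :: "'e tvs set \<Rightarrow> 'x topology \<Rightarrow> 'x fun_sheaf \<Rightarrow> ('x, 'e) chart set" where
  "sheaf_atlas \<E> X \<O> = {c. is_chart \<E> X c \<and> adapted_chart X \<O> c}"

context
  fixes X :: "'x topology" and \<O> :: "'x fun_sheaf"
  assumes mfd: "sheaf_smooth_manifold (cinf_lcs :: 'e tvs set) X \<O>"
begin

lemma structure_sheaf: "algebra_sheaf X \<O>"
  using mfd by (simp add: sheaf_smooth_manifold_def reduced_lrs_def)

lemma sheaf_atlas_smooth: "smooth_atlas cinf_lcs X (sheaf_atlas cinf_lcs X \<O> :: ('x, 'e) chart set)"
  unfolding smooth_atlas_def
proof (intro conjI ballI)
  show "is_chart cinf_lcs X c" if "c \<in> sheaf_atlas cinf_lcs X \<O>" for c :: "('x, 'e) chart"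
    using that by (simp add: sheaf_atlas_def)
  show "smooth_transition c c'"
    if "c \<in> sheaf_atlas cinf_lcs X \<O>" "c' \<in> sheaf_atlas cinf_lcs X \<O>" for c c' :: "('x, 'e) chart"
  proof -
    obtain U \<phi> E U' \<psi> F where "c = (U, \<phi>, E)" "c' = (U', \<psi>, F)"
      by (cases c; cases c')
    then show ?thesis
      using that by (auto simp: sheaf_atlas_def intro: adapted_charts_transition[OF structure_sheaf])
  qed
  show "(\<Union>c\<in>sheaf_atlas cinf_lcs X \<O> :: ('x, 'e) chart set. fst c) = topspace X"
  proof (intro equalityI subsetI)
    fix x assume "x \<in> (\<Union>c\<in>sheaf_atlas cinf_lcs X \<O> :: ('x, 'e) chart set. fst c)"
    then obtain U \<phi> and E :: "'e tvs" where "(U, \<phi>, E) \<in> sheaf_atlas cinf_lcs X \<O>" "x \<in> U"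
      by auto
    then show "x \<in> topspace X"
      using openin_subset[OF chart_open] by (fastforce simp: sheaf_atlas_def)
  next
    fix x assume "x \<in> topspace X"
    then obtain U and E :: "'e tvs" and D where U: "openin X U" "x \<in> U" and E: "E \<in> cinf_lcs"
      and D: "openin (topo E) D"
      and iso: "lrs_isomorphic (subtopology X U) \<O> (subtopology (topo E) D) (cinf_model E)"
      using mfd unfolding sheaf_smooth_manifold_def by blast
    obtain \<phi> where "is_chart cinf_lcs X (U, \<phi>, E)" "adapted_chart X \<O> (U, \<phi>, E)"
      by (rule lrs_isomorphism_adapted_chart[OF structure_sheaf U(1) E cinf_lcs_lcs[THEN bspec, OF E] D iso])
    then show "x \<in> (\<Union>c\<in>sheaf_atlas cinf_lcs X \<O> :: ('x, 'e) chart set. fst c)"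
      using U(2) by (force simp: sheaf_atlas_def)
  qed
qed

lemma sheaf_atlas_at:
  assumes "x \<in> topspace X"
  obtains U \<phi> and E :: "'e tvs" where "(U, \<phi>, E) \<in> sheaf_atlas cinf_lcs X \<O>" "x \<in> U"
    "is_chart cinf_lcs X (U, \<phi>, E)" "lcs E" "adapted_chart X \<O> (U, \<phi>, E)"
proof -
  obtain U \<phi> and E :: "'e tvs" where c: "(U, \<phi>, E) \<in> sheaf_atlas cinf_lcs X \<O>" "x \<in> U"
    by (rule atlas_cover[OF cinf_lcs_lcs sheaf_atlas_smooth assms])
  then show thesis
    using that atlas_chart[OF cinf_lcs_lcs sheaf_atlas_smooth c(1)] by (simp add: sheaf_atlas_def)
qed

text \<open>
  Membership in \<open>\<O>\<close> and smoothness are both local, and near each point both can be read off in an adapted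
  chart, to which smoothness is transported by the transition maps.
\<close>

lemma compatible_chart_adapted:
  fixes E :: "'e tvs"
  assumes c: "is_chart cinf_lcs X (U, \<phi>, E)"
    and compat: "\<And>c'. c' \<in> sheaf_atlas cinf_lcs X \<O> \<Longrightarrow>
      smooth_transition (U, \<phi>, E) c' \<and> smooth_transition c' (U, \<phi>, E)"
  shows "adapted_chart X \<O> (U, \<phi>, E)"
proof -
  note E = cinf_lcs_lcs[THEN bspec, OF chart_space[OF c]]
  have "f \<in> \<O> V \<longleftrightarrow> smooth_map E real_tvs (\<phi> ` V) (f \<circ> inv_into U \<phi>)"
    if V: "openin X V" "V \<subseteq> U" and f: "f \<in> extensional V" for V f
  proof
    assume fO: "f \<in> \<O> V"
    show "smooth_map E real_tvs (\<phi> ` V) (f \<circ> inv_into U \<phi>)"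
    proof (rule smooth_map_locally[OF E lcs_real_tvs chart_image_open[OF c V]])
      fix y assume "y \<in> \<phi> ` V"
      then obtain x where x: "x \<in> V" "y = \<phi> x"
        by blast
      then have "x \<in> topspace X"
        using openin_subset[OF V(1)] by blast
      then obtain U' \<psi> and F :: "'e tvs" where c': "(U', \<psi>, F) \<in> sheaf_atlas cinf_lcs X \<O>" "x \<in> U'"
        and ch': "is_chart cinf_lcs X (U', \<psi>, F)" "lcs F" and ad': "adapted_chart X \<O> (U', \<psi>, F)"
        by (rule sheaf_atlas_at)
      have W: "openin X (V \<inter> U')" "V \<inter> U' \<subseteq> U'" "V \<inter> U' \<subseteq> U"
        using V chart_open[OF ch'(1)] by auto
      have "restrict f (V \<inter> U') \<in> \<O> (V \<inter> U')"
        by (rule sheaf_restrict[OF structure_sheaf V(1) W(1) Int_lower1 fO])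
      then have "smooth_map F real_tvs (\<psi> ` (V \<inter> U')) (restrict f (V \<inter> U') \<circ> inv_into U' \<psi>)"
        using adapted_chartD[OF ad' W(1,2), of "restrict f (V \<inter> U')"] by simp
      then have "smooth_map E real_tvs (\<phi> ` (V \<inter> U')) (restrict f (V \<inter> U') \<circ> inv_into U \<phi>)"
        by (rule smooth_representative_transition[OF ch' c E lcs_real_tvs compat[OF c'(1), THEN conjunct2] W])
      then have "smooth_map E real_tvs (\<phi> ` (V \<inter> U')) (f \<circ> inv_into U \<phi>)"
        by (rule smooth_map_cong[OF E]) (use V(2) in \<open>auto simp: chart_inv[OF c]\<close>)
      then show "\<exists>W. y \<in> W \<and> W \<subseteq> \<phi> ` V \<and> smooth_map E real_tvs W (f \<circ> inv_into U \<phi>)"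
        using x c'(2) by (intro exI[of _ "\<phi> ` (V \<inter> U')"]) auto
    qed
  next
    assume sm: "smooth_map E real_tvs (\<phi> ` V) (f \<circ> inv_into U \<phi>)"
    show "f \<in> \<O> V"
    proof (rule sheaf_locally[OF structure_sheaf f])
      fix x assume x: "x \<in> V"
      then have "x \<in> topspace X"
        using openin_subset[OF V(1)] by blast
      then obtain U' \<psi> and F :: "'e tvs" where c': "(U', \<psi>, F) \<in> sheaf_atlas cinf_lcs X \<O>" "x \<in> U'"
        and ch': "is_chart cinf_lcs X (U', \<psi>, F)" "lcs F" and ad': "adapted_chart X \<O> (U', \<psi>, F)"
        by (rule sheaf_atlas_at)
      have W: "openin X (V \<inter> U')" "V \<inter> U' \<subseteq> U" "V \<inter> U' \<subseteq> U'"
        using V chart_open[OF ch'(1)] by auto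
      have "smooth_map E real_tvs (\<phi> ` (V \<inter> U')) (f \<circ> inv_into U \<phi>)"
        by (rule smooth_map_subset[OF E lcs_real_tvs sm chart_image_open[OF c W(1,2)]]) auto
      then have "smooth_map F real_tvs (\<psi> ` (V \<inter> U')) (f \<circ> inv_into U' \<psi>)"
        by (rule smooth_representative_transition[OF c E ch' lcs_real_tvs compat[OF c'(1), THEN conjunct1] W])
      then have "smooth_map F real_tvs (\<psi> ` (V \<inter> U')) (restrict f (V \<inter> U') \<circ> inv_into U' \<psi>)"
        by (rule smooth_map_cong[OF ch'(2)]) (auto simp: chart_inv[OF ch'(1)])
      then have "restrict f (V \<inter> U') \<in> \<O> (V \<inter> U')"
        using adapted_chartD[OF ad' W(1,3), of "restrict f (V \<inter> U')"] by simp
      then show "\<exists>W. openin X W \<and> x \<in> W \<and> W \<subseteq> V \<and> restrict f W \<in> \<O> W"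
        using W(1) x c'(2) by (intro exI[of _ "V \<inter> U'"]) auto
    qed
  qed
  then show ?thesis
    by (simp add: adapted_chart_def)
qed

lemma sheaf_atlas_maximal: "maximal_atlas cinf_lcs X (sheaf_atlas cinf_lcs X \<O> :: ('x, 'e) chart set)"
  unfolding maximal_atlas_def
proof (intro conjI allI impI sheaf_atlas_smooth)
  fix c :: "('x, 'e) chart"
  assume c: "is_chart cinf_lcs X c \<and> (\<forall>c'\<in>sheaf_atlas cinf_lcs X \<O>. smooth_transition c c' \<and> smooth_transition c' c)"
  obtain U \<phi> E where c_eq: "c = (U, \<phi>, E)"
    by (cases c)
  have "adapted_chart X \<O> (U, \<phi>, E)"
    using c by (intro compatible_chart_adapted) (simp_all add: c_eq)
  then show "c \<in> sheaf_atlas cinf_lcs X \<O>"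
    using c by (simp add: sheaf_atlas_def c_eq)
qed

text \<open>
  The charts of \<open>sheaf_atlas\<close>, restricted to \<open>V\<close>, cover \<open>V\<close>. On each of them both sides consist of the functions
  with smooth representative, and both sides are determined locally.
\<close>

lemma cinf_sheaf_sheaf_atlas:
  assumes V: "openin X V"
  shows "cinf_sheaf X (sheaf_atlas cinf_lcs X \<O> :: ('x, 'e) chart set) V = \<O> V"
proof (intro equalityI subsetI)
  fix f assume f: "f \<in> cinf_sheaf X (sheaf_atlas cinf_lcs X \<O> :: ('x, 'e) chart set) V"
  show "f \<in> \<O> V"
  proof (rule sheaf_locally[OF structure_sheaf])
    show "f \<in> extensional V"
      using f by (simp add: mem_cinf_sheaf_iff)
    fix x assume x: "x \<in> V"
    then have "x \<in> topspace X"
      using openin_subset[OF V] by blast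
    then obtain U \<phi> and E :: "'e tvs" where c: "(U, \<phi>, E) \<in> sheaf_atlas cinf_lcs X \<O>" "x \<in> U"
      and ch: "is_chart cinf_lcs X (U, \<phi>, E)" "lcs E" and ad: "adapted_chart X \<O> (U, \<phi>, E)"
      by (rule sheaf_atlas_at)
    have W: "openin X (V \<inter> U)" "V \<inter> U \<subseteq> U" "V \<inter> U \<subseteq> V"
      using V chart_open[OF ch(1)] by auto
    have "(V \<inter> U, \<phi>, E) \<in> sheaf_atlas cinf_lcs X \<O>"
      by (rule maximal_atlas_restrict[OF cinf_lcs_lcs sheaf_atlas_maximal c(1) W(1,2)])
    then have "smooth_map E real_tvs (\<phi> ` (V \<inter> U)) (f \<circ> inv_into (V \<inter> U) \<phi>)"
      using f W(3) by (simp add: mem_cinf_sheaf_iff)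
    then have "smooth_map E real_tvs (\<phi> ` (V \<inter> U)) (restrict f (V \<inter> U) \<circ> inv_into U \<phi>)"
      by (rule smooth_map_cong[OF ch(2)]) (auto simp: chart_inv[OF ch(1)] chart_inv_subset[OF ch(1) W(2)])
    then have "restrict f (V \<inter> U) \<in> \<O> (V \<inter> U)"
      using adapted_chartD[OF ad W(1,2), of "restrict f (V \<inter> U)"] by simp
    then show "\<exists>W. openin X W \<and> x \<in> W \<and> W \<subseteq> V \<and> restrict f W \<in> \<O> W"
      using W x c(2) by (intro exI[of _ "V \<inter> U"]) auto
  qed
next
  fix f assume f: "f \<in> \<O> V"
  show "f \<in> cinf_sheaf X (sheaf_atlas cinf_lcs X \<O> :: ('x, 'e) chart set) V"
  proof (rule cinf_sheaf_locally[OF cinf_lcs_lcs sheaf_atlas_smooth V sheaf_extensional[OF structure_sheaf V f]])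
    fix x assume x: "x \<in> V"
    then have "x \<in> topspace X"
      using openin_subset[OF V] by blast
    then obtain U \<phi> and E :: "'e tvs" where c: "(U, \<phi>, E) \<in> sheaf_atlas cinf_lcs X \<O>" "x \<in> U"
      and ch: "is_chart cinf_lcs X (U, \<phi>, E)" "lcs E" and ad: "adapted_chart X \<O> (U, \<phi>, E)"
      by (rule sheaf_atlas_at)
    have W: "openin X (V \<inter> U)" "V \<inter> U \<subseteq> U" "V \<inter> U \<subseteq> V"
      using V chart_open[OF ch(1)] by auto
    have "restrict f (V \<inter> U) \<in> \<O> (V \<inter> U)"
      by (rule sheaf_restrict[OF structure_sheaf V W(1,3) f])
    then have "smooth_map E real_tvs (\<phi> ` (V \<inter> U)) (restrict f (V \<inter> U) \<circ> inv_into U \<phi>)"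
      using adapted_chartD[OF ad W(1,2), of "restrict f (V \<inter> U)"] by simp
    then have "smooth_map E real_tvs (\<phi> ` (V \<inter> U)) (f \<circ> inv_into U \<phi>)"
      by (rule smooth_map_cong[OF ch(2)]) (auto simp: chart_inv[OF ch(1)])
    then show "\<exists>U \<phi> E W. (U, \<phi>, E) \<in> (sheaf_atlas cinf_lcs X \<O> :: ('x, 'e) chart set) \<and> openin X W \<and> x \<in> W \<and>
        W \<subseteq> U \<and> W \<subseteq> V \<and> smooth_map E real_tvs (\<phi> ` W) (f \<circ> inv_into U \<phi>)"
      using c W x by (intro exI[of _ U] exI[of _ \<phi>] exI[of _ E] exI[of _ "V \<inter> U"]) simp
  qed
qed

text \<open>
  Charts of a maximal atlas are adapted to its sheaf of smooth functions, which is \<open>\<O>\<close>. So \<open>A\<close> is contained in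
  \<open>sheaf_atlas\<close>, whose charts are then all compatible with \<open>A\<close> and belong to it by maximality.
\<close>

lemma sheaf_atlas_unique:
  fixes A :: "('x, 'e) chart set"
  assumes A: "maximal_atlas cinf_lcs X A" and eq: "\<And>V. openin X V \<Longrightarrow> cinf_sheaf X A V = \<O> V"
  shows "A = sheaf_atlas cinf_lcs X \<O>"
proof
  have at: "smooth_atlas cinf_lcs X A"
    using A by (simp add: maximal_atlas_def)
  show sub: "A \<subseteq> sheaf_atlas cinf_lcs X \<O>"
  proof
    fix c assume c: "c \<in> A"
    obtain U \<phi> E where c_eq: "c = (U, \<phi>, E)"
      by (cases c)
    have "adapted_chart X (cinf_sheaf X A) (U, \<phi>, E)"
      using maximal_atlas_adapted[OF cinf_lcs_lcs A] c by (simp add: c_eq)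
    then have "adapted_chart X \<O> (U, \<phi>, E)"
      using eq by (simp add: adapted_chart_def)
    then show "c \<in> sheaf_atlas cinf_lcs X \<O>"
      using at c by (simp add: sheaf_atlas_def smooth_atlas_def c_eq)
  qed
  show "sheaf_atlas cinf_lcs X \<O> \<subseteq> A"
  proof
    fix c :: "('x, 'e) chart" assume c: "c \<in> sheaf_atlas cinf_lcs X \<O>"
    then have "smooth_transition c c' \<and> smooth_transition c' c" if "c' \<in> A" for c'
      using that sub atlas_transition[OF sheaf_atlas_smooth] by blast
    moreover have "is_chart cinf_lcs X c"
      using c by (simp add: sheaf_atlas_def)
    ultimately show "c \<in> A"
      using A unfolding maximal_atlas_def by blast
  qed
qed

end

theorem theoremB:
  fixes M :: "'m topology" and A :: "('m, 'e) chart set"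
    and N :: "'n topology" and B :: "('n, 'f) chart set" and \<Phi> :: "'m \<Rightarrow> 'n"
    and X :: "'x topology" and \<O> :: "'x fun_sheaf"
  shows "(smooth_manifold cinf_lcs M A \<and> smooth_manifold mackey_lcs N B \<and> continuous_map M N \<Phi> \<longrightarrow>
      (smooth_manifold_map M A N B \<Phi> \<longleftrightarrow>
        lrs_morphism M (cinf_sheaf M A) N (cinf_sheaf N B) \<Phi>)) \<and>
    (sheaf_smooth_manifold (cinf_lcs :: 'g tvs set) X \<O> \<longrightarrow>
      (\<exists>!\<A>. smooth_manifold (cinf_lcs :: 'g tvs set) X \<A> \<and>
        (\<forall>U. openin X U \<longrightarrow> cinf_sheaf X \<A> U = \<O> U)))"
proof (intro conjI impI)
  assume "smooth_manifold cinf_lcs M A \<and> smooth_manifold mackey_lcs N B \<and> continuous_map M N \<Phi>"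
  then have A: "maximal_atlas cinf_lcs M A" and B: "maximal_atlas mackey_lcs N B"
    by (simp_all add: smooth_manifold_def)
  show "smooth_manifold_map M A N B \<Phi> \<longleftrightarrow> lrs_morphism M (cinf_sheaf M A) N (cinf_sheaf N B) \<Phi>"
    using smooth_imp_lrs_morphism[OF cinf_lcs_lcs mackey_lcs_lcs A B] lrs_morphism_imp_smooth[OF A B] by blast
next
  assume X: "sheaf_smooth_manifold (cinf_lcs :: 'g tvs set) X \<O>"
  show "\<exists>!\<A>. smooth_manifold (cinf_lcs :: 'g tvs set) X \<A> \<and> (\<forall>U. openin X U \<longrightarrow> cinf_sheaf X \<A> U = \<O> U)"
  proof (rule ex1I)
    show "smooth_manifold (cinf_lcs :: 'g tvs set) X (sheaf_atlas cinf_lcs X \<O>) \<and>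
        (\<forall>U. openin X U \<longrightarrow> cinf_sheaf X (sheaf_atlas (cinf_lcs :: 'g tvs set) X \<O>) U = \<O> U)"
      using X sheaf_atlas_maximal[OF X] cinf_sheaf_sheaf_atlas[OF X]
      by (simp add: smooth_manifold_def sheaf_smooth_manifold_def)
    show "\<A> = sheaf_atlas cinf_lcs X \<O>"
      if "smooth_manifold (cinf_lcs :: 'g tvs set) X \<A> \<and> (\<forall>U. openin X U \<longrightarrow> cinf_sheaf X \<A> U = \<O> U)" for \<A>
      using that sheaf_atlas_unique[OF X] by (simp add: smooth_manifold_def)
  qed
qed

end
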